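(* There exist finitely presented, residually finite groups whose profinite genus is countably infinite.
   Context: The profinite genus of a finitely generated, residually finite group $\Gamma$ is the set of isomorphism classes of finitely generated, residually finite groups $H$ such that $\widehat{H}\cong\widehat{\Gamma}$, where $\widehat{G}$ denotes the profinite completion of a group $G$. *)

theory Defs
  imports "HOL-Algebra.Product_Groups" "HOL-Algebra.Generated_Groups" "HOL-Analysis.Analysis"
begin

section \<open>Finitely generated and finitely presented groups\<close>

definition finitely_generated :: "('a, 'b) monoid_scheme \<Rightarrow> bool"
  where "finitely_generated G \<longleftrightarrow>
    group G \<and> (\<exists>S. finite S \<and> S \<subseteq> carrier G \<and> generate G S = carrier G)"

text \<open>A letter \<open>(True, x)\<close> stands for the generator \<open>x\<close>, and \<open>(False, x)\<close> for its formal inverse.\<close>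

definition group_words :: "'x set \<Rightarrow> (bool \<times> 'x) list set"
  where "group_words X = lists (UNIV \<times> X)"

inductive_set word_rel :: "'x set \<Rightarrow> ((bool \<times> 'x) list \<times> (bool \<times> 'x) list) set" for X
  where
    word_rel_refl: "u \<in> group_words X \<Longrightarrow> (u, u) \<in> word_rel X"
  | word_rel_sym: "(u, v) \<in> word_rel X \<Longrightarrow> (v, u) \<in> word_rel X"
  | word_rel_trans: "(u, v) \<in> word_rel X \<Longrightarrow> (v, w) \<in> word_rel X \<Longrightarrow> (u, w) \<in> word_rel X"
  | word_rel_cancel: "u \<in> group_words X \<Longrightarrow> v \<in> group_words X \<Longrightarrow> x \<in> X \<Longrightarrow>
      (u @ [(b, x), (\<not> b, x)] @ v, u @ v) \<in> word_rel X"

definition free_group :: "'x set \<Rightarrow> (bool \<times> 'x) list set monoid"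
  where "free_group X =
    \<lparr>carrier = group_words X // word_rel X,
     monoid.mult = (\<lambda>A B. \<Union>u\<in>A. \<Union>v\<in>B. word_rel X `` {u @ v}),
     one = word_rel X `` {[]}\<rparr>"

definition normal_closure :: "('a, 'b) monoid_scheme \<Rightarrow> 'a set \<Rightarrow> 'a set"
  where "normal_closure G R = \<Inter> {N. N \<lhd> G \<and> R \<subseteq> N}"

text \<open>Every finite set of generators can be relabelled by natural numbers.\<close>

definition finitely_presented :: "('a, 'b) monoid_scheme \<Rightarrow> bool"
  where "finitely_presented G \<longleftrightarrow>
    group G \<and>
    (\<exists>(X :: nat set) R. finite X \<and> finite R \<and> R \<subseteq> carrier (free_group X) \<and>
       G \<cong> free_group X Mod normal_closure (free_group X) R)"


section \<open>Residual finiteness and profinite completion\<close>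

definition finite_index_normal :: "('a, 'b) monoid_scheme \<Rightarrow> 'a set set"
  where "finite_index_normal G = {N. N \<lhd> G \<and> finite (rcosets\<^bsub>G\<^esub> N)}"

definition residually_finite :: "('a, 'b) monoid_scheme \<Rightarrow> bool"
  where "residually_finite G \<longleftrightarrow>
    group G \<and> (\<forall>g\<in>carrier G. g \<noteq> \<one>\<^bsub>G\<^esub> \<longrightarrow> (\<exists>N\<in>finite_index_normal G. g \<notin> N))"

text \<open>
  The profinite completion is the inverse limit of the finite quotients \<open>G/N\<close>, realised inside
  their product. For \<open>N \<subseteq> M\<close> the transition map \<open>G/N \<rightarrow> G/M\<close> sends a coset \<open>C\<close> of \<open>N\<close> to the
  coset \<open>M C\<close> of \<open>M\<close>.
\<close>

definition profinite_completion :: "('a, 'b) monoid_scheme \<Rightarrow> ('a set \<Rightarrow> 'a set) monoid"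
  where "profinite_completion G =
    (product_group (finite_index_normal G) (\<lambda>N. G Mod N))
      \<lparr>carrier := {f \<in> carrier (product_group (finite_index_normal G) (\<lambda>N. G Mod N)).
         \<forall>N\<in>finite_index_normal G. \<forall>M\<in>finite_index_normal G.
           N \<subseteq> M \<longrightarrow> f M = M <#>\<^bsub>G\<^esub> f N}\<rparr>"

definition profinite_topology :: "('a, 'b) monoid_scheme \<Rightarrow> ('a set \<Rightarrow> 'a set) topology"
  where "profinite_topology G =
    subtopology
      (product_topology (\<lambda>N. discrete_topology (carrier (G Mod N))) (finite_index_normal G))
      (carrier (profinite_completion G))"

text \<open>Profinite completions are compared as topological groups.\<close>

definition isomorphic_profinite_completions ::
  "('a, 'b) monoid_scheme \<Rightarrow> ('c, 'd) monoid_scheme \<Rightarrow> bool"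
  where "isomorphic_profinite_completions G H \<longleftrightarrow>
    (\<exists>\<phi>\<in>iso (profinite_completion G) (profinite_completion H).
       homeomorphic_map (profinite_topology G) (profinite_topology H) \<phi>)"


section \<open>The profinite genus\<close>

text \<open>
  A finitely generated group is countable, hence isomorphic to a group whose carrier is a set of
  natural numbers (lemma \<open>finitely_generated_nat_copy\<close> below), so the isomorphism
  classes of all finitely generated groups are represented on the type \<open>nat\<close>.
\<close>

definition genus_groups :: "('a, 'b) monoid_scheme \<Rightarrow> nat monoid set"
  where "genus_groups G =
    {H. finitely_generated H \<and> residually_finite H \<and> isomorphic_profinite_completions H G}"

definition profinite_genus :: "('a, 'b) monoid_scheme \<Rightarrow> nat monoid set set"
  where "profinite_genus G =
    genus_groups G // {(H, K). H \<in> genus_groups G \<and> K \<in> genus_groups G \<and> H \<cong> K}"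


section \<open>Basic facts\<close>

lemma equiv_word_rel: "equiv (group_words X) (word_rel X)"
proof (rule equivI)
  have "u \<in> group_words X \<and> v \<in> group_words X" if "(u, v) \<in> word_rel X" for u v
    using that by induction (auto simp: group_words_def)
  then show "word_rel X \<subseteq> group_words X \<times> group_words X" by auto
  show "refl_on (group_words X) (word_rel X)"
    by (simp add: refl_on_def word_rel_refl)
  show "sym (word_rel X)" by (auto intro: symI word_rel_sym)
  show "trans (word_rel X)" by (auto intro: transI word_rel_trans)
qed

lemma word_rel_append:
  assumes "(u, u') \<in> word_rel X" "(v, v') \<in> word_rel X"
  shows "(u @ v, u' @ v') \<in> word_rel X"
proof -
  have words: "a \<in> group_words X" "b \<in> group_words X" if "(a, b) \<in> word_rel X" for a b
    using that equiv_word_rel[of X] by (auto simp: equiv_def)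
  have 1: "(a @ w, b @ w) \<in> word_rel X" if "(a, b) \<in> word_rel X" "w \<in> group_words X" for a b w
    using that
  proof induction
    case (word_rel_cancel u v x b)
    then show ?case
      using word_rel.word_rel_cancel[of u X "v @ w" x b] by (auto simp: group_words_def)
  qed (auto intro: word_rel.intros simp: group_words_def)
  have 2: "(w @ a, w @ b) \<in> word_rel X" if "(a, b) \<in> word_rel X" "w \<in> group_words X" for a b w
    using that
  proof induction
    case (word_rel_cancel u v x b)
    then show ?case
      using word_rel.word_rel_cancel[of "w @ u" X v x b] by (auto simp: group_words_def)
  qed (auto intro: word_rel.intros simp: group_words_def)
  show ?thesis
    using 1[OF assms(1) words(1)[OF assms(2)]] 2[OF assms(2) words(2)[OF assms(1)]]
    by (rule word_rel_trans)
qed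

lemma free_group_mult_class:
  assumes "u \<in> group_words X" "v \<in> group_words X"
  shows "word_rel X `` {u} \<otimes>\<^bsub>free_group X\<^esub> word_rel X `` {v} = word_rel X `` {u @ v}"
proof -
  have "(\<lambda>u v. word_rel X `` {u @ v}) respects2 word_rel X"
    by (intro congruent2I[OF equiv_word_rel equiv_word_rel])
       (auto intro!: equiv_class_eq[OF equiv_word_rel] word_rel_append word_rel_refl)
  then show ?thesis
    using assms UN_equiv_class2[OF equiv_word_rel equiv_word_rel] by (simp add: free_group_def)
qed

lemma group_free_group: "group (free_group X)"
proof (rule groupI)
  have app: "u @ v \<in> group_words X" if "u \<in> group_words X" "v \<in> group_words X" for u v
    using that by (auto simp: group_words_def)
  have nil: "[] \<in> group_words X" by (simp add: group_words_def)
  have one: "\<one>\<^bsub>free_group X\<^esub> = word_rel X `` {[]}" by (simp add: free_group_def)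
  have rep: "\<exists>u\<in>group_words X. A = word_rel X `` {u}" if "A \<in> carrier (free_group X)" for A
    using that by (auto simp: free_group_def elim: quotientE)
  have cls: "word_rel X `` {u} \<in> carrier (free_group X)" if "u \<in> group_words X" for u
    using that by (auto simp: free_group_def intro: quotientI)
  note m = free_group_mult_class
  show "\<one>\<^bsub>free_group X\<^esub> \<in> carrier (free_group X)"
    using cls[OF nil] one by simp
  show "A \<otimes>\<^bsub>free_group X\<^esub> B \<in> carrier (free_group X)"
    if "A \<in> carrier (free_group X)" "B \<in> carrier (free_group X)" for A B
    using that[THEN rep] cls app m by (metis (no_types, lifting))
  show "A \<otimes>\<^bsub>free_group X\<^esub> B \<otimes>\<^bsub>free_group X\<^esub> C = A \<otimes>\<^bsub>free_group X\<^esub> (B \<otimes>\<^bsub>free_group X\<^esub> C)"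
    if "A \<in> carrier (free_group X)" "B \<in> carrier (free_group X)" "C \<in> carrier (free_group X)"
    for A B C
    using that[THEN rep] by (auto simp: m app)
  show "\<one>\<^bsub>free_group X\<^esub> \<otimes>\<^bsub>free_group X\<^esub> A = A" if "A \<in> carrier (free_group X)" for A
    using rep[OF that] by (auto simp: m nil one)
  show "\<exists>B\<in>carrier (free_group X). B \<otimes>\<^bsub>free_group X\<^esub> A = \<one>\<^bsub>free_group X\<^esub>"
    if "A \<in> carrier (free_group X)" for A
  proof -
    obtain u where u: "u \<in> group_words X" and A: "A = word_rel X `` {u}"
      using rep \<open>A \<in> carrier (free_group X)\<close> by blast
    have "\<exists>v\<in>group_words X. (v @ u, []) \<in> word_rel X"
      using u
    proof (induction u)
      case Nil
      show ?case using nil word_rel_refl by force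
    next
      case (Cons l u)
      obtain b x where l: "l = (b, x)" by (cases l)
      have x: "x \<in> X" and u: "u \<in> group_words X" using Cons.prems l by (auto simp: group_words_def)
      obtain v where v: "v \<in> group_words X" "(v @ u, []) \<in> word_rel X" using Cons.IH[OF u] by auto
      have "(v @ [(\<not> b, x), (\<not> \<not> b, x)] @ u, v @ u) \<in> word_rel X"
        by (rule word_rel_cancel[OF v(1) u x])
      then have "((v @ [(\<not> b, x)]) @ l # u, []) \<in> word_rel X"
        using v(2) l by (auto intro: word_rel_trans)
      moreover have "v @ [(\<not> b, x)] \<in> group_words X" using v(1) x by (auto simp: group_words_def)
      ultimately show ?case by blast
    qed
    then obtain v where v: "v \<in> group_words X" "(v @ u, []) \<in> word_rel X" by auto
    then have "word_rel X `` {v} \<otimes>\<^bsub>free_group X\<^esub> A = \<one>\<^bsub>free_group X\<^esub>"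
      using u by (simp add: A m one equiv_class_eq[OF equiv_word_rel])
    then show ?thesis using cls[OF v(1)] by auto
  qed
qed

lemma normal_normal_closure:
  assumes "group G" "R \<subseteq> carrier G"
  shows "normal_closure G R \<lhd> G"
proof -
  interpret group G by fact
  let ?\<N> = "{N. N \<lhd> G \<and> R \<subseteq> N}"
  have "carrier G \<lhd> G" by (simp add: normal_inv_iff subgroup_self)
  then have ne: "?\<N> \<noteq> {}" using assms(2) by blast
  have "subgroup (\<Inter>?\<N>) G"
    by (rule subgroups_Inter[OF _ ne]) (simp add: normal_imp_subgroup)
  then show ?thesis
    unfolding normal_closure_def normal_inv_iff using normal_inv_iff by blast
qed

lemma group_profinite_completion:
  fixes G (structure)
  assumes "group G"
  shows "group (profinite_completion G)"
proof -
  let ?F = "finite_index_normal G"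
  let ?P = "product_group ?F (\<lambda>N. G Mod N)"
  have nor: "N \<lhd> G" if "N \<in> ?F" for N using that by (simp add: finite_index_normal_def)
  have P: "group ?P" by (simp add: nor normal.factorgroup_is_group)
  interpret group G by fact
  interpret P: group ?P by (rule P)
  have hom: "(\<lambda>C. M <#>\<^bsub>G\<^esub> C) \<in> hom (G Mod N) (G Mod M)"
    if N: "N \<in> ?F" and M: "M \<in> ?F" and NM: "N \<subseteq> M" for N M
  proof -
    interpret N: normal N G using nor[OF N] .
    interpret M: normal M G using nor[OF M] .
    have "M <#> N = M"
    proof
      show "M <#> N \<subseteq> M" using NM by (auto simp: set_mult_def)
      show "M \<subseteq> M <#> N"
      proof
        fix m assume m: "m \<in> M"
        then have "m = m \<otimes> \<one>" using M.subset by (simp add: subsetD)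
        then show "m \<in> M <#> N" using m N.one_closed unfolding set_mult_def by blast
      qed
    qed
    then have c: "M <#> (N #> g) = M #> g" if "g \<in> carrier G" for g
      using setmult_rcos_assoc[OF M.subset N.subset that] by simp
    show ?thesis
    proof (rule homI)
      fix A B assume "A \<in> carrier (G Mod N)" "B \<in> carrier (G Mod N)"
      then obtain a b where ab: "a \<in> carrier G" "A = N #> a" "b \<in> carrier G" "B = N #> b"
        by (auto simp: FactGroup_def RCOSETS_def)
      then show "M <#> A \<in> carrier (G Mod M)"
        using c by (auto simp: FactGroup_def RCOSETS_def)
      show "M <#> (A \<otimes>\<^bsub>G Mod N\<^esub> B) = (M <#> A) \<otimes>\<^bsub>G Mod M\<^esub> (M <#> B)"
        using ab by (simp add: FactGroup_def N.rcos_sum M.rcos_sum c)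
    qed
  qed
  let ?C = "carrier (profinite_completion G)"
  have C: "?C = {f \<in> carrier ?P. \<forall>N\<in>?F. \<forall>M\<in>?F. N \<subseteq> M \<longrightarrow> f M = M <#>\<^bsub>G\<^esub> f N}"
    by (simp add: profinite_completion_def)
  have gr: "group (G Mod N)" if "N \<in> ?F" for N using that by (simp add: nor normal.factorgroup_is_group)
  have ghom: "group_hom (G Mod N) (G Mod M) (\<lambda>C. M <#>\<^bsub>G\<^esub> C)"
    if "N \<in> ?F" "M \<in> ?F" "N \<subseteq> M" for N M
    using hom[OF that] gr that by (simp add: group_hom_def group_hom_axioms_def)
  have memI: "f \<in> ?C"
    if "f \<in> carrier ?P" "\<And>N M. N \<in> ?F \<Longrightarrow> M \<in> ?F \<Longrightarrow> N \<subseteq> M \<Longrightarrow> f M = M <#> f N" for f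
    unfolding C using that by blast
  have compat: "f M = M <#> f N" if "f \<in> ?C" "N \<in> ?F" "M \<in> ?F" "N \<subseteq> M" for f N M
    using that unfolding C by blast
  have CP: "?C \<subseteq> carrier ?P" unfolding C by blast
  have val: "f N \<in> carrier (G Mod N)" if "f \<in> ?C" "N \<in> ?F" for f N
    using CP that by (metis PiE_mem carrier_product_group subsetD)
  have "subgroup ?C ?P"
  proof (rule P.subgroupI)
    show "?C \<subseteq> carrier ?P" by (rule CP)
    have "\<one>\<^bsub>?P\<^esub> \<in> ?C"
    proof (rule memI[OF P.one_closed])
      fix N M assume NM: "N \<in> ?F" "M \<in> ?F" "N \<subseteq> M"
      show "\<one>\<^bsub>?P\<^esub> M = M <#> \<one>\<^bsub>?P\<^esub> N"
        using group_hom.hom_one[OF ghom[OF NM]] NM by (simp del: one_FactGroup)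
    qed
    then show "?C \<noteq> {}" by blast
    show "inv\<^bsub>?P\<^esub> f \<in> ?C" if f: "f \<in> ?C" for f
    proof (rule memI)
      show "inv\<^bsub>?P\<^esub> f \<in> carrier ?P" using f CP by blast
      fix N M assume NM: "N \<in> ?F" "M \<in> ?F" "N \<subseteq> M"
      have "inv\<^bsub>?P\<^esub> f = (\<lambda>N\<in>?F. inv\<^bsub>G Mod N\<^esub> f N)"
        using f CP gr by (intro inv_product_group) auto
      then show "(inv\<^bsub>?P\<^esub> f) M = M <#> (inv\<^bsub>?P\<^esub> f) N"
        using group_hom.hom_inv[OF ghom[OF NM] val[OF f NM(1)]] compat[OF f NM] NM by simp
    qed
    show "f \<otimes>\<^bsub>?P\<^esub> g \<in> ?C" if f: "f \<in> ?C" and g: "g \<in> ?C" for f g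
    proof (rule memI)
      show "f \<otimes>\<^bsub>?P\<^esub> g \<in> carrier ?P" using f g CP by (meson P.m_closed subsetD)
      fix N M assume NM: "N \<in> ?F" "M \<in> ?F" "N \<subseteq> M"
      show "(f \<otimes>\<^bsub>?P\<^esub> g) M = M <#> (f \<otimes>\<^bsub>?P\<^esub> g) N"
        using group_hom.hom_mult[OF ghom[OF NM] val[OF f NM(1)] val[OF g NM(1)]]
          compat[OF f NM] compat[OF g NM] NM by (simp del: mult_FactGroup)
    qed
  qed
  then have "group (?P\<lparr>carrier := ?C\<rparr>)" by (rule P.subgroup_imp_group)
  then show ?thesis by (simp add: profinite_completion_def)
qed

lemma finitely_generated_nat_copy:
  fixes G :: "('a, 'b) monoid_scheme" (structure)
  assumes "finitely_generated G"
  shows "\<exists>H :: nat monoid. group H \<and> G \<cong> H"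
proof -
  interpret group G using assms by (simp add: finitely_generated_def)
  obtain S where S: "finite S" "S \<subseteq> carrier G" "generate G S = carrier G"
    using assms by (auto simp: finitely_generated_def)
  define ev where "ev = foldr (\<lambda>a b. a \<otimes> b)"
  let ?T = "S \<union> m_inv G ` S"
  have T: "?T \<subseteq> carrier G" using S(2) by auto
  have ev_app: "ev (u @ v) \<one> = ev u \<one> \<otimes> ev v \<one> \<and> ev u \<one> \<in> carrier G"
    if "u \<in> lists ?T" "v \<in> lists ?T" for u v
  proof -
    have cl: "ev w \<one> \<in> carrier G" if "w \<in> lists ?T" for w
      using that T by (induction w) (auto simp: ev_def)
    show ?thesis using that(1)
    proof (induction u)
      case Nil
      then show ?case using cl[OF that(2)] by (simp add: ev_def)
    next
      case (Cons a u)
      then have "a \<in> carrier G" using T by auto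
      with Cons cl[OF that(2)] show ?case by (auto simp: ev_def m_assoc)
    qed
  qed
  have "x \<in> (\<lambda>w. ev w \<one>) ` lists ?T" if "x \<in> generate G S" for x
    using that
  proof induction
    case one
    show ?case by (rule image_eqI[of _ _ "[]"]) (auto simp: ev_def)
  next
    case (incl h)
    then show ?case using S(2) by (intro image_eqI[of _ _ "[h]"]) (auto simp: ev_def)
  next
    case (inv h)
    then show ?case using S(2) by (intro image_eqI[of _ _ "[inv h]"]) (auto simp: ev_def)
  next
    case (eng h1 h2)
    then obtain u v where "u \<in> lists ?T" "h1 = ev u \<one>" "v \<in> lists ?T" "h2 = ev v \<one>" by blast
    then show ?case using ev_app by (intro image_eqI[of _ _ "u @ v"]) auto
  qed
  then have "carrier G \<subseteq> (\<lambda>w. ev w \<one>) ` lists ?T" using S(3) by blast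
  moreover have "countable (lists ?T)"
    using S(1) by (intro countable_lists countable_finite) auto
  ultimately have "countable (carrier G)" by (meson countable_image countable_subset)
  then obtain f :: "'a \<Rightarrow> nat" where f: "inj_on f (carrier G)" by (auto simp: countable_def)
  define g where "g = inv_into (carrier G) f"
  define H :: "nat monoid" where
    "H = \<lparr>carrier = f ` carrier G, monoid.mult = (\<lambda>a b. f (g a \<otimes> g b)), one = f \<one>\<rparr>"
  have iso: "f \<in> iso G H"
    using f by (auto simp: iso_def hom_def H_def g_def bij_betw_def)
  have "group H"
  proof (rule groupI)
    show "\<exists>y\<in>carrier H. y \<otimes>\<^bsub>H\<^esub> x = \<one>\<^bsub>H\<^esub>" if "x \<in> carrier H" for x
    proof -
      obtain a where "a \<in> carrier G" "x = f a" using \<open>x \<in> carrier H\<close> by (auto simp: H_def)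
      then show ?thesis using f by (intro bexI[of _ "f (inv a)"]) (auto simp: H_def g_def)
    qed
  qed (use f in \<open>auto simp: H_def g_def m_assoc\<close>)
  then show ?thesis using iso by (auto simp: is_iso_def)
qed

end

theory Submission
  imports Defs "HOL-Library.Function_Algebras"
begin

text \<open>
  Let \<open>B = \<int>[x, 1/x, 1/(1+x)]\<close> and \<open>\<phi> = x^4 - 1\<close>. For \<open>e \<in> B\<close> the group \<open>\<Gamma>(e)\<close> is the extension of the
  free abelian group on \<open>x, y, w\<close> by the module \<open>M(e) = {(f, g) \<in> B\<^sup>2. f \<equiv> e g mod \<phi>}\<close>, where
  \<open>x\<close> and \<open>y\<close> act as multiplication by \<open>x\<close> and \<open>1 + x\<close>, and \<open>w\<close> acts as \<open>(1, x^4)\<close>. Baumslag's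
  trick makes \<open>\<Gamma>(1)\<close> finitely presented.

  Since \<open>(1 + x)^4\<close> is congruent to an even element modulo \<open>\<phi>\<close>, the number \<open>2\<close> is a unit modulo \<open>\<phi>\<close>.
  In a finite quotient of \<open>B\<close> every unit modulo \<open>\<phi>\<close> lifts to a unit, so that all \<open>M(2^k)\<close>, and hence
  all \<open>\<Gamma>(2^k)\<close>, have the same profinite completion. The module part of
  \<open>\<Gamma>(2^k)\<close> is the centralizer of the commutators, and an isomorphism from \<open>\<Gamma>(2^k)\<close> to \<open>\<Gamma>(2^l)\<close> respects
  the two coordinate axes of \<open>M\<close>, possibly swapping them. It therefore makes \<open>2^k\<close> congruent modulo
  \<open>\<phi>\<close> to \<open>2^l\<close> or \<open>2^-l\<close> times a unit of \<open>B\<close>. The units of \<open>B\<close> are \<open>\<plusminus>x^i (1+x)^j\<close>, and comparing absolute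
  values at the zeros \<open>1\<close> and \<open>\<i>\<close> of \<open>\<phi>\<close> gives \<open>k = l\<close>.

  A residually finite group embeds into its profinite completion, so all groups in the genus
  of \<open>\<Gamma>(1)\<close> are metabelian. By P. Hall's theorem finitely generated metabelian groups satisfy the
  maximal condition on normal subgroups, and hence there are only countably many of them.
\<close>

section \<open>Limits of homomorphisms on profinite completions\<close>

text \<open>As a \<open>B\<close>-module \<open>M(e)\<close> is free on \<open>(\<phi>, 0)\<close>
  and \<open>(e, 1)\<close>, so \<open>x\<close> and \<open>y\<close> alone cannot tell the groups
  apart; \<open>w\<close> is there to mark the two axes, and it preserves the congruence because
  \<open>x^4\<close> is 1 modulo \<phi>. Inverting \<open>1 + x\<close> serves both Baumslag's trick
  and the invertibility of 2 modulo \<phi>. The exponent 4 is the least that works: for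
  \<open>x - 1\<close> and \<open>x^2 - 1\<close> the quotient of \<open>B\<close> is
  \<open>Z[1/2]\<close>, where 2 is the image of the unit \<open>1 + x\<close>, and for
  \<open>x^3 - 1\<close> the zeros other than 1 give a quotient in which 2 is not invertible. At the
  zeros 1 and \<i> of \<open>x^4 - 1\<close> the unit \<open>1 + x\<close> has the different
  absolute values 2 and the square root of 2.

  On the profinite side the obstacle is that \<open>e\<close> is a unit modulo \<phi> without
  lifting to a unit of \<open>B\<close>, so multiplication by a lift is not an isomorphism of the
  groups. Lifts to units exist in each finite quotient, but have to be chosen coherently. An
  explicit sequence of lifts that is eventually constant in every finite quotient does this, and
  limits of homomorphisms turn it into an isomorphism of completions.\<close>

lemma rcos_eq_iff:
  assumes "N \<lhd> G" "a \<in> carrier G" "b \<in> carrier G"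
  shows "N #>\<^bsub>G\<^esub> a = N #>\<^bsub>G\<^esub> b \<longleftrightarrow> a \<otimes>\<^bsub>G\<^esub> inv\<^bsub>G\<^esub> b \<in> N"
proof -
  interpret normal N G by fact
  show ?thesis
    using rcos_module[OF is_group assms(3,2)] repr_independence[OF _ assms(3) subgroup_axioms]
      rcos_self[OF assms(2) subgroup_axioms] by blast
qed

lemma rcos_eq_self_iff:
  assumes "N \<lhd> G" "a \<in> carrier G"
  shows "N #>\<^bsub>G\<^esub> a = N \<longleftrightarrow> a \<in> N"
proof -
  interpret normal N G by fact
  show ?thesis
    using coset_join1[OF _ assms(2) subgroup_axioms] coset_join2[OF assms(2) subgroup_axioms]
    by blast
qed

text \<open>Elements with the same label lie in one coset, so there are at most as many cosets as
  labels. The labelling \<open>c\<close> is arbitrary; it is used with coset maps and with choices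
  of residues.\<close>

lemma finite_index_normalI:
  assumes N: "N \<lhd> G" and fin: "finite (c ` carrier G)"
    and c: "\<And>a b. a \<in> carrier G \<Longrightarrow> b \<in> carrier G \<Longrightarrow> c a = c b \<Longrightarrow> a \<otimes>\<^bsub>G\<^esub> inv\<^bsub>G\<^esub> b \<in> N"
  shows "N \<in> finite_index_normal G"
proof -
  have "rcosets\<^bsub>G\<^esub> N \<subseteq> (\<lambda>v. N #>\<^bsub>G\<^esub> (SOME a. a \<in> carrier G \<and> c a = v)) ` c ` carrier G"
  proof
    fix C assume "C \<in> rcosets\<^bsub>G\<^esub> N"
    then obtain a where a: "a \<in> carrier G" "C = N #>\<^bsub>G\<^esub> a" by (auto simp: RCOSETS_def)
    define b where "b = (SOME b. b \<in> carrier G \<and> c b = c a)"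
    have b: "b \<in> carrier G \<and> c b = c a" unfolding b_def by (rule someI[of _ a]) (use a in auto)
    then have "C = N #>\<^bsub>G\<^esub> b" using a c[of a b] rcos_eq_iff[OF N, of a b] by auto
    then show "C \<in> (\<lambda>v. N #>\<^bsub>G\<^esub> (SOME a. a \<in> carrier G \<and> c a = v)) ` c ` carrier G"
      using a(1) unfolding b_def by blast
  qed
  then show ?thesis using N fin by (auto simp: finite_index_normal_def dest: finite_subset)
qed

lemma normal_vimage:
  assumes "group G" "h \<in> hom G H" "N \<lhd> H"
  shows "{g \<in> carrier G. h g \<in> N} \<lhd> G"
proof -
  interpret N: normal N H by fact
  interpret group_hom G H h using assms by (simp add: group_hom_def group_hom_axioms_def N.is_group)
  have "subgroup {g \<in> carrier G. h g \<in> N} G"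
    by (rule G.subgroupI) (auto intro!: exI[of _ "\<one>\<^bsub>G\<^esub>"])
  then show ?thesis using N.inv_op_closed2 by (auto simp: G.normal_inv_iff)
qed

lemma finite_index_normal_vimage:
  assumes G: "group G" and h: "h \<in> hom G H" and N: "N \<in> finite_index_normal H"
  shows "{g \<in> carrier G. h g \<in> N} \<in> finite_index_normal G"
proof (rule finite_index_normalI)
  have NH: "N \<lhd> H" and fin: "finite (rcosets\<^bsub>H\<^esub> N)" using N by (auto simp: finite_index_normal_def)
  interpret N: normal N H by fact
  interpret group_hom G H h using assms by (simp add: group_hom_def group_hom_axioms_def N.is_group)
  show "{g \<in> carrier G. h g \<in> N} \<lhd> G" by (rule normal_vimage[OF G h NH])
  show "finite ((\<lambda>g. N #>\<^bsub>H\<^esub> h g) ` carrier G)"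
    by (rule finite_subset[OF _ fin]) (auto simp: RCOSETS_def intro!: bexI[of _ "h _"])
  show "a \<otimes>\<^bsub>G\<^esub> inv\<^bsub>G\<^esub> b \<in> {g \<in> carrier G. h g \<in> N}"
    if "a \<in> carrier G" "b \<in> carrier G" "N #>\<^bsub>H\<^esub> h a = N #>\<^bsub>H\<^esub> h b" for a b
    using that rcos_eq_iff[OF NH, of "h a" "h b"] by auto
qed

lemma profinite_completion_mem:
  "f \<in> carrier (profinite_completion G) \<longleftrightarrow>
    f \<in> extensional (finite_index_normal G) \<and>
    (\<forall>N\<in>finite_index_normal G. \<exists>g\<in>carrier G. f N = N #>\<^bsub>G\<^esub> g) \<and>
    (\<forall>N\<in>finite_index_normal G. \<forall>M\<in>finite_index_normal G. N \<subseteq> M \<longrightarrow> f M = M <#>\<^bsub>G\<^esub> f N)"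
  by (auto simp: profinite_completion_def PiE_iff carrier_FactGroup image_iff)

lemma set_mult_rcos:
  assumes "N \<lhd> G" "M \<lhd> G" "N \<subseteq> M" "g \<in> carrier G"
  shows "M <#>\<^bsub>G\<^esub> (N #>\<^bsub>G\<^esub> g) = M #>\<^bsub>G\<^esub> g"
proof -
  interpret N: normal N G by fact
  interpret M: normal M G by fact
  have "M <#>\<^bsub>G\<^esub> N = M"
  proof
    show "M <#>\<^bsub>G\<^esub> N \<subseteq> M"
      using mono_set_mult[where G=G, OF order_refl[of M] assms(3)] by (simp only: N.subgroup_mult_id[OF M.subgroup_axioms])
    show "M \<subseteq> M <#>\<^bsub>G\<^esub> N"
    proof
      fix m assume m: "m \<in> M"
      have "m \<otimes>\<^bsub>G\<^esub> \<one>\<^bsub>G\<^esub> \<in> M <#>\<^bsub>G\<^esub> N" using m subgroup.one_closed[OF N.subgroup_axioms] unfolding set_mult_def by blast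
      then show "m \<in> M <#>\<^bsub>G\<^esub> N" by (simp only: N.r_one[OF M.mem_carrier[OF m]])
    qed
  qed
  then show ?thesis using N.setmult_rcos_assoc[OF M.subset N.subset assms(4)] by simp
qed

lemma profinite_completion_restrict:
  assumes "f \<in> carrier (profinite_completion G)" "N \<in> finite_index_normal G"
    "M \<in> finite_index_normal G" "N \<subseteq> M" "g \<in> carrier G" "f N = N #>\<^bsub>G\<^esub> g"
  shows "f M = M #>\<^bsub>G\<^esub> g"
proof -
  have "f M = M <#>\<^bsub>G\<^esub> f N" using assms(1-4) unfolding profinite_completion_mem by blast
  then show ?thesis
    using assms(2-6) set_mult_rcos[of N G M g] by (simp add: finite_index_normal_def)
qed

text \<open>The index \<open>n0\<close> depends on \<open>N\<close> but not on \<open>g\<close>.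
  This uniformity makes the preimage of \<open>N\<close> under \<open>\<Phi> n\<close> independent
  of \<open>n\<close> from some point on, so that the limit can be read off at one index.\<close>

definition profinitely_convergent ::
  "('a, 'b) monoid_scheme \<Rightarrow> ('c, 'd) monoid_scheme \<Rightarrow> (nat \<Rightarrow> 'a \<Rightarrow> 'c) \<Rightarrow> bool"
  where "profinitely_convergent G H \<Phi> \<longleftrightarrow> (\<forall>n. \<Phi> n \<in> hom G H) \<and>
    (\<forall>N\<in>finite_index_normal H. \<exists>n0. \<forall>n\<ge>n0. \<forall>g\<in>carrier G. N #>\<^bsub>H\<^esub> \<Phi> n g = N #>\<^bsub>H\<^esub> \<Phi> n0 g)"

definition stable_index where
  "stable_index G H \<Phi> N =
    (SOME n0. \<forall>n\<ge>n0. \<forall>g\<in>carrier G. N #>\<^bsub>H\<^esub> \<Phi> n g = N #>\<^bsub>H\<^esub> \<Phi> (n0 :: nat) g)"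

text \<open>
  The component of \<open>f\<close> at the preimage of \<open>N\<close> is a coset on which \<open>\<Phi> n\<close> is constant modulo \<open>N\<close>, so the
  choice of its element does not matter.
\<close>

definition profinite_limit ::
  "('a, 'b) monoid_scheme \<Rightarrow> ('c, 'd) monoid_scheme \<Rightarrow> (nat \<Rightarrow> 'a \<Rightarrow> 'c) \<Rightarrow>
    ('a set \<Rightarrow> 'a set) \<Rightarrow> 'c set \<Rightarrow> 'c set"
  where "profinite_limit G H \<Phi> f = (\<lambda>N\<in>finite_index_normal H.
    let n = stable_index G H \<Phi> N
    in N #>\<^bsub>H\<^esub> \<Phi> n (SOME g. g \<in> f {g \<in> carrier G. \<Phi> n g \<in> N}))"

context
  fixes G :: "('a, 'b) monoid_scheme" and H :: "('c, 'd) monoid_scheme" and \<Phi>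
  assumes G: "group G" and H: "group H" and conv: "profinitely_convergent G H \<Phi>"
begin

lemma limit_hom: "group_hom G H (\<Phi> n)"
  using G H conv by (simp add: profinitely_convergent_def group_hom_def group_hom_axioms_def)

lemma stable_indexD:
  assumes "N \<in> finite_index_normal H" "n \<ge> stable_index G H \<Phi> N" "g \<in> carrier G"
  shows "N #>\<^bsub>H\<^esub> \<Phi> n g = N #>\<^bsub>H\<^esub> \<Phi> (stable_index G H \<Phi> N) g"
proof -
  have "\<exists>n0. \<forall>n\<ge>n0. \<forall>g\<in>carrier G. N #>\<^bsub>H\<^esub> \<Phi> n g = N #>\<^bsub>H\<^esub> \<Phi> n0 g"
    using conv assms(1) by (simp add: profinitely_convergent_def)
  from someI_ex[OF this] show ?thesis using assms(2,3) unfolding stable_index_def by blast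
qed

lemma stable_vimage:
  assumes N: "N \<in> finite_index_normal H" and n: "n \<ge> stable_index G H \<Phi> N"
  shows "{g \<in> carrier G. \<Phi> n g \<in> N} = {g \<in> carrier G. \<Phi> (stable_index G H \<Phi> N) g \<in> N}"
proof -
  have nor: "N \<lhd> H" using N by (simp add: finite_index_normal_def)
  have "\<Phi> n g \<in> N \<longleftrightarrow> \<Phi> (stable_index G H \<Phi> N) g \<in> N" if "g \<in> carrier G" for g
    unfolding rcos_eq_self_iff[OF nor group_hom.hom_closed[OF limit_hom that], symmetric]
    by (simp only: stable_indexD[OF N n that])
  then show ?thesis by blast
qed

lemma vimage_index: "N \<in> finite_index_normal H \<Longrightarrow> {g \<in> carrier G. \<Phi> n g \<in> N} \<in> finite_index_normal G"
  by (rule finite_index_normal_vimage[OF G]) (use conv in \<open>auto simp only: profinitely_convergent_def\<close>)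

text \<open>Any late index and any representative compute the limit. The freedom in \<open>n\<close>
  lets one index serve several subgroups at once, as compatibility and invertibility of the limit
  require.\<close>

lemma profinite_limit_eq:
  assumes f: "f \<in> carrier (profinite_completion G)" and N: "N \<in> finite_index_normal H"
    and n: "n \<ge> stable_index G H \<Phi> N" and g: "g \<in> carrier G"
    and fg: "f {g \<in> carrier G. \<Phi> n g \<in> N} = {g \<in> carrier G. \<Phi> n g \<in> N} #>\<^bsub>G\<^esub> g"
  shows "profinite_limit G H \<Phi> f N = N #>\<^bsub>H\<^esub> \<Phi> n g"
proof -
  let ?m = "stable_index G H \<Phi> N"
  define K where "K = {g \<in> carrier G. \<Phi> ?m g \<in> N}"
  have K: "K \<lhd> G" using vimage_index[OF N] unfolding K_def by (simp add: finite_index_normal_def)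
  have fK: "f K = K #>\<^bsub>G\<^esub> g" using fg unfolding stable_vimage[OF N n] K_def .
  define s where "s = (SOME g. g \<in> f K)"
  have lim: "profinite_limit G H \<Phi> f N = N #>\<^bsub>H\<^esub> \<Phi> ?m s"
    using N by (simp add: profinite_limit_def Let_def s_def K_def)
  interpret K: normal K G by (rule K)
  interpret m: group_hom G H "\<Phi> ?m" by (rule limit_hom)
  have "s \<in> f K" unfolding s_def
    by (rule someI[of _ g]) (use fK K.rcos_self[OF g K.subgroup_axioms] in simp)
  then have sK: "s \<in> K #>\<^bsub>G\<^esub> g" by (simp only: fK)
  have s: "s \<in> carrier G" by (rule K.elemrcos_carrier[OF G g sK])
  have "s \<otimes>\<^bsub>G\<^esub> inv\<^bsub>G\<^esub> g \<in> K" by (rule K.rcos_module_imp[OF G g sK])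
  then have "\<Phi> ?m (s \<otimes>\<^bsub>G\<^esub> inv\<^bsub>G\<^esub> g) \<in> N" unfolding K_def by blast
  then have "\<Phi> ?m s \<otimes>\<^bsub>H\<^esub> inv\<^bsub>H\<^esub> \<Phi> ?m g \<in> N" using s g by simp
  moreover have "N \<lhd> H" using N by (simp add: finite_index_normal_def)
  ultimately have "N #>\<^bsub>H\<^esub> \<Phi> ?m s = N #>\<^bsub>H\<^esub> \<Phi> ?m g"
    using rcos_eq_iff m.hom_closed s g by metis
  then show ?thesis
    using stable_indexD[OF N n g] lim by simp
qed

lemma profinite_limit_mem:
  assumes f: "f \<in> carrier (profinite_completion G)"
  shows "profinite_limit G H \<Phi> f \<in> carrier (profinite_completion H)"
  unfolding profinite_completion_mem
proof (intro conjI ballI impI)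
  show "profinite_limit G H \<Phi> f \<in> extensional (finite_index_normal H)"
    by (simp add: profinite_limit_def)
next
  fix N assume N: "N \<in> finite_index_normal H"
  let ?m = "stable_index G H \<Phi> N"
  obtain g where g: "g \<in> carrier G" "f {g \<in> carrier G. \<Phi> ?m g \<in> N} = {g \<in> carrier G. \<Phi> ?m g \<in> N} #>\<^bsub>G\<^esub> g"
    using f vimage_index[OF N, of ?m] unfolding profinite_completion_mem by blast
  show "\<exists>h\<in>carrier H. profinite_limit G H \<Phi> f N = N #>\<^bsub>H\<^esub> h"
    using profinite_limit_eq[OF f N order_refl g] group_hom.hom_closed[OF limit_hom g(1)] by blast
next
  fix N M assume N: "N \<in> finite_index_normal H" and M: "M \<in> finite_index_normal H" and NM: "N \<subseteq> M"
  \<comment> \<open>One index for both subgroups, so that a single \<open>g\<close> represents the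
    components at \<open>N\<close> and at \<open>M\<close>.\<close>
  define n where "n = max (stable_index G H \<Phi> N) (stable_index G H \<Phi> M)"
  have n: "n \<ge> stable_index G H \<Phi> N" "n \<ge> stable_index G H \<Phi> M" by (auto simp: n_def)
  obtain g where g: "g \<in> carrier G" "f {g \<in> carrier G. \<Phi> n g \<in> N} = {g \<in> carrier G. \<Phi> n g \<in> N} #>\<^bsub>G\<^esub> g"
    using f vimage_index[OF N, of n] unfolding profinite_completion_mem by blast
  have "f {g \<in> carrier G. \<Phi> n g \<in> M} = {g \<in> carrier G. \<Phi> n g \<in> M} #>\<^bsub>G\<^esub> g"
    by (rule profinite_completion_restrict[OF f vimage_index[OF N] vimage_index[OF M] _ g]) (use NM in auto)
  then have "profinite_limit G H \<Phi> f M = M #>\<^bsub>H\<^esub> \<Phi> n g"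
    by (rule profinite_limit_eq[OF f M n(2) g(1)])
  moreover have "profinite_limit G H \<Phi> f N = N #>\<^bsub>H\<^esub> \<Phi> n g"
    by (rule profinite_limit_eq[OF f N n(1) g])
  ultimately show "profinite_limit G H \<Phi> f M = M <#>\<^bsub>H\<^esub> profinite_limit G H \<Phi> f N"
    using set_mult_rcos[of N H M "\<Phi> n g"] N M NM group_hom.hom_closed[OF limit_hom g(1)]
    by (simp add: finite_index_normal_def)
qed

lemma profinite_limit_hom:
  "profinite_limit G H \<Phi> \<in> hom (profinite_completion G) (profinite_completion H)"
proof (rule homI)
  fix f f' assume f: "f \<in> carrier (profinite_completion G)" and f': "f' \<in> carrier (profinite_completion G)"
  let ?P = "profinite_limit G H \<Phi>"
  interpret PG: group "profinite_completion G" by (rule group_profinite_completion[OF G])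
  interpret PH: group "profinite_completion H" by (rule group_profinite_completion[OF H])
  have ff': "f \<otimes>\<^bsub>profinite_completion G\<^esub> f' \<in> carrier (profinite_completion G)" using f f' by simp
  show "?P (f \<otimes>\<^bsub>profinite_completion G\<^esub> f') = ?P f \<otimes>\<^bsub>profinite_completion H\<^esub> ?P f'"
  proof (rule extensionalityI[of _ "finite_index_normal H"])
    show "?P (f \<otimes>\<^bsub>profinite_completion G\<^esub> f') \<in> extensional (finite_index_normal H)"
      by (simp add: profinite_limit_def)
    show "?P f \<otimes>\<^bsub>profinite_completion H\<^esub> ?P f' \<in> extensional (finite_index_normal H)"
      by (simp add: profinite_completion_def)
    fix N assume N: "N \<in> finite_index_normal H"
    let ?m = "stable_index G H \<Phi> N"
    define K where "K = {g \<in> carrier G. \<Phi> ?m g \<in> N}"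
    have KF: "K \<in> finite_index_normal G" unfolding K_def by (rule vimage_index[OF N])
    interpret N: normal N H using N by (simp add: finite_index_normal_def)
    interpret K: normal K G using KF by (simp add: finite_index_normal_def)
    interpret m: group_hom G H "\<Phi> ?m" by (rule limit_hom)
    obtain g where g: "g \<in> carrier G" "f K = K #>\<^bsub>G\<^esub> g"
      using f KF unfolding profinite_completion_mem by blast
    obtain g' where g': "g' \<in> carrier G" "f' K = K #>\<^bsub>G\<^esub> g'"
      using f' KF unfolding profinite_completion_mem by blast
    have "(f \<otimes>\<^bsub>profinite_completion G\<^esub> f') K = K #>\<^bsub>G\<^esub> (g \<otimes>\<^bsub>G\<^esub> g')"
      using KF g g' K.rcos_sum by (simp add: profinite_completion_def)
    then have "?P (f \<otimes>\<^bsub>profinite_completion G\<^esub> f') N = N #>\<^bsub>H\<^esub> \<Phi> ?m (g \<otimes>\<^bsub>G\<^esub> g')"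
      using profinite_limit_eq[OF ff' N order_refl, of "g \<otimes>\<^bsub>G\<^esub> g'", folded K_def] g g' by simp
    also have "\<dots> = ?P f N <#>\<^bsub>H\<^esub> ?P f' N"
      using profinite_limit_eq[OF f N order_refl g[unfolded K_def]]
        profinite_limit_eq[OF f' N order_refl g'[unfolded K_def]] g(1) g'(1)
      by (simp add: N.rcos_sum)
    also have "\<dots> = (?P f \<otimes>\<^bsub>profinite_completion H\<^esub> ?P f') N"
      using N by (simp add: profinite_completion_def)
    finally show "?P (f \<otimes>\<^bsub>profinite_completion G\<^esub> f') N = (?P f \<otimes>\<^bsub>profinite_completion H\<^esub> ?P f') N" .
  qed
qed (rule profinite_limit_mem)

lemma profinite_limit_continuous:
  "continuous_map (profinite_topology G) (profinite_topology H) (profinite_limit G H \<Phi>)"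
proof -
  let ?T = "\<lambda>K. product_topology (\<lambda>N. discrete_topology (carrier (K Mod N))) (finite_index_normal K)"
  have sub: "carrier (profinite_completion K) \<subseteq> topspace (?T K)" for K :: "('x, 'y) monoid_scheme"
    by (auto simp: profinite_completion_def)
  have topG: "topspace (profinite_topology G) = carrier (profinite_completion G)"
    using sub[of G] by (auto simp: profinite_topology_def)
  show ?thesis
    unfolding profinite_topology_def[of H]
  proof (intro continuous_map_into_subtopology iffD2[OF continuous_map_componentwise] conjI ballI)
    show "profinite_limit G H \<Phi> ` topspace (profinite_topology G) \<subseteq> extensional (finite_index_normal H)"
      by (auto simp: profinite_limit_def)
    show "profinite_limit G H \<Phi> \<in> topspace (profinite_topology G) \<rightarrow> carrier (profinite_completion H)"
      using profinite_limit_mem by (simp add: topG)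
    fix N assume N: "N \<in> finite_index_normal H"
    let ?m = "stable_index G H \<Phi> N"
    define K where "K = {g \<in> carrier G. \<Phi> ?m g \<in> N}"
    \<comment> \<open>The component at \<open>N\<close> factors through the projection to the
      discrete quotient at \<open>K\<close>, and maps between discrete spaces are
      continuous.\<close>
    let ?F = "\<lambda>C. N #>\<^bsub>H\<^esub> \<Phi> ?m (SOME g. g \<in> C)"
    have KF: "K \<in> finite_index_normal G" unfolding K_def by (rule vimage_index[OF N])
    then have "continuous_map (?T G) (discrete_topology (carrier (G Mod K))) (\<lambda>f. f K)"
      by (rule continuous_map_product_projection)
    then have 1: "continuous_map (profinite_topology G) (discrete_topology (carrier (G Mod K))) (\<lambda>f. f K)"
      unfolding profinite_topology_def by (rule continuous_map_from_subtopology)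
    interpret K: normal K G using KF by (simp add: finite_index_normal_def)
    have "?F C \<in> carrier (H Mod N)" if C: "C \<in> carrier (G Mod K)" for C
    proof -
      obtain g where "g \<in> carrier G" "C = K #>\<^bsub>G\<^esub> g" using C by (auto simp: carrier_FactGroup)
      then have "(SOME g. g \<in> C) \<in> C" using K.rcos_self[OF _ K.subgroup_axioms] by (metis someI)
      then have "(SOME g. g \<in> C) \<in> carrier G"
        using \<open>g \<in> carrier G\<close> \<open>C = K #>\<^bsub>G\<^esub> g\<close> K.elemrcos_carrier[OF G] by blast
      then show ?thesis using group_hom.hom_closed[OF limit_hom] by (auto simp: carrier_FactGroup)
    qed
    then have "continuous_map (discrete_topology (carrier (G Mod K))) (discrete_topology (carrier (H Mod N))) ?F"
      by (auto simp: continuous_map_def)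
    from continuous_map_compose[OF 1 this, unfolded K_def]
    show "continuous_map (profinite_topology G) (discrete_topology (carrier (H Mod N)))
       (\<lambda>f. profinite_limit G H \<Phi> f N)"
      using N by (simp add: profinite_limit_def Let_def o_def)
  qed
qed

end

lemma profinite_limit_inverse:
  assumes G: "group G" and H: "group H"
    and \<Phi>: "profinitely_convergent G H \<Phi>" and \<Psi>: "profinitely_convergent H G \<Psi>"
    and inv: "\<And>N. N \<in> finite_index_normal G \<Longrightarrow>
      \<exists>n0. \<forall>n\<ge>n0. \<forall>g\<in>carrier G. N #>\<^bsub>G\<^esub> \<Psi> n (\<Phi> n g) = N #>\<^bsub>G\<^esub> g"
    and f: "f \<in> carrier (profinite_completion G)"
  shows "profinite_limit H G \<Psi> (profinite_limit G H \<Phi> f) = f"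
proof (rule extensionalityI[of _ "finite_index_normal G"])
  show "profinite_limit H G \<Psi> (profinite_limit G H \<Phi> f) \<in> extensional (finite_index_normal G)"
    by (simp add: profinite_limit_def)
  show "f \<in> extensional (finite_index_normal G)" using f by (simp add: profinite_completion_mem)
  fix N assume N: "N \<in> finite_index_normal G"
  then have nor: "N \<lhd> G" by (simp add: finite_index_normal_def)
  obtain n0 where n0: "\<And>n g. n \<ge> n0 \<Longrightarrow> g \<in> carrier G \<Longrightarrow> N #>\<^bsub>G\<^esub> \<Psi> n (\<Phi> n g) = N #>\<^bsub>G\<^esub> g"
    using inv[OF N] by blast
  let ?m = "stable_index H G \<Psi> N"
  let ?K = "{h \<in> carrier H. \<Psi> ?m h \<in> N}"
  \<comment> \<open>Late enough for \<open>\<Psi>\<close> at \<open>N\<close>, for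
    \<open>\<Phi>\<close> at the preimage of \<open>N\<close>, and for the composite to be the
    identity modulo \<open>N\<close>.\<close>
  define n where "n = max n0 (max ?m (stable_index G H \<Phi> ?K))"
  have n: "n \<ge> n0" "n \<ge> ?m" "n \<ge> stable_index G H \<Phi> ?K" by (auto simp: n_def)
  have K: "?K \<in> finite_index_normal H" by (rule vimage_index[OF H G \<Psi> N])
  have Keq: "{h \<in> carrier H. \<Psi> n h \<in> N} = ?K" by (rule stable_vimage[OF H G \<Psi> N n(2)])
  interpret \<Phi>: group_hom G H "\<Phi> n" by (rule limit_hom[OF G H \<Phi>])
  interpret \<Psi>: group_hom H G "\<Psi> n" by (rule limit_hom[OF H G \<Psi>])
  have "\<Psi> n (\<Phi> n g) \<in> N \<longleftrightarrow> g \<in> N" if "g \<in> carrier G" for g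
    using n0[OF n(1) that] rcos_eq_self_iff[OF nor] that by (metis \<Phi>.hom_closed \<Psi>.hom_closed)
  \<comment> \<open>Pulling \<open>N\<close> back along \<open>\<Psi> n\<close> and then along
    \<open>\<Phi> n\<close> returns \<open>N\<close>, so the limit of \<open>f\<close> at
    \<open>?K\<close> is determined by \<open>f N\<close>.\<close>
  then have NN: "{g \<in> carrier G. \<Phi> n g \<in> ?K} = N"
    using Keq nor[THEN normal_imp_subgroup, THEN subgroup.subset] by (auto simp flip: Keq)
  obtain g where g: "g \<in> carrier G" "f N = N #>\<^bsub>G\<^esub> g"
    using f N unfolding profinite_completion_mem by blast
  have "profinite_limit G H \<Phi> f ?K = ?K #>\<^bsub>H\<^esub> \<Phi> n g"
    by (rule profinite_limit_eq[OF G H \<Phi> f K n(3) g(1)]) (use NN g in simp)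
  then have "profinite_limit H G \<Psi> (profinite_limit G H \<Phi> f) N = N #>\<^bsub>G\<^esub> \<Psi> n (\<Phi> n g)"
    using profinite_limit_eq[OF H G \<Psi> profinite_limit_mem[OF G H \<Phi> f] N n(2), of "\<Phi> n g"] Keq g(1)
    by simp
  then show "profinite_limit H G \<Psi> (profinite_limit G H \<Phi> f) N = f N"
    using n0[OF n(1) g(1)] g(2) by simp
qed

section \<open>From convergent sequences of homomorphisms to isomorphic completions\<close>

lemma topspace_profinite_topology [simp]:
  "topspace (profinite_topology G) = carrier (profinite_completion G)"
  by (auto simp: profinite_topology_def profinite_completion_def)

lemma isomorphic_profinite_completionsI:
  assumes G: "group G" and H: "group H"
    and \<Phi>: "profinitely_convergent G H \<Phi>" and \<Psi>: "profinitely_convergent H G \<Psi>"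
    and inv: "\<And>N. N \<in> finite_index_normal G \<Longrightarrow>
      \<exists>n0. \<forall>n\<ge>n0. \<forall>g\<in>carrier G. N #>\<^bsub>G\<^esub> \<Psi> n (\<Phi> n g) = N #>\<^bsub>G\<^esub> g"
    and inv': "\<And>N. N \<in> finite_index_normal H \<Longrightarrow>
      \<exists>n0. \<forall>n\<ge>n0. \<forall>h\<in>carrier H. N #>\<^bsub>H\<^esub> \<Phi> n (\<Psi> n h) = N #>\<^bsub>H\<^esub> h"
  shows "isomorphic_profinite_completions G H"
proof -
  let ?f = "profinite_limit G H \<Phi>" and ?g = "profinite_limit H G \<Psi>"
  note gf = profinite_limit_inverse[OF G H \<Phi> \<Psi> inv] and fg = profinite_limit_inverse[OF H G \<Psi> \<Phi> inv']
  have "bij_betw ?f (carrier (profinite_completion G)) (carrier (profinite_completion H))"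
    by (rule bij_betw_byWitness[where f' = ?g])
       (use gf fg profinite_limit_mem[OF G H \<Phi>] profinite_limit_mem[OF H G \<Psi>] in auto)
  then have "?f \<in> iso (profinite_completion G) (profinite_completion H)"
    using profinite_limit_hom[OF G H \<Phi>] by (simp add: iso_def)
  moreover have "homeomorphic_maps (profinite_topology G) (profinite_topology H) ?f ?g"
    using gf fg profinite_limit_continuous[OF G H \<Phi>] profinite_limit_continuous[OF H G \<Psi>]
    by (simp add: homeomorphic_maps_def)
  ultimately show ?thesis
    unfolding isomorphic_profinite_completions_def using homeomorphic_maps_map by blast
qed

lemma isomorphic_profinite_completions_of_iso:
  assumes G: "group G" and H: "group H" and "G \<cong> H"
  shows "isomorphic_profinite_completions G H"
proof -
  obtain h where h: "h \<in> iso G H" using assms(3) by (auto simp: is_iso_def)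
  define k where "k = inv_into (carrier G) h"
  have k: "k \<in> iso H G" unfolding k_def by (rule group.iso_set_sym[OF G h])
  have "k (h g) = g" if "g \<in> carrier G" for g
    using h that by (simp add: k_def iso_def bij_betw_def)
  moreover have "h (k g) = g" if "g \<in> carrier H" for g
    using h that by (simp add: k_def iso_def bij_betw_def f_inv_into_f)
  moreover have "profinitely_convergent G H (\<lambda>_. h)" "profinitely_convergent H G (\<lambda>_. k)"
    using h k by (auto simp: profinitely_convergent_def iso_def)
  ultimately show ?thesis
    by (intro isomorphic_profinite_completionsI[OF G H, of "\<lambda>_. h" "\<lambda>_. k"]) auto
qed

lemma isomorphic_profinite_completions_trans:
  assumes "isomorphic_profinite_completions G H" "isomorphic_profinite_completions H K"
  shows "isomorphic_profinite_completions G K"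
  using assms unfolding isomorphic_profinite_completions_def
  by (blast intro: iso_set_trans homeomorphic_map_compose)

lemma isomorphic_profinite_completions_sym:
  assumes "isomorphic_profinite_completions G H" "group G"
  shows "isomorphic_profinite_completions H G"
proof -
  obtain \<phi> where \<phi>: "\<phi> \<in> iso (profinite_completion G) (profinite_completion H)"
      "homeomorphic_map (profinite_topology G) (profinite_topology H) \<phi>"
    using assms(1) by (auto simp: isomorphic_profinite_completions_def)
  let ?\<psi> = "inv_into (carrier (profinite_completion G)) \<phi>"
  have "?\<psi> \<in> iso (profinite_completion H) (profinite_completion G)"
    by (rule group.iso_set_sym[OF group_profinite_completion[OF assms(2)] \<phi>(1)])
  moreover obtain \<psi> where \<psi>: "homeomorphic_maps (profinite_topology G) (profinite_topology H) \<phi> \<psi>"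
    using \<phi>(2) homeomorphic_map_maps by blast
  \<comment> \<open>The inverse homeomorphism and \<open>inv_into\<close> have to agree only on the
    carrier, which is the whole topological space.\<close>
  moreover have "\<psi> x = ?\<psi> x" if "x \<in> topspace (profinite_topology H)" for x
  proof -
    have "\<psi> x \<in> carrier (profinite_completion G)" "\<phi> (\<psi> x) = x"
      using \<psi> that unfolding homeomorphic_maps_def continuous_map_def by auto
    moreover have "inj_on \<phi> (carrier (profinite_completion G))" using \<phi>(1) by (simp add: iso_def bij_betw_def)
    ultimately show ?thesis by (metis inv_into_f_f)
  qed
  moreover have "homeomorphic_map (profinite_topology H) (profinite_topology G) \<psi>"
    using \<psi> homeomorphic_maps_map homeomorphic_maps_sym by blast
  ultimately show ?thesis
    unfolding isomorphic_profinite_completions_def using homeomorphic_map_eq by metis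
qed

section \<open>Residual finiteness and the embedding into the completion\<close>

lemma residually_finite_iso:
  assumes G: "residually_finite G" and H: "group H" and iso: "H \<cong> G"
  shows "residually_finite H"
  unfolding residually_finite_def
proof (intro conjI H ballI impI)
  obtain h where h: "h \<in> iso H G" using iso by (auto simp: is_iso_def)
  have gG: "group G" using G by (simp add: residually_finite_def)
  interpret group_hom H G h using h H gG by (simp add: group_hom_def group_hom_axioms_def iso_def)
  fix x assume x: "x \<in> carrier H" "x \<noteq> \<one>\<^bsub>H\<^esub>"
  then have "h x \<noteq> \<one>\<^bsub>G\<^esub>" using h iso_iff by blast
  then obtain N where "N \<in> finite_index_normal G" "h x \<notin> N"
    using G x by (auto simp: residually_finite_def)
  then show "\<exists>N\<in>finite_index_normal H. x \<notin> N"
    using finite_index_normal_vimage[OF H homh] by (intro bexI[of _ "{g \<in> carrier H. h g \<in> N}"]) auto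
qed

lemma residually_finite_embedding:
  assumes "residually_finite G"
  shows "\<exists>h. h \<in> hom G (profinite_completion G) \<and> inj_on h (carrier G)"
proof -
  let ?h = "\<lambda>g. \<lambda>N\<in>finite_index_normal G. N #>\<^bsub>G\<^esub> g"
  have G: "group G" using assms by (simp add: residually_finite_def)
  interpret G: group G by (rule G)
  have "?h \<in> hom G (profinite_completion G)"
  proof (rule homI)
    fix x assume x: "x \<in> carrier G"
    show "?h x \<in> carrier (profinite_completion G)"
      unfolding profinite_completion_mem using x set_mult_rcos[of _ G _ x]
      by (auto simp: finite_index_normal_def)
    fix y assume y: "y \<in> carrier G"
    show "?h (x \<otimes>\<^bsub>G\<^esub> y) = ?h x \<otimes>\<^bsub>profinite_completion G\<^esub> ?h y"
      using x y normal.rcos_sum[of _ G x y]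
      by (auto simp: profinite_completion_def finite_index_normal_def fun_eq_iff)
  qed
  moreover have "inj_on ?h (carrier G)"
  proof (rule inj_onI)
    fix x y assume xy: "x \<in> carrier G" "y \<in> carrier G" "?h x = ?h y"
    have "x \<otimes>\<^bsub>G\<^esub> inv\<^bsub>G\<^esub> y \<in> N" if "N \<in> finite_index_normal G" for N
      using fun_cong[OF xy(3), of N] that rcos_eq_iff[of N G x y] xy(1,2) by (simp add: finite_index_normal_def)
    then have "x \<otimes>\<^bsub>G\<^esub> inv\<^bsub>G\<^esub> y = \<one>\<^bsub>G\<^esub>" using assms xy by (meson G.inv_closed G.m_closed residually_finite_def)
    then show "x = y" using xy G.inv_equality G.inv_inv by (metis G.inv_closed)
  qed
  ultimately show ?thesis by blast
qed

section \<open>Free groups and presentations\<close>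

definition word_eval :: "('a, 'b) monoid_scheme \<Rightarrow> ('x \<Rightarrow> 'a) \<Rightarrow> (bool \<times> 'x) list \<Rightarrow> 'a"
  where "word_eval G f u =
    foldr (\<lambda>(b, x) a. (if b then f x else inv\<^bsub>G\<^esub> f x) \<otimes>\<^bsub>G\<^esub> a) u \<one>\<^bsub>G\<^esub>"

lemma word_eval_simps [simp]:
  "word_eval G f [] = \<one>\<^bsub>G\<^esub>"
  "word_eval G f ((b, x) # u) = (if b then f x else inv\<^bsub>G\<^esub> f x) \<otimes>\<^bsub>G\<^esub> word_eval G f u"
  by (simp_all add: word_eval_def)

lemma group_words_simps [simp]:
  "[] \<in> group_words X"
  "(b, x) # u \<in> group_words X \<longleftrightarrow> x \<in> X \<and> u \<in> group_words X"
  "u @ v \<in> group_words X \<longleftrightarrow> u \<in> group_words X \<and> v \<in> group_words X"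
  by (auto simp: group_words_def)

lemma group_words_induct [consumes 1, case_names Nil Cons]:
  assumes "u \<in> group_words X" "P []"
    and "\<And>b x u. x \<in> X \<Longrightarrow> u \<in> group_words X \<Longrightarrow> P u \<Longrightarrow> P ((b, x) # u)"
  shows "P u"
  using assms(1)
proof (induction u)
  case (Cons l u)
  then show ?case using assms(3) by (cases l) auto
qed (rule assms(2))

context group
begin

lemma word_eval_closed [simp]:
  assumes "u \<in> group_words X" "f \<in> X \<rightarrow> carrier G"
  shows "word_eval G f u \<in> carrier G"
  using assms by (induction rule: group_words_induct) auto

lemma word_eval_append:
  assumes "u \<in> group_words X" "v \<in> group_words X" "f \<in> X \<rightarrow> carrier G"
  shows "word_eval G f (u @ v) = word_eval G f u \<otimes> word_eval G f v"
  using assms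
proof (induction rule: group_words_induct)
  case (Cons b x u)
  then have "f x \<in> carrier G" "word_eval G f u \<in> carrier G" "word_eval G f v \<in> carrier G"
    using word_eval_closed by auto
  then show ?case using Cons by (simp add: m_assoc)
qed (use word_eval_closed in auto)

lemma word_eval_word_rel:
  assumes "(u, v) \<in> word_rel X" "f \<in> X \<rightarrow> carrier G"
  shows "word_eval G f u = word_eval G f v"
  using assms
proof (induction rule: word_rel.induct)
  case (word_rel_cancel u v x b)
  then have "f x \<in> carrier G" "word_eval G f u \<in> carrier G" "word_eval G f v \<in> carrier G"
    using word_eval_closed by auto
  moreover have "word_eval G f (u @ [(b, x), (\<not> b, x)] @ v) =
      word_eval G f u \<otimes> word_eval G f ([(b, x), (\<not> b, x)] @ v)"
    by (rule word_eval_append) (use word_rel_cancel in auto)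
  moreover have "word_eval G f (u @ v) = word_eval G f u \<otimes> word_eval G f v"
    by (rule word_eval_append) (use word_rel_cancel in auto)
  ultimately show ?case by (auto simp: m_assoc) (simp_all flip: m_assoc)
qed auto

lemma word_eval_generate:
  assumes "u \<in> group_words X" "f \<in> X \<rightarrow> carrier G"
  shows "word_eval G f u \<in> generate G (f ` X)"
  using assms(1)
proof (induction rule: group_words_induct)
  case (Cons b x u)
  then show ?case using generate.eng[OF generate.incl[of "f x" "f ` X"], of _ G]
      generate.eng[OF generate.inv[of "f x" "f ` X"], of _ G] by auto
qed (auto intro: generate.one)

end

lemma word_eval_hom:
  assumes "group_hom G H h" "u \<in> group_words X" "f \<in> X \<rightarrow> carrier G"
  shows "h (word_eval G f u) = word_eval H (h \<circ> f) u"
proof -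
  interpret group_hom G H h by fact
  show ?thesis using assms(2)
  proof (induction rule: group_words_induct)
    case (Cons b x u)
    then have "f x \<in> carrier G" "word_eval G f u \<in> carrier G" using assms(3) G.word_eval_closed by auto
    then show ?case using Cons by auto
  qed simp
qed

abbreviation word_class :: "'x set \<Rightarrow> (bool \<times> 'x) list \<Rightarrow> (bool \<times> 'x) list set"
  where "word_class X u \<equiv> word_rel X `` {u}"

lemma carrier_free_group: "carrier (free_group X) = word_class X ` group_words X"
  by (auto simp: free_group_def quotient_def)

lemma word_class_closed: "u \<in> group_words X \<Longrightarrow> word_class X u \<in> carrier (free_group X)"
  by (simp add: carrier_free_group)

lemma one_free_group: "\<one>\<^bsub>free_group X\<^esub> = word_class X []"
  by (simp add: free_group_def)

lemma inv_free_group_letter: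
  assumes "x \<in> X"
  shows "inv\<^bsub>free_group X\<^esub> word_class X [(b, x)] = word_class X [(\<not> b, x)]"
proof -
  interpret group "free_group X" by (rule group_free_group)
  have "([(\<not> b, x), (b, x)], []) \<in> word_rel X"
    using word_rel_cancel[of "[]" X "[]" x "\<not> b"] assms by simp
  then have "word_class X [(\<not> b, x)] \<otimes>\<^bsub>free_group X\<^esub> word_class X [(b, x)] = \<one>\<^bsub>free_group X\<^esub>"
    using assms by (simp add: free_group_mult_class one_free_group equiv_class_eq[OF equiv_word_rel])
  then show ?thesis by (rule inv_equality) (use assms in \<open>auto simp: carrier_free_group\<close>)
qed

text \<open>Evaluating at the generators of the free group itself changes nothing; hence a
  homomorphism out of the free group evaluates words at the images of the generators.\<close>

lemma word_class_eq_word_eval: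
  assumes "u \<in> group_words X"
  shows "word_class X u = word_eval (free_group X) (\<lambda>x. word_class X [(True, x)]) u"
  using assms
proof (induction rule: group_words_induct)
  case (Cons b x u)
  have "word_class X ((b, x) # u) = word_class X [(b, x)] \<otimes>\<^bsub>free_group X\<^esub> word_class X u"
    using Cons.hyps by (simp add: free_group_mult_class)
  then show ?case using Cons inv_free_group_letter[of x X True] by (cases b) auto
qed (simp add: one_free_group)

lemma free_group_lift:
  assumes "group G" "f \<in> X \<rightarrow> carrier G"
  obtains h where "h \<in> hom (free_group X) G"
    "\<And>u. u \<in> group_words X \<Longrightarrow> h (word_class X u) = word_eval G f u"
proof
  interpret group G by fact
  \<comment> \<open>Evaluation is constant on each class, so the choice of the word is
    harmless.\<close>
  let ?h = "\<lambda>A. word_eval G f (SOME u. u \<in> A)"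
  show eval: "?h (word_class X u) = word_eval G f u" if u: "u \<in> group_words X" for u
  proof -
    have "(SOME v. v \<in> word_class X u) \<in> word_class X u"
      by (rule someI[of _ u]) (use u in \<open>auto intro: word_rel_refl\<close>)
    then show ?thesis using word_eval_word_rel[OF _ assms(2)] by (metis Image_singleton_iff)
  qed
  show "?h \<in> hom (free_group X) G"
  proof (rule homI)
    fix A assume "A \<in> carrier (free_group X)"
    then obtain u where u: "u \<in> group_words X" "A = word_class X u" by (auto simp: carrier_free_group)
    then show "?h A \<in> carrier G" using eval word_eval_closed[OF _ assms(2)] by simp
    fix B assume "B \<in> carrier (free_group X)"
    then obtain v where v: "v \<in> group_words X" "B = word_class X v" by (auto simp: carrier_free_group)
    show "?h (A \<otimes>\<^bsub>free_group X\<^esub> B) = ?h A \<otimes>\<^bsub>G\<^esub> ?h B"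
      using u v eval word_eval_append[OF _ _ assms(2)] by (simp add: free_group_mult_class)
  qed
qed

lemma normal_closure_least:
  "N \<lhd> G \<Longrightarrow> R \<subseteq> N \<Longrightarrow> normal_closure G R \<subseteq> N"
  by (auto simp: normal_closure_def)

lemma normal_closure_incl: "R \<subseteq> normal_closure G R"
  by (auto simp: normal_closure_def)

lemma FactGroup_hom_rcos:
  assumes "N \<lhd> G"
  shows "group_hom G (G Mod N) (\<lambda>g. N #>\<^bsub>G\<^esub> g)"
  using assms normal.r_coset_hom_Mod[OF assms] normal.factorgroup_is_group[OF assms]
  by (simp add: group_hom_def group_hom_axioms_def normal_def)

lemma generate_hom_surj:
  assumes "group_hom G H h" "S \<subseteq> carrier G" "generate H (h ` S) = carrier H"
  shows "h ` carrier G = carrier H"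
proof -
  interpret group_hom G H h by fact
  have "generate H (h ` S) \<subseteq> h ` carrier G"
    by (rule H.generate_subgroup_incl) (use assms(2) img_is_subgroup in auto)
  then show ?thesis using assms(3) by auto
qed

text \<open>
  Relations are given as pairs of words. To see that they suffice, it is enough to check that
  every group generated by elements satisfying them and mapping onto \<open>G\<close> maps injectively.
\<close>

lemma finitely_presentedI:
  fixes G :: "('a, 'b) monoid_scheme" and X :: "nat set"
  assumes G: "group G" and X: "finite X" and f: "f \<in> X \<rightarrow> carrier G"
    and gen: "generate G (f ` X) = carrier G"
    and Rel: "finite Rel" "Rel \<subseteq> group_words X \<times> group_words X"
    and rel: "\<And>u v. (u, v) \<in> Rel \<Longrightarrow> word_eval G f u = word_eval G f v"
    and suff: "\<And>(P :: (bool \<times> nat) list set set monoid) p \<pi> g.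
      \<lbrakk>group P; p \<in> X \<rightarrow> carrier P; generate P (p ` X) = carrier P;
       \<And>u v. (u, v) \<in> Rel \<Longrightarrow> word_eval P p u = word_eval P p v;
       \<pi> \<in> hom P G; \<And>x. x \<in> X \<Longrightarrow> \<pi> (p x) = f x; g \<in> carrier P; \<pi> g = \<one>\<^bsub>G\<^esub>\<rbrakk> \<Longrightarrow> g = \<one>\<^bsub>P\<^esub>"
  shows "finitely_presented G"
proof -
  let ?F = "free_group X"
  interpret F: group ?F by (rule group_free_group)
  interpret G: group G by (rule G)
  define R where "R = (\<lambda>(u, v). word_class X u \<otimes>\<^bsub>?F\<^esub> inv\<^bsub>?F\<^esub> word_class X v) ` Rel"
  have RF: "R \<subseteq> carrier ?F" "finite R" using Rel by (auto simp: R_def intro!: word_class_closed)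
  define N where "N = normal_closure ?F R"
  have N: "N \<lhd> ?F" unfolding N_def by (rule normal_normal_closure[OF group_free_group RF(1)])
  let ?P = "?F Mod N"
  interpret q: group_hom ?F ?P "\<lambda>g. N #>\<^bsub>?F\<^esub> g" by (rule FactGroup_hom_rcos[OF N])
  obtain h where h: "h \<in> hom ?F G" and heval: "\<And>u. u \<in> group_words X \<Longrightarrow> h (word_class X u) = word_eval G f u"
    using free_group_lift[OF G f] by blast
  interpret h: group_hom ?F G h using h by (simp add: group_hom_def group_hom_axioms_def G F.is_group)
  have "R \<subseteq> kernel ?F G h"
  proof
    fix r assume "r \<in> R"
    then obtain u v where uv: "(u, v) \<in> Rel" "r = word_class X u \<otimes>\<^bsub>?F\<^esub> inv\<^bsub>?F\<^esub> word_class X v"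
      by (auto simp: R_def)
    then have w: "u \<in> group_words X" "v \<in> group_words X" using Rel by auto
    then have "h r = \<one>\<^bsub>G\<^esub>"
      using uv heval rel[OF uv(1)] G.word_eval_closed[OF w(2) f] by (simp add: word_class_closed)
    then show "r \<in> kernel ?F G h" using uv w by (simp add: kernel_def word_class_closed)
  qed
  \<comment> \<open>The relators die in \<open>G\<close>, hence so does their normal closure, and
    \<open>h\<close> factors through the presented group \<open>?P\<close>.\<close>
  then have Nker: "N \<subseteq> kernel ?F G h"
    unfolding N_def by (rule normal_closure_least[OF h.normal_kernel])
  have cosets: "h x = h y" if "x \<in> carrier ?F" "y \<in> carrier ?F" "N #>\<^bsub>?F\<^esub> x = N #>\<^bsub>?F\<^esub> y" for x y
  proof -
    have "h (x \<otimes>\<^bsub>?F\<^esub> inv\<^bsub>?F\<^esub> y) = \<one>\<^bsub>G\<^esub>" using that rcos_eq_iff[OF N] Nker by (auto simp: kernel_def)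
    then show ?thesis using that by (metis F.inv_closed G.inv_equality G.inv_inv h.hom_closed h.hom_inv h.hom_mult)
  qed
  obtain \<pi> where \<pi>: "\<pi> \<in> hom ?P G" "\<And>x. x \<in> carrier ?F \<Longrightarrow> \<pi> (N #>\<^bsub>?F\<^esub> x) = h x"
    using FactGroup_universal[OF h N cosets] by blast
  define p where "p = (\<lambda>x. N #>\<^bsub>?F\<^esub> word_class X [(True, x)])"
  have letter: "(\<lambda>x. word_class X [(True, x)]) \<in> X \<rightarrow> carrier ?F" by (auto simp: carrier_free_group)
  have p: "p \<in> X \<rightarrow> carrier ?P" using letter q.hom_closed by (auto simp: p_def Pi_iff)
  have peval: "word_eval ?P p u = N #>\<^bsub>?F\<^esub> word_class X u" if "u \<in> group_words X" for u
    using word_eval_hom[OF q.group_hom_axioms that letter] word_class_eq_word_eval[OF that]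
    by (simp add: p_def o_def)
  have pgen: "generate ?P (p ` X) = carrier ?P"
  proof
    show "generate ?P (p ` X) \<subseteq> carrier ?P" using p by (intro q.H.generate_incl) auto
    show "carrier ?P \<subseteq> generate ?P (p ` X)"
    proof
      fix C assume "C \<in> carrier ?P"
      then obtain u where "u \<in> group_words X" "C = N #>\<^bsub>?F\<^esub> word_class X u"
        by (auto simp: carrier_FactGroup carrier_free_group)
      then show "C \<in> generate ?P (p ` X)" using q.H.word_eval_generate[OF _ p] peval by metis
    qed
  qed
  have prel: "word_eval ?P p u = word_eval ?P p v" if "(u, v) \<in> Rel" for u v
  proof -
    have w: "u \<in> group_words X" "v \<in> group_words X" using that Rel by auto
    have "word_class X u \<otimes>\<^bsub>?F\<^esub> inv\<^bsub>?F\<^esub> word_class X v \<in> N"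
      using that normal_closure_incl[of R ?F] by (auto simp: N_def R_def)
    then show ?thesis using w peval rcos_eq_iff[OF N] by (simp add: carrier_free_group)
  qed
  have \<pi>p: "\<pi> (p x) = f x" if "x \<in> X" for x
    using that f \<pi>(2) heval[of "[(True, x)]"] G.r_one by (auto simp: p_def Pi_iff word_class_closed)
  interpret \<pi>: group_hom ?P G \<pi>
    using \<pi>(1) by (simp add: group_hom_def group_hom_axioms_def G q.H.is_group)
  have "generate G (\<pi> ` p ` X) = carrier G"
    using gen \<pi>p by (simp add: image_image cong: image_cong)
  then have "\<pi> ` carrier ?P = carrier G"
    using generate_hom_surj[OF \<pi>.group_hom_axioms, of "p ` X"] p by blast
  \<comment> \<open>\<open>suff\<close> is applied to the presented group itself, whose type is the
    one fixed in that hypothesis.\<close>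
  moreover have "g = \<one>\<^bsub>?P\<^esub>" if "g \<in> carrier ?P" "\<pi> g = \<one>\<^bsub>G\<^esub>" for g
    using suff[OF q.H.is_group p pgen prel \<pi>(1) \<pi>p that] .
  ultimately have "\<pi> \<in> iso ?P G" using \<pi>.iso_iff by blast
  then have "G \<cong> ?P" using q.H.iso_set_sym is_isoI by blast
  then show ?thesis
    unfolding finitely_presented_def N_def using G X RF by blast
qed

section \<open>Maximal condition on normal subgroups of metabelian groups\<close>

definition op_subgroup :: "('a, 'b) monoid_scheme \<Rightarrow> ('a \<Rightarrow> 'a) set \<Rightarrow> 'a set \<Rightarrow> bool"
  where "op_subgroup G \<Omega> N \<longleftrightarrow> subgroup N G \<and> (\<forall>f\<in>\<Omega>. f ` N \<subseteq> N)"

definition op_span :: "('a, 'b) monoid_scheme \<Rightarrow> ('a \<Rightarrow> 'a) set \<Rightarrow> 'a set \<Rightarrow> 'a set"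
  where "op_span G \<Omega> E = \<Inter>{N. op_subgroup G \<Omega> N \<and> E \<subseteq> N}"

text \<open>For an abelian group with commuting operators these are the noetherian modules over the
  polynomial ring \<open>Z[\<Omega>]\<close>; operators make it possible to speak of them without an
  action of that ring.\<close>

definition op_noetherian :: "('a, 'b) monoid_scheme \<Rightarrow> ('a \<Rightarrow> 'a) set \<Rightarrow> 'a set \<Rightarrow> bool"
  where "op_noetherian G \<Omega> B \<longleftrightarrow> op_subgroup G \<Omega> B \<and>
    (\<forall>N. op_subgroup G \<Omega> N \<longrightarrow> N \<subseteq> B \<longrightarrow> (\<exists>E. finite E \<and> N = op_span G \<Omega> E))"

lemma op_span_least: "op_subgroup G \<Omega> N \<Longrightarrow> E \<subseteq> N \<Longrightarrow> op_span G \<Omega> E \<subseteq> N"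
  by (auto simp: op_span_def)

lemma op_span_incl: "E \<subseteq> op_span G \<Omega> E"
  by (auto simp: op_span_def)

text \<open>The hypothesis supplies a member of the family; the intersection of an empty family
  would be the whole type.\<close>

lemma (in group) op_subgroup_op_span:
  assumes "op_subgroup G \<Omega> N" "E \<subseteq> N"
  shows "op_subgroup G \<Omega> (op_span G \<Omega> E)"
  unfolding op_subgroup_def
proof
  show "subgroup (op_span G \<Omega> E) G"
    unfolding op_span_def by (rule subgroups_Inter) (use assms in \<open>auto simp: op_subgroup_def\<close>)
  show "\<forall>f\<in>\<Omega>. f ` op_span G \<Omega> E \<subseteq> op_span G \<Omega> E"
    unfolding op_span_def by (auto simp: op_subgroup_def)
qed

lemma finite_subset_chain:
  assumes "finite E" "E \<subseteq> (\<Union>i. L (i :: nat))" "\<And>i. L i \<subseteq> L (Suc i)"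
  shows "\<exists>m. E \<subseteq> L m"
  using assms(1,2)
proof induction
  case (insert x E)
  then obtain m k where "E \<subseteq> L m" "x \<in> L k" by auto
  moreover have "L i \<subseteq> L j" if "i \<le> j" for i j
    using lift_Suc_mono_le[of L, OF assms(3) that] .
  ultimately have "insert x E \<subseteq> L (max m k)"
    by (metis insert_subset max.cobounded1 max.cobounded2 order_trans subsetD)
  then show ?case by blast
qed simp

lemma (in group) subgroup_Union_chain:
  assumes L: "\<And>i. subgroup (L i) G" and mono: "\<And>i :: nat. L i \<subseteq> L (Suc i)"
  shows "subgroup (\<Union>i. L i) G"
proof (rule subgroupI)
  show "(\<Union>i. L i) \<noteq> {}" using subgroup.one_closed[OF L] by blast
  show "a \<otimes> b \<in> (\<Union>i. L i)" if a: "a \<in> (\<Union>i. L i)" and b: "b \<in> (\<Union>i. L i)" for a b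
  proof -
    have le: "L i \<subseteq> L j" if "i \<le> j" for i j using lift_Suc_mono_le[of L, OF mono that] .
    obtain i j where "a \<in> L i" "b \<in> L j" using a b by auto
    then have "a \<in> L (max i j)" "b \<in> L (max i j)"
      using le[OF max.cobounded1] le[OF max.cobounded2] by blast+
    then show ?thesis using subgroup.m_closed[OF L] by blast
  qed
qed (use subgroup.mem_carrier[OF L] subgroup.m_inv_closed[OF L] in blast)+

text \<open>
  The proof of the Hilbert basis theorem. The subgroup \<open>op_poly G f B i\<close> plays the role of the
  polynomials of degree less than \<open>i\<close> in the indeterminate \<open>f\<close> with coefficients in \<open>B\<close>.
\<close>

primrec op_poly :: "('a, 'b) monoid_scheme \<Rightarrow> ('a \<Rightarrow> 'a) \<Rightarrow> 'a set \<Rightarrow> nat \<Rightarrow> 'a set"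
  where
    "op_poly G f B 0 = {\<one>\<^bsub>G\<^esub>}"
  | "op_poly G f B (Suc i) = {c \<otimes>\<^bsub>G\<^esub> (f ^^ i) b | c b. c \<in> op_poly G f B i \<and> b \<in> B}"

text \<open>Hilbert's ideals of leading coefficients. An element may be written as a polynomial in
  \<open>f\<close> in several ways, so a coefficient counts as soon as one of them has it.\<close>

definition lead_coeffs where
  "lead_coeffs G f B N i = {b \<in> B. \<exists>c\<in>op_poly G f B i. c \<otimes>\<^bsub>G\<^esub> (f ^^ i) b \<in> N}"

locale operator_extension = comm_group G for G (structure) +
  fixes \<Omega> :: "('a \<Rightarrow> 'a) set" and f :: "'a \<Rightarrow> 'a" and B :: "'a set"
  assumes ops: "\<Omega> \<subseteq> hom G G" and f: "f \<in> hom G G"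
    and commute: "\<And>g a. g \<in> \<Omega> \<Longrightarrow> a \<in> carrier G \<Longrightarrow> f (g a) = g (f a)"
    and B: "op_subgroup G \<Omega> B"
begin

lemma B_subgroup: "subgroup B G"
  using B by (simp add: op_subgroup_def)

lemmas B_closed = subgroup.mem_carrier[OF B_subgroup] subgroup.one_closed[OF B_subgroup]
  subgroup.m_closed[OF B_subgroup] subgroup.m_inv_closed[OF B_subgroup]

lemma B_op: "g \<in> \<Omega> \<Longrightarrow> b \<in> B \<Longrightarrow> g b \<in> B"
  using B by (auto simp: op_subgroup_def)

lemma pow_hom: "group_hom G G (f ^^ i)"
proof -
  have "(f ^^ i) \<in> hom G G"
    using f by (induction i) (auto simp: hom_def Pi_iff)
  then show ?thesis by (simp add: group_hom_def group_hom_axioms_def is_group)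
qed

lemma op_hom: "g \<in> \<Omega> \<Longrightarrow> group_hom G G g"
  using ops by (auto simp: group_hom_def group_hom_axioms_def is_group)

lemma pow_closed: "a \<in> carrier G \<Longrightarrow> (f ^^ i) a \<in> carrier G"
  using group_hom.hom_closed[OF pow_hom] .

lemma pow_commute: "g \<in> \<Omega> \<Longrightarrow> a \<in> carrier G \<Longrightarrow> (f ^^ i) (g a) = g ((f ^^ i) a)"
  by (induction i) (simp_all add: commute pow_closed)

lemma op_poly_subgroup: "subgroup (op_poly G f B i) G"
proof (induction i)
  case 0
  show ?case by (simp add: triv_subgroup)
next
  case (Suc i)
  interpret p: group_hom G G "f ^^ i" by (rule pow_hom)
  note C = subgroup.mem_carrier[OF Suc] subgroup.one_closed[OF Suc]
    subgroup.m_closed[OF Suc] subgroup.m_inv_closed[OF Suc]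
  show ?case
  proof (rule subgroupI)
    show "op_poly G f B (Suc i) \<subseteq> carrier G" using C B_closed by auto
    show "op_poly G f B (Suc i) \<noteq> {}" using C(2) B_closed(2) by auto
    show "inv a \<in> op_poly G f B (Suc i)" if a: "a \<in> op_poly G f B (Suc i)" for a
    proof -
      obtain c b where "c \<in> op_poly G f B i" "b \<in> B" "a = c \<otimes> (f ^^ i) b"
        using a by auto
      then have "inv a = inv c \<otimes> (f ^^ i) (inv b)" "inv c \<in> op_poly G f B i" "inv b \<in> B"
        using C B_closed by (auto simp: inv_mult)
      then show ?thesis by auto
    qed
    show "a \<otimes> a' \<in> op_poly G f B (Suc i)"
      if a: "a \<in> op_poly G f B (Suc i)" and a': "a' \<in> op_poly G f B (Suc i)" for a a'
    proof -
      obtain c b where cb: "c \<in> op_poly G f B i" "b \<in> B" "a = c \<otimes> (f ^^ i) b"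
        using a by auto
      obtain c' b' where cb': "c' \<in> op_poly G f B i" "b' \<in> B" "a' = c' \<otimes> (f ^^ i) b'"
        using a' by auto
      have "a \<otimes> a' = (c \<otimes> c') \<otimes> (f ^^ i) (b \<otimes> b')"
        using cb cb' C(1) B_closed(1) pow_closed by (simp add: m_ac)
      moreover have "c \<otimes> c' \<in> op_poly G f B i" "b \<otimes> b' \<in> B" using cb cb' C(3) B_closed(3) by auto
      ultimately show ?thesis by auto
    qed
  qed
qed

lemmas op_poly_closed = subgroup.mem_carrier[OF op_poly_subgroup] subgroup.one_closed[OF op_poly_subgroup]
  subgroup.m_closed[OF op_poly_subgroup] subgroup.m_inv_closed[OF op_poly_subgroup]

lemma op_poly_op:
  assumes "g \<in> \<Omega>" "c \<in> op_poly G f B i"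
  shows "g c \<in> op_poly G f B i"
  using assms(2)
proof (induction i arbitrary: c)
  case 0
  interpret g: group_hom G G g by (rule op_hom[OF assms(1)])
  show ?case using 0 by simp
next
  case (Suc i)
  interpret g: group_hom G G g by (rule op_hom[OF assms(1)])
  obtain c' b where "c' \<in> op_poly G f B i" "b \<in> B" "c = c' \<otimes> (f ^^ i) b" using Suc.prems by auto
  moreover from this have "g c = g c' \<otimes> (f ^^ i) (g b)"
    using pow_commute[OF assms(1)] op_poly_closed(1) B_closed(1) pow_closed by simp
  ultimately show ?case using Suc.IH B_op[OF assms(1)] by auto
qed

lemma op_poly_Suc: "op_poly G f B i \<subseteq> op_poly G f B (Suc i)"
proof
  interpret p: group_hom G G "f ^^ i" by (rule pow_hom)
  fix c assume c: "c \<in> op_poly G f B i"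
  then have "c = c \<otimes> (f ^^ i) \<one>" using op_poly_closed(1) by simp
  then show "c \<in> op_poly G f B (Suc i)" using c B_closed(2) by (auto simp only: op_poly.simps)
qed

lemma op_poly_shift: "c \<in> op_poly G f B i \<Longrightarrow> f c \<in> op_poly G f B (Suc i)"
proof (induction i arbitrary: c)
  case 0
  interpret f: group_hom G G f using pow_hom[of 1] by simp
  show ?case using 0 op_poly_closed(2)[of 1] by simp
next
  case (Suc i)
  interpret f: group_hom G G f using pow_hom[of 1] by simp
  obtain c' b where cb: "c' \<in> op_poly G f B i" "b \<in> B" "c = c' \<otimes> (f ^^ i) b" using Suc.prems by auto
  then have "f c = f c' \<otimes> (f ^^ Suc i) b"
    using op_poly_closed(1) B_closed(1) pow_closed by simp
  then show ?case using Suc.IH[OF cb(1)] cb(2) op_poly.simps(2)[of G f B "Suc i"] by blast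
qed

lemma op_poly_shift_pow: "c \<in> op_poly G f B i \<Longrightarrow> (f ^^ k) c \<in> op_poly G f B (k + i)"
  using op_poly_shift by (induction k) auto

lemma op_subgroup_op_poly_Union: "op_subgroup G (insert f \<Omega>) (\<Union>i. op_poly G f B i)"
proof -
  have "subgroup (\<Union>i. op_poly G f B i) G"
    by (rule subgroup_Union_chain) (rule op_poly_subgroup, rule op_poly_Suc)
  moreover have "g ` (\<Union>i. op_poly G f B i) \<subseteq> (\<Union>i. op_poly G f B i)" if "g \<in> \<Omega>" for g
    using op_poly_op[OF that] by blast
  moreover have "f ` (\<Union>i. op_poly G f B i) \<subseteq> (\<Union>i. op_poly G f B i)"
    using op_poly_shift by blast
  ultimately show ?thesis by (simp only: op_subgroup_def) blast
qed

lemma lead_coeffs_op_subgroup: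
  assumes N: "op_subgroup G (insert f \<Omega>) N"
  shows "op_subgroup G \<Omega> (lead_coeffs G f B N i)"
proof -
  interpret p: group_hom G G "f ^^ i" by (rule pow_hom)
  have Ns: "subgroup N G" using N by (simp add: op_subgroup_def)
  note Nc = subgroup.one_closed[OF Ns] subgroup.m_closed[OF Ns] subgroup.m_inv_closed[OF Ns]
  have intro: "b \<in> lead_coeffs G f B N i"
    if "b \<in> B" "c \<in> op_poly G f B i" "c \<otimes> (f ^^ i) b \<in> N" for b c
    using that by (auto simp: lead_coeffs_def)
  have "subgroup (lead_coeffs G f B N i) G"
  proof (rule subgroupI)
    show "lead_coeffs G f B N i \<subseteq> carrier G" using B_closed(1) by (auto simp: lead_coeffs_def)
    have "\<one> \<in> lead_coeffs G f B N i"
      by (rule intro[OF B_closed(2) op_poly_closed(2)]) (use Nc in simp)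
    then show "lead_coeffs G f B N i \<noteq> {}" by blast
    show "inv b \<in> lead_coeffs G f B N i" if b: "b \<in> lead_coeffs G f B N i" for b
    proof -
      obtain c where c: "b \<in> B" "c \<in> op_poly G f B i" "c \<otimes> (f ^^ i) b \<in> N"
        using b by (auto simp: lead_coeffs_def)
      then have "inv (c \<otimes> (f ^^ i) b) = inv c \<otimes> (f ^^ i) (inv b)"
        using op_poly_closed(1) B_closed(1) by (simp add: inv_mult)
      then show ?thesis using intro[of "inv b" "inv c"] c op_poly_closed(4) B_closed(4) Nc(3) by metis
    qed
    show "b \<otimes> b' \<in> lead_coeffs G f B N i"
      if b: "b \<in> lead_coeffs G f B N i" and b': "b' \<in> lead_coeffs G f B N i" for b b'
    proof -
      obtain c where c: "b \<in> B" "c \<in> op_poly G f B i" "c \<otimes> (f ^^ i) b \<in> N"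
        using b by (auto simp: lead_coeffs_def)
      obtain c' where c': "b' \<in> B" "c' \<in> op_poly G f B i" "c' \<otimes> (f ^^ i) b' \<in> N"
        using b' by (auto simp: lead_coeffs_def)
      have "(c \<otimes> (f ^^ i) b) \<otimes> (c' \<otimes> (f ^^ i) b') = (c \<otimes> c') \<otimes> (f ^^ i) (b \<otimes> b')"
        using c c' op_poly_closed(1) B_closed(1) pow_closed by (simp add: m_ac)
      then show ?thesis
        using intro[of "b \<otimes> b'" "c \<otimes> c'"] c c' op_poly_closed(3) B_closed(3) Nc(2) by metis
    qed
  qed
  moreover have "g b \<in> lead_coeffs G f B N i" if g: "g \<in> \<Omega>" and b: "b \<in> lead_coeffs G f B N i" for g b
  proof -
    interpret g: group_hom G G g by (rule op_hom[OF g])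
    obtain c where c: "b \<in> B" "c \<in> op_poly G f B i" "c \<otimes> (f ^^ i) b \<in> N"
      using b by (auto simp: lead_coeffs_def)
    then have "g (c \<otimes> (f ^^ i) b) = g c \<otimes> (f ^^ i) (g b)"
      using pow_commute[OF g] op_poly_closed(1) B_closed(1) pow_closed by simp
    moreover have "g (c \<otimes> (f ^^ i) b) \<in> N" using N g c(3) by (auto simp: op_subgroup_def)
    ultimately show ?thesis using intro[of "g b" "g c"] op_poly_op[OF g c(2)] B_op[OF g c(1)] by simp
  qed
  ultimately show ?thesis by (auto simp: op_subgroup_def)
qed

text \<open>Applying \<open>f\<close> to an element of \<open>N\<close> raises its degree and keeps
  its leading coefficient.\<close>

lemma lead_coeffs_Suc:
  assumes N: "op_subgroup G (insert f \<Omega>) N"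
  shows "lead_coeffs G f B N i \<subseteq> lead_coeffs G f B N (Suc i)"
proof
  interpret f: group_hom G G f using pow_hom[of 1] by simp
  fix b assume "b \<in> lead_coeffs G f B N i"
  then obtain c where c: "b \<in> B" "c \<in> op_poly G f B i" "c \<otimes> (f ^^ i) b \<in> N"
    by (auto simp: lead_coeffs_def)
  then have "f (c \<otimes> (f ^^ i) b) = f c \<otimes> (f ^^ Suc i) b"
    using op_poly_closed(1) B_closed(1) pow_closed by simp
  moreover have "f (c \<otimes> (f ^^ i) b) \<in> N" using N c(3) by (auto simp: op_subgroup_def)
  ultimately show "b \<in> lead_coeffs G f B N (Suc i)"
    using op_poly_shift[OF c(2)] c(1) unfolding lead_coeffs_def by auto
qed

text \<open>The ideals of leading coefficients increase and their union is finitely generated, so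
  they are constant from some \<open>m\<close> on. Lifts of finitely many generators of the ideals
  up to degree \<open>m\<close> generate \<open>N\<close>: subtracting an element of their span
  lowers the degree of any given element.\<close>

theorem op_noetherian_extend:
  assumes noeth: "op_noetherian G \<Omega> B"
  shows "op_noetherian G (insert f \<Omega>) (\<Union>i. op_poly G f B i)"
  unfolding op_noetherian_def
proof (intro conjI allI impI op_subgroup_op_poly_Union)
  fix N assume N: "op_subgroup G (insert f \<Omega>) N" and NB: "N \<subseteq> (\<Union>i. op_poly G f B i)"
  have Ns: "subgroup N G" using N by (simp add: op_subgroup_def)
  let ?L = "lead_coeffs G f B N"
  have LB: "?L i \<subseteq> B" for i by (auto simp: lead_coeffs_def)
  have Lmono: "?L i \<subseteq> ?L j" if "i \<le> j" for i j
    using lift_Suc_mono_le[of ?L, OF lead_coeffs_Suc[OF N] that] .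
  have Lsub: "op_subgroup G \<Omega> (?L i)" for i by (rule lead_coeffs_op_subgroup[OF N])
  have "op_subgroup G \<Omega> (\<Union>i. ?L i)"
  proof -
    have "subgroup (\<Union>i. ?L i) G"
      by (rule subgroup_Union_chain)
         (use Lsub in \<open>simp add: op_subgroup_def\<close>, rule lead_coeffs_Suc[OF N])
    moreover have "g ` (\<Union>i. ?L i) \<subseteq> (\<Union>i. ?L i)" if "g \<in> \<Omega>" for g
      using Lsub that unfolding op_subgroup_def by blast
    ultimately show ?thesis by (simp add: op_subgroup_def)
  qed
  then obtain E where E: "finite E" "(\<Union>i. ?L i) = op_span G \<Omega> E"
    using noeth LB unfolding op_noetherian_def by (metis UN_least)
  then obtain m where m: "E \<subseteq> ?L m"
    using finite_subset_chain[of E ?L] lead_coeffs_Suc[OF N] op_span_incl[of E G \<Omega>] by auto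
  have Lm: "?L i \<subseteq> ?L m" for i
    using op_span_least[OF Lsub m] E(2) by blast
  have "\<forall>i. \<exists>E. finite E \<and> ?L i = op_span G \<Omega> E"
    using noeth LB Lsub unfolding op_noetherian_def by blast
  then obtain Es where Es: "\<And>i. finite (Es i)" "\<And>i. ?L i = op_span G \<Omega> (Es i)" by metis
  have EsL: "Es i \<subseteq> ?L i" for i using op_span_incl[of "Es i"] Es(2) by auto
  then have "\<forall>i. \<forall>b\<in>Es i. \<exists>c\<in>op_poly G f B i. c \<otimes> (f ^^ i) b \<in> N"
    unfolding lead_coeffs_def by blast
  then obtain lc where lc: "\<And>i b. b \<in> Es i \<Longrightarrow> lc i b \<in> op_poly G f B i"
      "\<And>i b. b \<in> Es i \<Longrightarrow> lc i b \<otimes> (f ^^ i) b \<in> N" by metis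
  define F where "F = (\<Union>i\<le>m. (\<lambda>b. lc i b \<otimes> (f ^^ i) b) ` Es i)"
  have F: "finite F" "F \<subseteq> N" using Es(1) lc(2) by (auto simp: F_def)
  define S where "S = op_span G (insert f \<Omega>) F"
  have SN: "S \<subseteq> N" unfolding S_def by (rule op_span_least[OF N F(2)])
  have S: "op_subgroup G (insert f \<Omega>) S" unfolding S_def by (rule op_subgroup_op_span[OF N F(2)])
  then have Ss: "subgroup S G" by (simp add: op_subgroup_def)
  have fS: "(f ^^ k) s \<in> S" if "s \<in> S" for k s
    using that S by (induction k) (auto simp: op_subgroup_def)
  have "N \<inter> op_poly G f B i \<subseteq> S" for i
  proof (induction i)
    case 0
    then show ?case using subgroup.one_closed[OF Ss] by auto
  next
    case (Suc i)
    show ?case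
    proof
      fix n assume n: "n \<in> N \<inter> op_poly G f B (Suc i)"
      then obtain c b where cb: "c \<in> op_poly G f B i" "b \<in> B" "n = c \<otimes> (f ^^ i) b" by auto
      define j where "j = min i m"
      have "b \<in> ?L i" using n cb by (auto simp: lead_coeffs_def)
      then have "b \<in> ?L j" using Lm by (auto simp: j_def min_def)
      \<comment> \<open>The leading coefficients of \<open>S\<close> form an operator subgroup
        themselves, so it is enough that they contain the generators \<open>Es j\<close>; no
        explicit combination of the lifts is written down.\<close>
      moreover have "?L j \<subseteq> lead_coeffs G f B S j"
        unfolding Es(2)[of j]
      proof (rule op_span_least[OF lead_coeffs_op_subgroup[OF S]])
        have "lc j b \<otimes> (f ^^ j) b \<in> S" if "b \<in> Es j" for b
        proof -
          have "lc j b \<otimes> (f ^^ j) b \<in> F" using that unfolding F_def j_def by (intro UN_I[of j]) (auto simp: j_def)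
          then show ?thesis using op_span_incl[of F G "insert f \<Omega>"] unfolding S_def by blast
        qed
        then show "Es j \<subseteq> lead_coeffs G f B S j"
          using EsL[of j] LB[of j] lc(1)[of _ j] unfolding lead_coeffs_def by blast
      qed
      ultimately obtain c' where c': "c' \<in> op_poly G f B j" "c' \<otimes> (f ^^ j) b \<in> S"
        by (auto simp: lead_coeffs_def)
      \<comment> \<open>For \<open>i > m\<close> the coefficient is already realised in degree
        \<open>m\<close>; applying \<open>f\<close> another \<open>i - m\<close> times moves it up
        to degree \<open>i\<close>.\<close>
      define k where "k = i - j"
      have ij: "k + j = i" by (auto simp: k_def j_def)
      interpret p: group_hom G G "f ^^ k" by (rule pow_hom)
      have carr: "c \<in> carrier G" "c' \<in> carrier G" "b \<in> carrier G"
        using cb c' op_poly_closed(1) B_closed(1) by auto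
      have "(f ^^ k) (c' \<otimes> (f ^^ j) b) = (f ^^ k) c' \<otimes> (f ^^ i) b"
        using carr pow_closed by (simp add: ij[symmetric] funpow_add)
      then have s: "(f ^^ k) c' \<otimes> (f ^^ i) b \<in> S" using fS[OF c'(2), of k] by simp
      have C: "(f ^^ k) c' \<in> op_poly G f B i" using op_poly_shift_pow[OF c'(1), of k] ij by simp
      \<comment> \<open>Subtracting an element of \<open>S\<close> with the same leading coefficient
        leaves an element of \<open>N\<close> of degree less than \<open>i\<close>, to which the
        induction hypothesis applies.\<close>
      have eq: "n = (c \<otimes> inv ((f ^^ k) c')) \<otimes> ((f ^^ k) c' \<otimes> (f ^^ i) b)"
        using carr pow_closed cb(3) by (simp add: m_assoc[symmetric]) (simp add: m_assoc)
      then have "c \<otimes> inv ((f ^^ k) c') = n \<otimes> inv ((f ^^ k) c' \<otimes> (f ^^ i) b)"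
        using carr pow_closed by (simp add: m_assoc)
      then have "c \<otimes> inv ((f ^^ k) c') \<in> N"
        using n s SN subgroup.m_closed[OF Ns] subgroup.m_inv_closed[OF Ns] by auto
      then have "c \<otimes> inv ((f ^^ k) c') \<in> S"
        using Suc.IH op_poly_closed(3)[OF cb(1) op_poly_closed(4)[OF C]] by blast
      then show "n \<in> S" using eq s subgroup.m_closed[OF Ss] by metis
    qed
  qed
  then have "N \<subseteq> S" using NB by blast
  then show "\<exists>E. finite E \<and> N = op_span G (insert f \<Omega>) E"
    using SN F(1) unfolding S_def by blast
qed

end

section \<open>Several commuting operators over a finitely generated abelian group\<close>

lemma (in comm_group) op_noetherian_ops:
  assumes "finite \<Omega>" "op_noetherian G {} B" "\<Omega> \<subseteq> hom G G"
    and "\<And>f g a. f \<in> \<Omega> \<Longrightarrow> g \<in> \<Omega> \<Longrightarrow> a \<in> carrier G \<Longrightarrow> f (g a) = g (f a)"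
  shows "\<exists>C. op_noetherian G \<Omega> C \<and> B \<subseteq> C"
  using assms(1,3,4)
proof induction
  case empty
  then show ?case using assms(2) by blast
next
  case (insert f \<Omega>)
  then obtain C where C: "op_noetherian G \<Omega> C" "B \<subseteq> C" by auto
  interpret operator_extension G \<Omega> f C
    by unfold_locales (use insert.prems C in \<open>auto simp: op_noetherian_def\<close>)
  have "op_noetherian G (insert f \<Omega>) (\<Union>i. op_poly G f C i)"
    by (rule op_noetherian_extend[OF C(1)])
  moreover have "C \<subseteq> op_poly G f C 1"
  proof
    fix b assume "b \<in> C"
    then show "b \<in> op_poly G f C 1" using B_closed(1) by (auto intro!: exI[of _ b])
  qed
  ultimately show ?case using C(2) by blast
qed

text \<open>As for subgroups of the integers: if exponents of \<open>g\<close> occur in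
  \<open>N\<close> at all, one element with the least positive exponent \<open>d\<close> and
  generators of the intersection with \<open>B\<close> suffice, by division with remainder.\<close>

lemma (in comm_group) op_noetherian_cyclic_extend:
  assumes B: "op_noetherian G {} B" and g: "g \<in> carrier G"
    and C: "subgroup C G" "C \<subseteq> {b \<otimes> g [^] (k :: int) | b k. b \<in> B}"
  shows "op_noetherian G {} C"
  unfolding op_noetherian_def
proof (intro conjI allI impI)
  show "op_subgroup G {} C" using C(1) by (simp add: op_subgroup_def)
  fix N assume N: "op_subgroup G {} N" and NC: "N \<subseteq> C"
  have Bs: "subgroup B G" and Ns: "subgroup N G" using B N by (auto simp: op_noetherian_def op_subgroup_def)
  note Bc = subgroup.mem_carrier[OF Bs] subgroup.one_closed[OF Bs] subgroup.m_closed[OF Bs] subgroup.m_inv_closed[OF Bs]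
  note Nc = subgroup.mem_carrier[OF Ns] subgroup.one_closed[OF Ns] subgroup.m_closed[OF Ns] subgroup.m_inv_closed[OF Ns]
  have "op_subgroup G {} (N \<inter> B)" using Ns Bs by (simp add: op_subgroup_def subgroups_Inter_pair)
  then obtain E where E: "finite E" "N \<inter> B = op_span G {} E"
    using B unfolding op_noetherian_def by (meson inf_le2)
  have EN: "E \<subseteq> N" using E(2) op_span_incl[of E G "{}"] by blast
  \<comment> \<open>The positive exponents of \<open>g\<close> modulo \<open>B\<close> that occur in
    \<open>N\<close>; a negative exponent yields a positive one by inversion.\<close>
  define K where "K = {k :: nat. k > 0 \<and> (\<exists>b\<in>B. b \<otimes> g [^] (int k) \<in> N)}"
  have Kabs: "nat \<bar>k\<bar> \<in> K" if k: "k \<noteq> 0" and b: "b \<in> B" "b \<otimes> g [^] k \<in> N" for b and k :: int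
  proof (cases "k > 0")
    case True
    then show ?thesis using b by (auto simp: K_def)
  next
    case False
    have "inv (b \<otimes> g [^] k) = inv b \<otimes> g [^] (- k)" using b Bc g by (simp add: inv_mult int_pow_neg)
    then have "inv b \<otimes> g [^] (- k) \<in> N" using Nc(4)[OF b(2)] by simp
    then show ?thesis using False k Bc(4)[OF b(1)] by (auto simp: K_def intro!: bexI[of _ "inv b"])
  qed
  show "\<exists>E. finite E \<and> N = op_span G {} E"
  proof (cases "K = {}")
    case True
    have "N \<subseteq> B"
    proof
      fix n assume n: "n \<in> N"
      then obtain b and k :: int where bk: "b \<in> B" "n = b \<otimes> g [^] k" using NC C(2) by blast
      then have "k = 0" using Kabs[of k b] True n by auto
      then show "n \<in> B" using bk Bc by simp
    qed
    then show ?thesis using E by (metis inf.absorb1)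
  next
    case False
    define d where "d = (LEAST k. k \<in> K)"
    have dK: "d \<in> K" unfolding d_def using False by (auto intro: LeastI)
    have least: "d \<le> k" if "k \<in> K" for k unfolding d_def using that by (rule Least_le)
    obtain c where c: "c \<in> B" "c \<otimes> g [^] int d \<in> N" and d: "d > 0" using dK by (auto simp: K_def)
    let ?F = "insert (c \<otimes> g [^] int d) E"
    have F: "finite ?F" "?F \<subseteq> N" using E(1) EN c by auto
    have S: "op_subgroup G {} (op_span G {} ?F)" by (rule op_subgroup_op_span[OF N F(2)])
    then have Ss: "subgroup (op_span G {} ?F) G" by (simp add: op_subgroup_def)
    have ES: "op_span G {} E \<subseteq> op_span G {} ?F"
      by (rule op_span_least[OF S]) (use op_span_incl[of ?F G "{}"] in blast)
    have "N \<subseteq> op_span G {} ?F"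
    proof
      fix n assume n: "n \<in> N"
      then obtain b and k :: int where bk: "b \<in> B" "n = b \<otimes> g [^] k" using NC C(2) by blast
      define q where "q = k div int d"
      define x where "x = (c \<otimes> g [^] int d) [^] q"
      have xS: "x \<in> op_span G {} ?F" unfolding x_def
        by (rule subgroup_int_pow_closed[OF Ss]) (use op_span_incl[of ?F G "{}"] in blast)
      have xN: "x \<in> N" unfolding x_def by (rule subgroup_int_pow_closed[OF Ns c(2)])
      have cc: "c \<in> carrier G" "b \<in> carrier G" using c bk Bc by auto
      have x: "x = c [^] q \<otimes> g [^] (int d * q)" unfolding x_def
        using cc g by (simp add: int_pow_distrib int_pow_pow)
      have k: "k - int d * q = k mod int d" by (simp add: q_def minus_mult_div_eq_mod)
      have "n \<otimes> inv x = (b \<otimes> inv (c [^] q)) \<otimes> (g [^] k \<otimes> inv (g [^] (int d * q)))"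
        using cc g bk by (simp add: x inv_mult m_ac)
      also have "\<dots> = (b \<otimes> inv (c [^] q)) \<otimes> g [^] (k mod int d)"
        using g by (simp add: int_pow_diff[symmetric] k)
      finally have nx: "n \<otimes> inv x = (b \<otimes> inv (c [^] q)) \<otimes> g [^] (k mod int d)" .
      have bc: "b \<otimes> inv (c [^] q) \<in> B"
        using bk c subgroup_int_pow_closed[OF Bs c(1)] Bc by simp
      have nxN: "n \<otimes> inv x \<in> N" using n xN Nc by simp
      \<comment> \<open>Otherwise the remainder would be an exponent occurring in \<open>N\<close>
        below the least one.\<close>
      have "k mod int d = 0"
      proof (rule ccontr)
        assume "k mod int d \<noteq> 0"
        then have "nat \<bar>k mod int d\<bar> \<in> K" using Kabs bc nxN nx by metis
        then have "d \<le> nat \<bar>k mod int d\<bar>" by (rule least)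
        then show False using d pos_mod_bound[of "int d" k] pos_mod_sign[of "int d" k] by linarith
      qed
      then have "n \<otimes> inv x \<in> B" using nx bc Bc(1) by simp
      then have "n \<otimes> inv x \<in> op_span G {} ?F" using nxN E(2) ES by blast
      then have "(n \<otimes> inv x) \<otimes> x \<in> op_span G {} ?F" using xS subgroup.m_closed[OF Ss] by blast
      then show "n \<in> op_span G {} ?F" using Nc(1)[OF n] Nc(1)[OF xN] by (simp add: m_assoc)
    qed
    then show ?thesis using op_span_least[OF N F(2)] F(1) by blast
  qed
qed

lemma (in comm_group) op_noetherian_generate:
  assumes "finite S" "S \<subseteq> carrier G"
  shows "op_noetherian G {} (generate G S)"
  using assms
proof induction
  case empty
  have "N = op_span G {} {}" if "op_subgroup G {} N" "N \<subseteq> {\<one>}" for N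
  proof -
    have "\<one> \<in> N" using that(1) subgroup.one_closed by (auto simp: op_subgroup_def)
    then have "N = {\<one>}" using that(2) by blast
    moreover have "\<one> \<in> op_span G {} {}"
      by (auto simp: op_span_def op_subgroup_def subgroup.one_closed)
    moreover have "op_span G {} {} \<subseteq> {\<one>}"
      by (rule op_span_least) (simp_all add: op_subgroup_def triv_subgroup)
    ultimately show ?thesis by blast
  qed
  then show ?case
    unfolding op_noetherian_def generate_empty using finite.emptyI
    by (auto simp: op_subgroup_def triv_subgroup)
next
  case (insert g S)
  then have g: "g \<in> carrier G" and S: "S \<subseteq> carrier G" by auto
  let ?B = "generate G S"
  have Bs: "subgroup ?B G" by (rule generate_is_subgroup[OF S])
  note Bc = subgroup.mem_carrier[OF Bs] subgroup.one_closed[OF Bs] subgroup.m_closed[OF Bs] subgroup.m_inv_closed[OF Bs]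
  let ?C = "{b \<otimes> g [^] (k :: int) | b k. b \<in> ?B}"
  have CI: "b \<otimes> g [^] k \<in> ?C" if "b \<in> ?B" for b and k :: int using that by blast
  have Cs: "subgroup ?C G"
  proof (rule subgroupI)
    show "?C \<subseteq> carrier G" using Bc g by auto
    show "?C \<noteq> {}" using Bc(2) by blast
    show "inv a \<in> ?C" if a: "a \<in> ?C" for a
    proof -
      obtain b and k :: int where bk: "b \<in> ?B" "a = b \<otimes> g [^] k" using a by blast
      then have "inv a = inv b \<otimes> g [^] (- k)" using Bc g by (simp add: inv_mult int_pow_neg)
      then show ?thesis using CI[OF Bc(4)[OF bk(1)]] by simp
    qed
    show "a \<otimes> a' \<in> ?C" if a: "a \<in> ?C" and a': "a' \<in> ?C" for a a'
    proof -
      obtain b and k :: int where bk: "b \<in> ?B" "a = b \<otimes> g [^] k" using a by blast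
      obtain b' and k' :: int where bk': "b' \<in> ?B" "a' = b' \<otimes> g [^] k'" using a' by blast
      have "a \<otimes> a' = (b \<otimes> b') \<otimes> g [^] (k + k')"
        using bk bk' Bc(1) g by (simp add: int_pow_mult m_ac)
      then show ?thesis using CI[OF Bc(3)[OF bk(1) bk'(1)]] by simp
    qed
  qed
  have "insert g S \<subseteq> ?C"
  proof -
    have "g \<in> ?C" using CI[OF Bc(2), of 1] g by simp
    moreover have "s \<in> ?C" if "s \<in> S" for s
      using CI[OF generate.incl[OF that], of 0] that S by (simp add: subsetD)
    ultimately show ?thesis by blast
  qed
  then have "generate G (insert g S) \<subseteq> ?C" by (rule generate_subgroup_incl[OF _ Cs])
  moreover have "subgroup (generate G (insert g S)) G" by (rule generate_is_subgroup) (use g S in simp)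
  ultimately show ?case using op_noetherian_cyclic_extend[OF insert.IH[OF S] g] by blast
qed

section \<open>Commutators and Hall's theorem on normal subgroups\<close>

definition commutator :: "('a, 'b) monoid_scheme \<Rightarrow> 'a \<Rightarrow> 'a \<Rightarrow> 'a"
  where "commutator G a b = a \<otimes>\<^bsub>G\<^esub> b \<otimes>\<^bsub>G\<^esub> inv\<^bsub>G\<^esub> a \<otimes>\<^bsub>G\<^esub> inv\<^bsub>G\<^esub> b"

definition metabelian :: "('a, 'b) monoid_scheme \<Rightarrow> bool"
  where "metabelian G \<longleftrightarrow> (\<forall>a\<in>carrier G. \<forall>b\<in>carrier G. \<forall>c\<in>carrier G. \<forall>d\<in>carrier G.
    commutator G (commutator G a b) (commutator G c d) = \<one>\<^bsub>G\<^esub>)"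

lemma (in group_hom) hom_commutator:
  "a \<in> carrier G \<Longrightarrow> b \<in> carrier G \<Longrightarrow> h (commutator G a b) = commutator H (h a) (h b)"
  by (simp add: commutator_def)

lemma (in group) commutator_closed [simp]:
  "a \<in> carrier G \<Longrightarrow> b \<in> carrier G \<Longrightarrow> commutator G a b \<in> carrier G"
  by (simp add: commutator_def)

lemma (in group) commutator_eq_one_iff:
  assumes "a \<in> carrier G" "b \<in> carrier G"
  shows "commutator G a b = \<one> \<longleftrightarrow> a \<otimes> b = b \<otimes> a"
proof -
  have "commutator G a b = (a \<otimes> b) \<otimes> inv (b \<otimes> a)"
    using assms by (simp add: commutator_def inv_mult_group m_assoc)
  then show ?thesis using assms by (metis inv_closed inv_equality inv_inv m_closed r_inv)
qed

text \<open>Two passes through centralizers: that of \<open>T\<close> is a subgroup containing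
  \<open>S\<close>, hence \<open>generate G S\<close>; then that of \<open>generate G S\<close>
  contains \<open>T\<close>.\<close>

lemma (in group) generate_commute:
  assumes S: "S \<subseteq> carrier G" and comm: "\<And>s t. s \<in> S \<Longrightarrow> t \<in> T \<Longrightarrow> s \<otimes> t = t \<otimes> s"
    and T: "T \<subseteq> carrier G" and a: "a \<in> generate G S" and b: "b \<in> generate G T"
  shows "a \<otimes> b = b \<otimes> a"
proof -
  have cent: "subgroup {g \<in> carrier G. \<forall>x\<in>X. g \<otimes> x = x \<otimes> g} G" if X: "X \<subseteq> carrier G" for X
  proof (rule subgroupI)
    show "inv g \<in> {g \<in> carrier G. \<forall>x\<in>X. g \<otimes> x = x \<otimes> g}" if g: "g \<in> {g \<in> carrier G. \<forall>x\<in>X. g \<otimes> x = x \<otimes> g}" for g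
    proof -
      have "inv g \<otimes> x = x \<otimes> inv g" if "x \<in> X" for x
      proof -
        have "x \<in> carrier G" "g \<in> carrier G" "g \<otimes> x = x \<otimes> g" using that X g by auto
        then show ?thesis by (metis inv_closed inv_solve_left inv_solve_right' m_assoc m_closed)
      qed
      then show ?thesis using g by auto
    qed
    show "g \<otimes> h \<in> {g \<in> carrier G. \<forall>x\<in>X. g \<otimes> x = x \<otimes> g}"
      if g: "g \<in> {g \<in> carrier G. \<forall>x\<in>X. g \<otimes> x = x \<otimes> g}" and h: "h \<in> {g \<in> carrier G. \<forall>x\<in>X. g \<otimes> x = x \<otimes> g}" for g h
    proof -
      have "g \<otimes> h \<otimes> x = x \<otimes> (g \<otimes> h)" if "x \<in> X" for x
      proof -
        have "x \<in> carrier G" "g \<in> carrier G" "g \<otimes> x = x \<otimes> g" "h \<in> carrier G" "h \<otimes> x = x \<otimes> h"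
          using that X g h by auto
        then show ?thesis by (metis m_assoc)
      qed
      then show ?thesis using g h by auto
    qed
  qed (use X in \<open>auto intro!: exI[of _ "\<one>"]\<close>)
  have "generate G S \<subseteq> {g \<in> carrier G. \<forall>x\<in>T. g \<otimes> x = x \<otimes> g}"
    by (rule generate_subgroup_incl[OF _ cent[OF T]]) (use S comm in auto)
  moreover have "generate G T \<subseteq> {g \<in> carrier G. \<forall>x\<in>generate G S. g \<otimes> x = x \<otimes> g}"
    by (rule generate_subgroup_incl[OF _ cent[OF generate_incl[OF S]]]) (use T calculation in auto)
  ultimately show ?thesis using a b by auto
qed

text \<open>Both conjugations are assumed because conjugation by \<open>s\<close> alone could map
  \<open>T\<close> onto a proper subgroup of itself.\<close>

lemma (in group) normal_by_generators:
  assumes S: "S \<subseteq> carrier G" "generate G S = carrier G" and T: "subgroup T G"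
    and conj: "\<And>s t. s \<in> S \<Longrightarrow> t \<in> T \<Longrightarrow> s \<otimes> t \<otimes> inv s \<in> T"
      "\<And>s t. s \<in> S \<Longrightarrow> t \<in> T \<Longrightarrow> inv s \<otimes> t \<otimes> s \<in> T"
  shows "T \<lhd> G"
proof -
  have "\<forall>t\<in>T. g \<otimes> t \<otimes> inv g \<in> T" if "g \<in> generate G S" for g
    using that
  proof induction
    case one
    then show ?case using subgroup.mem_carrier[OF T] by simp
  next
    case (incl h)
    then show ?case using conj(1) by blast
  next
    case (inv h)
    then show ?case using conj(2) S by (simp add: subsetD)
  next
    case (eng g h)
    then have gh: "g \<in> carrier G" "h \<in> carrier G" using S by auto
    have "g \<otimes> h \<otimes> t \<otimes> inv (g \<otimes> h) = g \<otimes> (h \<otimes> t \<otimes> inv h) \<otimes> inv g" if "t \<in> T" for t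
      using gh subgroup.mem_carrier[OF T that] by (simp add: inv_mult_group m_assoc)
    then show ?case using eng by simp
  qed
  then show ?thesis using T S by (simp add: normal_inv_iff)
qed

text \<open>Modulo \<open>T\<close> the generators commute, so the quotient is abelian.\<close>

lemma (in group) commutators_in_normal:
  assumes S: "S \<subseteq> carrier G" "generate G S = carrier G" and T: "T \<lhd> G"
    and comm: "\<And>s t. s \<in> S \<Longrightarrow> t \<in> S \<Longrightarrow> commutator G s t \<in> T"
    and ab: "a \<in> carrier G" "b \<in> carrier G"
  shows "commutator G a b \<in> T"
proof -
  interpret T: normal T G by fact
  interpret q: group_hom G "G Mod T" "\<lambda>g. T #> g" by (rule FactGroup_hom_rcos[OF T])
  have iff: "commutator G a b \<in> T \<longleftrightarrow> (T #> a) \<otimes>\<^bsub>G Mod T\<^esub> (T #> b) = (T #> b) \<otimes>\<^bsub>G Mod T\<^esub> (T #> a)"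
    if "a \<in> carrier G" "b \<in> carrier G" for a b
    using q.hom_commutator[OF that] rcos_eq_self_iff[OF T commutator_closed[OF that]]
      q.H.commutator_eq_one_iff[OF q.hom_closed[OF that(1)] q.hom_closed[OF that(2)]]
    by simp
  have gen: "generate (G Mod T) ((\<lambda>g. T #> g) ` S) = carrier (G Mod T)"
    using q.generate_img[OF S(1)] S(2) by (simp add: carrier_FactGroup)
  have "(T #> a) \<otimes>\<^bsub>G Mod T\<^esub> (T #> b) = (T #> b) \<otimes>\<^bsub>G Mod T\<^esub> (T #> a)"
  proof (rule q.H.generate_commute)
    show "T #> a \<in> generate (G Mod T) ((\<lambda>g. T #> g) ` S)" "T #> b \<in> generate (G Mod T) ((\<lambda>g. T #> g) ` S)"
      unfolding gen using ab by (auto simp: carrier_FactGroup)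
    show "(\<lambda>g. T #> g) ` S \<subseteq> carrier (G Mod T)" "(\<lambda>g. T #> g) ` S \<subseteq> carrier (G Mod T)"
      using S(1) by (auto simp: carrier_FactGroup)
    show "x \<otimes>\<^bsub>G Mod T\<^esub> y = y \<otimes>\<^bsub>G Mod T\<^esub> x" if xy: "x \<in> (\<lambda>g. T #> g) ` S" "y \<in> (\<lambda>g. T #> g) ` S" for x y
    proof -
      obtain s t where st: "s \<in> S" "t \<in> S" "x = T #> s" "y = T #> t" using xy by blast
      show ?thesis unfolding st(3,4) using iff[of s t] comm[OF st(1,2)] S(1) st(1,2) by blast
    qed
  qed
  then show ?thesis using iff[OF ab] by simp
qed

lemma derived_eq_commutators:
  "derived G (carrier G) = generate G {commutator G a b | a b. a \<in> carrier G \<and> b \<in> carrier G}"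
proof -
  have "derived_set G (carrier G) = {commutator G a b | a b. a \<in> carrier G \<and> b \<in> carrier G}"
    by (auto simp: commutator_def)
  then show ?thesis by (simp add: derived_def)
qed

text \<open>The derived subgroup \<open>D\<close> is abelian, hence a module over the group ring of
  \<open>G/D\<close>, and noetherian by Hilbert's theorem; \<open>G/D\<close> is a finitely
  generated abelian group. Generators of the intersection of \<open>N\<close> with \<open>D\<close>
  and lifts of generators of the image of \<open>N\<close> in \<open>G/D\<close> together generate
  \<open>N\<close> as a normal subgroup.\<close>

theorem metabelian_max_normal:
  fixes G (structure)
  assumes fg: "finitely_generated G" and met: "metabelian G" and N: "N \<lhd> G"
  shows "\<exists>E. finite E \<and> E \<subseteq> N \<and> N = normal_closure G E"
proof -
  interpret group G using fg by (simp add: finitely_generated_def)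
  obtain S where S: "finite S" "S \<subseteq> carrier G" "generate G S = carrier G"
    using fg by (auto simp: finitely_generated_def)
  interpret N: normal N G by fact
  define K where "K = {commutator G a b | a b. a \<in> carrier G \<and> b \<in> carrier G}"
  have KG: "K \<subseteq> carrier G" by (auto simp: K_def)
  define D where "D = derived G (carrier G)"
  have DK: "D = generate G K" by (simp add: D_def K_def derived_eq_commutators)
  have D: "D \<lhd> G" unfolding D_def by (rule derived_is_normal) (simp add: normal_inv_iff subgroup_self)
  interpret D: normal D G by (rule D)
  have Dcomm: "a \<otimes> b = b \<otimes> a" if "a \<in> D" "b \<in> D" for a b
  proof (rule generate_commute[OF KG _ KG])
    show "x \<otimes> y = y \<otimes> x" if xy: "x \<in> K" "y \<in> K" for x y
    proof -
      have "commutator G x y = \<one>" using xy met unfolding K_def metabelian_def by blast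
      then show ?thesis using commutator_eq_one_iff xy KG by blast
    qed
  qed (use that DK in auto)
  define A where "A = G\<lparr>carrier := D\<rparr>"
  have A_simps: "carrier A = D" "x \<otimes>\<^bsub>A\<^esub> y = x \<otimes> y" "\<one>\<^bsub>A\<^esub> = \<one>" for x y by (simp_all add: A_def)
  interpret A: comm_group A
    unfolding A_def using D.subgroup_is_group[OF is_group] Dcomm
    by (auto intro: group.group_comm_groupI)
  have A_inv: "inv\<^bsub>A\<^esub> x = inv x" if "x \<in> D" for x
    unfolding A_def by (rule m_inv_consistent[OF D.subgroup_axioms that])
  have sub_A: "subgroup T A \<longleftrightarrow> subgroup T G \<and> T \<subseteq> D" for T
  proof
    assume "subgroup T A"
    then show "subgroup T G \<and> T \<subseteq> D"
      unfolding A_def using incl_subgroup[OF D.subgroup_axioms] subgroup.subset by fastforce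
  next
    assume "subgroup T G \<and> T \<subseteq> D"
    then show "subgroup T A" unfolding A_def using subgroup_incl D.subgroup_axioms by blast
  qed
  define cj where "cj = (\<lambda>s d. s \<otimes> d \<otimes> inv s)"
  \<comment> \<open>Inverses are included so that the operator subgroups are exactly the normal
    subgroups of \<open>G\<close> inside \<open>D\<close>.\<close>
  define \<Omega> where "\<Omega> = cj ` (S \<union> m_inv G ` S)"
  have S': "S \<union> m_inv G ` S \<subseteq> carrier G" using S by auto
  have opsub: "op_subgroup A \<Omega> T \<longleftrightarrow> T \<lhd> G \<and> T \<subseteq> D" for T
  proof
    assume T: "op_subgroup A \<Omega> T"
    then have TG: "subgroup T G" "T \<subseteq> D" using sub_A by (auto simp: op_subgroup_def)
    have "T \<lhd> G"
    proof (rule normal_by_generators[OF S(2,3) TG(1)])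
      fix s t assume st: "s \<in> S" "t \<in> T"
      have "cj s ` T \<subseteq> T" "cj (inv s) ` T \<subseteq> T" using T st(1) unfolding op_subgroup_def \<Omega>_def by blast+
      then have "cj s t \<in> T" "cj (inv s) t \<in> T" using st(2) by blast+
      then show "s \<otimes> t \<otimes> inv s \<in> T" "inv s \<otimes> t \<otimes> s \<in> T"
        using st S(2) by (auto simp: cj_def subsetD)
    qed
    then show "T \<lhd> G \<and> T \<subseteq> D" using TG by simp
  next
    assume T: "T \<lhd> G \<and> T \<subseteq> D"
    then have "subgroup T A" using sub_A normal_imp_subgroup by blast
    moreover have "cj s t \<in> T" if "s \<in> carrier G" "t \<in> T" for s t
      using T that normal_inv_iff unfolding cj_def by blast
    ultimately show "op_subgroup A \<Omega> T" using S' unfolding op_subgroup_def \<Omega>_def by blast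
  qed
  have noethD: "op_noetherian A \<Omega> D"
  proof -
    define K0 where "K0 = (\<lambda>(s, t). commutator G s t) ` (S \<times> S)"
    have K0: "finite K0" "K0 \<subseteq> K" using S by (auto simp: K0_def K_def)
    have KD: "K \<subseteq> D" unfolding DK by (auto intro: generate.incl)
    have "op_noetherian A {} (generate A K0)"
      by (rule A.op_noetherian_generate) (use K0 KD A_simps in auto)
    moreover have "finite \<Omega>" using S by (simp add: \<Omega>_def)
    moreover have "\<Omega> \<subseteq> hom A A"
    proof
      fix g assume "g \<in> \<Omega>"
      then obtain s where s: "s \<in> carrier G" "g = cj s" using S' by (auto simp: \<Omega>_def)
      have "s \<otimes> (x \<otimes> y) \<otimes> inv s = (s \<otimes> x \<otimes> inv s) \<otimes> (s \<otimes> y \<otimes> inv s)"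
        if "x \<in> carrier G" "y \<in> carrier G" for x y
      proof -
        have "(s \<otimes> x \<otimes> inv s) \<otimes> (s \<otimes> y \<otimes> inv s) = s \<otimes> x \<otimes> (inv s \<otimes> s) \<otimes> y \<otimes> inv s"
          using s that by (simp only: m_assoc m_closed inv_closed)
        then show ?thesis using s that by (simp add: m_assoc)
      qed
      then show "g \<in> hom A A"
        using s D.inv_op_closed2 D.mem_carrier by (auto simp: hom_def A_simps cj_def)
    qed
    \<comment> \<open>Conjugations by \<open>s\<close> and \<open>t\<close> commute on
      \<open>D\<close>: \<open>st\<close> and \<open>ts\<close> differ by a commutator, which lies
      in the abelian group \<open>D\<close> and so centralizes it.\<close>
    moreover have "g (h a) = h (g a)" if gh: "g \<in> \<Omega>" "h \<in> \<Omega>" and a: "a \<in> carrier A" for g h a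
    proof -
      obtain s t where st: "s \<in> carrier G" "g = cj s" "t \<in> carrier G" "h = cj t"
        using gh S' unfolding \<Omega>_def by blast
      have aD: "a \<in> D" "a \<in> carrier G" using a D.mem_carrier by (auto simp: A_simps)
      have "commutator G (inv s) (inv t) \<in> K" using st by (auto simp: K_def)
      then have c: "commutator G (inv s) (inv t) \<in> D" using KD by blast
      then have "s \<otimes> t = t \<otimes> s \<otimes> commutator G (inv s) (inv t)"
        using st by (simp add: commutator_def m_assoc) (simp flip: m_assoc)
      then have "cj s (cj t a) = (t \<otimes> s) \<otimes> (commutator G (inv s) (inv t) \<otimes> a \<otimes> inv (commutator G (inv s) (inv t))) \<otimes> inv (t \<otimes> s)"
      proof -
        have "cj s (cj t a) = (s \<otimes> t) \<otimes> a \<otimes> inv (s \<otimes> t)"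
          using st aD by (simp add: cj_def inv_mult_group m_assoc)
        then show ?thesis
          using \<open>s \<otimes> t = t \<otimes> s \<otimes> commutator G (inv s) (inv t)\<close> st aD
          by (simp add: inv_mult_group m_assoc)
      qed
      also have "commutator G (inv s) (inv t) \<otimes> a \<otimes> inv (commutator G (inv s) (inv t)) = a"
        using Dcomm[OF c aD(1)] aD D.mem_carrier[OF c] by (simp add: m_assoc)
      also have "(t \<otimes> s) \<otimes> a \<otimes> inv (t \<otimes> s) = cj t (cj s a)"
        using st aD by (simp add: cj_def inv_mult_group m_assoc)
      finally show ?thesis by (simp add: st)
    qed
    ultimately obtain C where C: "op_noetherian A \<Omega> C" "generate A K0 \<subseteq> C"
      using A.op_noetherian_ops by blast
    have Cn: "C \<lhd> G" "C \<subseteq> D" using C(1) opsub by (auto simp: op_noetherian_def)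
    \<comment> \<open>\<open>C\<close> is normal in \<open>G\<close> and contains the commutators of
      the generators, so \<open>G/C\<close> is abelian and \<open>C\<close> is all of
      \<open>D\<close>.\<close>
    have "commutator G a b \<in> C" if "a \<in> carrier G" "b \<in> carrier G" for a b
    proof (rule commutators_in_normal[OF S(2,3) Cn(1) _ that])
      fix s t assume "s \<in> S" "t \<in> S"
      then have "commutator G s t \<in> K0" unfolding K0_def by force
      then show "commutator G s t \<in> C" using C(2) generate.incl[of _ K0 A] by blast
    qed
    then have "K \<subseteq> C" by (auto simp: K_def)
    then have "D \<subseteq> C" unfolding DK by (rule generate_subgroup_incl[OF _ normal_imp_subgroup[OF Cn(1)]])
    then show ?thesis using C(1) Cn(2) by (metis subset_antisym)
  qed
  have "N \<inter> D \<lhd> G" by (rule normal_subgroup_intersect[OF N D])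
  then have "op_subgroup A \<Omega> (N \<inter> D)" using opsub by blast
  then obtain E1 where E1: "finite E1" "N \<inter> D = op_span A \<Omega> E1"
    using noethD unfolding op_noetherian_def by (meson inf_le2)
  interpret Q: comm_group "G Mod D" unfolding D_def by (rule derived_quot_is_comm_group)
  interpret q: group_hom G "G Mod D" "\<lambda>g. D #> g" by (rule FactGroup_hom_rcos[OF D])
  have Qgen: "generate (G Mod D) ((\<lambda>g. D #> g) ` S) = carrier (G Mod D)"
    using q.generate_img[OF S(2)] S(3) by (simp add: carrier_FactGroup)
  have "op_noetherian (G Mod D) {} (carrier (G Mod D))"
    unfolding Qgen[symmetric] by (rule Q.op_noetherian_generate) (use S in \<open>auto simp: carrier_FactGroup\<close>)
  moreover have "op_subgroup (G Mod D) {} ((\<lambda>g. D #> g) ` N)"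
    using q.subgroup_img_is_subgroup[OF N.subgroup_axioms] by (simp add: op_subgroup_def)
  moreover have "(\<lambda>g. D #> g) ` N \<subseteq> carrier (G Mod D)" by (auto simp: carrier_FactGroup)
  ultimately obtain E2 where E2: "finite E2" "(\<lambda>g. D #> g) ` N = op_span (G Mod D) {} E2"
    unfolding op_noetherian_def by blast
  then have "E2 \<subseteq> (\<lambda>g. D #> g) ` N"
    using op_span_incl[of E2 "G Mod D" "{}"] by simp
  then obtain E3 where E3: "finite E3" "E3 \<subseteq> N" "(\<lambda>g. D #> g) ` E3 = E2"
    using finite_subset_image[OF E2(1), of "\<lambda>g. D #> g" N] by metis
  define M where "M = normal_closure G (E1 \<union> E3)"
  have E1N: "E1 \<subseteq> N \<inter> D" using E1(2) op_span_incl[of E1 A \<Omega>] by simp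
  then have E: "E1 \<union> E3 \<subseteq> N" using E3 by blast
  have M: "M \<lhd> G" unfolding M_def by (rule normal_normal_closure[OF is_group]) (use E N.subset in blast)
  have ME: "E1 \<union> E3 \<subseteq> M" unfolding M_def by (rule normal_closure_incl)
  have "N \<inter> D \<subseteq> M \<inter> D"
    unfolding E1(2)
    by (rule op_span_least) (use opsub normal_subgroup_intersect[OF M D] ME E1N in auto)
  moreover have "(\<lambda>g. D #> g) ` N \<subseteq> (\<lambda>g. D #> g) ` M"
    unfolding E2(2)
    by (rule op_span_least)
       (use q.subgroup_img_is_subgroup[OF normal_imp_subgroup[OF M]] E3(3) ME in \<open>auto simp: op_subgroup_def\<close>)
  ultimately have "N \<subseteq> M"
  proof (intro subsetI)
    \<comment> \<open>Some \<open>m\<close> in \<open>M\<close> agrees with \<open>n\<close> modulo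
      \<open>D\<close>; then \<open>n m^-1\<close> lies in the intersection of \<open>N\<close> with
      \<open>D\<close>, which \<open>M\<close> contains.\<close>
    fix n assume n: "n \<in> N"
    have MN: "M \<subseteq> N" unfolding M_def by (rule normal_closure_least[OF N E])
    obtain m where m: "m \<in> M" "D #> n = D #> m"
      using n \<open>(\<lambda>g. D #> g) ` N \<subseteq> (\<lambda>g. D #> g) ` M\<close> by blast
    have c: "n \<in> carrier G" "m \<in> carrier G" using n m MN N.subset by auto
    have "n \<otimes> inv m \<in> D" using rcos_eq_iff[OF D c] m(2) by simp
    moreover have "n \<otimes> inv m \<in> N"
      using n m MN subgroup.m_closed[OF N.subgroup_axioms] subgroup.m_inv_closed[OF N.subgroup_axioms] by blast
    ultimately have "n \<otimes> inv m \<in> M" using \<open>N \<inter> D \<subseteq> M \<inter> D\<close> by blast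
    then have "n \<otimes> inv m \<otimes> m \<in> M" using m subgroup.m_closed[OF normal_imp_subgroup[OF M]] by blast
    then show "n \<in> M" using c by (simp add: m_assoc)
  qed
  moreover have "M \<subseteq> N" unfolding M_def by (rule normal_closure_least[OF N E])
  ultimately show ?thesis using E E1 E3 unfolding M_def by (intro exI[of _ "E1 \<union> E3"]) auto
qed

section \<open>Countability of the isomorphism classes of finitely generated metabelian
  groups\<close>

definition metabelian_relators :: "('a, 'b) monoid_scheme \<Rightarrow> 'a set"
  where "metabelian_relators G = {commutator G (commutator G a b) (commutator G c d) | a b c d.
    a \<in> carrier G \<and> b \<in> carrier G \<and> c \<in> carrier G \<and> d \<in> carrier G}"

lemma metabelian_FactGroup:
  assumes G: "group G" and N: "N \<lhd> G" "metabelian_relators G \<subseteq> N"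
  shows "metabelian (G Mod N)"
  unfolding metabelian_def
proof (intro ballI)
  interpret q: group_hom G "G Mod N" "\<lambda>g. N #>\<^bsub>G\<^esub> g" by (rule FactGroup_hom_rcos[OF N(1)])
  fix A B C D assume "A \<in> carrier (G Mod N)" "B \<in> carrier (G Mod N)" "C \<in> carrier (G Mod N)" "D \<in> carrier (G Mod N)"
  then obtain a b c d where abcd: "a \<in> carrier G" "b \<in> carrier G" "c \<in> carrier G" "d \<in> carrier G"
    and eq: "A = N #>\<^bsub>G\<^esub> a" "B = N #>\<^bsub>G\<^esub> b" "C = N #>\<^bsub>G\<^esub> c" "D = N #>\<^bsub>G\<^esub> d"
    unfolding carrier_FactGroup by blast
  let ?x = "commutator G (commutator G a b) (commutator G c d)"
  have "commutator (G Mod N) (commutator (G Mod N) A B) (commutator (G Mod N) C D) = N #>\<^bsub>G\<^esub> ?x"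
    using abcd by (simp only: eq q.hom_commutator[symmetric] q.G.commutator_closed)
  also have "\<dots> = N"
  proof -
    have "?x \<in> N" using N(2) abcd unfolding metabelian_relators_def by blast
    then show ?thesis using rcos_eq_self_iff[OF N(1)] abcd by simp
  qed
  finally show "commutator (G Mod N) (commutator (G Mod N) A B) (commutator (G Mod N) C D) = \<one>\<^bsub>G Mod N\<^esub>"
    by simp
qed

text \<open>Together with the preceding lemma: the normal closure of the relators is the kernel onto
  the largest metabelian quotient, which for a free group is the free metabelian group.\<close>

lemma metabelian_relators_kernel:
  assumes "group_hom G H h" "metabelian H"
  shows "metabelian_relators G \<subseteq> kernel G H h"
proof
  interpret group_hom G H h by fact
  fix x assume "x \<in> metabelian_relators G"
  then obtain a b c d where abcd: "a \<in> carrier G" "b \<in> carrier G" "c \<in> carrier G" "d \<in> carrier G"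
      "x = commutator G (commutator G a b) (commutator G c d)"
    unfolding metabelian_relators_def by blast
  then have "h x = commutator H (commutator H (h a) (h b)) (commutator H (h c) (h d))"
    by (simp only: hom_commutator G.commutator_closed)
  then show "x \<in> kernel G H h"
    using assms(2) abcd hom_closed unfolding metabelian_def kernel_def by simp
qed

lemma finitely_generated_free_group:
  assumes "finite X"
  shows "finitely_generated (free_group X)"
proof -
  interpret group "free_group X" by (rule group_free_group)
  let ?S = "(\<lambda>x. word_class X [(True, x)]) ` X"
  have S: "(\<lambda>x. word_class X [(True, x)]) \<in> X \<rightarrow> carrier (free_group X)"
    by (auto intro!: word_class_closed)
  have "A \<in> generate (free_group X) ?S" if A: "A \<in> carrier (free_group X)" for A
  proof -
    obtain u where "u \<in> group_words X" "A = word_class X u" using A by (auto simp: carrier_free_group)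
    then show ?thesis using word_eval_generate[OF _ S] word_class_eq_word_eval by metis
  qed
  then have "generate (free_group X) ?S = carrier (free_group X)"
    using generate_incl[of ?S] S by auto
  then show ?thesis
    unfolding finitely_generated_def using assms S is_group by (intro conjI exI[of _ ?S]) auto
qed

lemma finitely_generated_image:
  assumes "group_hom G H h" "h ` carrier G = carrier H" "finitely_generated G"
  shows "finitely_generated H"
proof -
  interpret group_hom G H h by fact
  obtain S where S: "finite S" "S \<subseteq> carrier G" "generate G S = carrier G"
    using assms(3) by (auto simp: finitely_generated_def)
  have "generate H (h ` S) = carrier H" using generate_img[OF S(2)] S(3) assms(2) by simp
  then show ?thesis unfolding finitely_generated_def using S(1,2) H.is_group by (intro conjI exI[of _ "h ` S"]) auto
qed

text \<open>The maximal condition holds in the quotient by the normal closure of \<open>D\<close>,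
  so finitely many elements besides \<open>D\<close> suffice to generate \<open>K\<close>.\<close>

lemma normal_closure_preimage:
  assumes G: "group G" and D: "D \<subseteq> carrier G" and K: "K \<lhd> G" and DK: "D \<subseteq> K"
    and fg: "finitely_generated (G Mod normal_closure G D)"
    and met: "metabelian (G Mod normal_closure G D)"
  shows "\<exists>E. finite E \<and> E \<subseteq> K \<and> K = normal_closure G (E \<union> D)"
proof -
  interpret K: normal K G by fact
  define N where "N = normal_closure G D"
  have N: "N \<lhd> G" unfolding N_def by (rule normal_normal_closure[OF G D])
  interpret q: group_hom G "G Mod N" "\<lambda>g. N #>\<^bsub>G\<^esub> g" by (rule FactGroup_hom_rcos[OF N])
  have surj: "(\<lambda>g. N #>\<^bsub>G\<^esub> g) ` carrier G = carrier (G Mod N)" by (simp add: carrier_FactGroup)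
  have img: "(\<lambda>g. N #>\<^bsub>G\<^esub> g) ` M \<lhd> G Mod N" if "M \<lhd> G" for M
    by (rule normal.surj_hom_normal_subgroup[OF that q.group_hom_axioms surj])
  obtain E' where E': "finite E'" "E' \<subseteq> (\<lambda>g. N #>\<^bsub>G\<^esub> g) ` K"
      "(\<lambda>g. N #>\<^bsub>G\<^esub> g) ` K = normal_closure (G Mod N) E'"
    using metabelian_max_normal[OF fg[folded N_def] met[folded N_def] img[OF K]] by metis
  obtain E where E: "E \<subseteq> K" "finite E" "E' = (\<lambda>g. N #>\<^bsub>G\<^esub> g) ` E"
    using finite_subset_image[OF E'(1,2)] by metis
  define M where "M = normal_closure G (E \<union> D)"
  have M: "M \<lhd> G" unfolding M_def by (rule normal_normal_closure[OF G]) (use E D K.subset in blast)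
  have MED: "E \<union> D \<subseteq> M" unfolding M_def by (rule normal_closure_incl)
  have MK: "M \<subseteq> K" unfolding M_def by (rule normal_closure_least[OF K]) (use E DK in blast)
  have NM: "N \<subseteq> M" unfolding N_def by (rule normal_closure_least[OF M]) (use MED in blast)
  have "(\<lambda>g. N #>\<^bsub>G\<^esub> g) ` K \<subseteq> (\<lambda>g. N #>\<^bsub>G\<^esub> g) ` M"
    unfolding E'(3) by (rule normal_closure_least[OF img[OF M]]) (use E(3) MED in blast)
  have "K \<subseteq> M"
  proof
    fix k assume k: "k \<in> K"
    then obtain m where m: "m \<in> M" "N #>\<^bsub>G\<^esub> k = N #>\<^bsub>G\<^esub> m"
      using \<open>(\<lambda>g. N #>\<^bsub>G\<^esub> g) ` K \<subseteq> (\<lambda>g. N #>\<^bsub>G\<^esub> g) ` M\<close> by blast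
    have c: "k \<in> carrier G" "m \<in> carrier G" using k m MK K.subset by auto
    have "k \<otimes>\<^bsub>G\<^esub> inv\<^bsub>G\<^esub> m \<in> M" using rcos_eq_iff[OF N c] m(2) NM by auto
    then have "k \<otimes>\<^bsub>G\<^esub> inv\<^bsub>G\<^esub> m \<otimes>\<^bsub>G\<^esub> m \<in> M"
      using m subgroup.m_closed[OF normal_imp_subgroup[OF M]] by blast
    then show "k \<in> M" using c by (simp add: K.m_assoc)
  qed
  then show ?thesis using MK E unfolding M_def by blast
qed

text \<open>Relative to the metabelian law, such a group is finitely presented: the kernel of a map
  from a free group needs only finitely many relators \<open>U\<close> beyond the law. Thus the
  finite data \<open>(d, U)\<close> determine the group up to isomorphism.\<close>

lemma finitely_generated_metabelian_presentation:
  assumes fg: "finitely_generated H" and met: "metabelian H"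
  shows "\<exists>(d :: nat) U. finite U \<and> U \<subseteq> group_words {..<d} \<and>
    H \<cong> free_group {..<d} Mod normal_closure (free_group {..<d})
      (word_class {..<d} ` U \<union> metabelian_relators (free_group {..<d}))"
proof -
  interpret H: group H using fg by (simp add: finitely_generated_def)
  obtain S where S: "finite S" "S \<subseteq> carrier H" "generate H S = carrier H"
    using fg by (auto simp: finitely_generated_def)
  obtain d :: nat and s where s: "S = s ` {i. i < d}"
    using S(1) by (metis finite_imp_nat_seg_image_inj_on)
  define X where "X = {..<d}"
  have s: "S = s ` X" using s by (auto simp: X_def)
  then have sX: "s \<in> X \<rightarrow> carrier H" using S by auto
  let ?F = "free_group X"
  interpret F: group ?F by (rule group_free_group)
  obtain h where h: "h \<in> hom ?F H" "\<And>u. u \<in> group_words X \<Longrightarrow> h (word_class X u) = word_eval H s u"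
    using free_group_lift[OF H.is_group sX] by blast
  interpret h: group_hom ?F H h using h(1) by (simp add: group_hom_def group_hom_axioms_def)
  have letters: "(\<lambda>x. word_class X [(True, x)]) ` X \<subseteq> carrier ?F" by (auto intro!: word_class_closed)
  have "h ` (\<lambda>x. word_class X [(True, x)]) ` X = S"
    using h(2) sX by (auto simp: s image_iff Pi_iff)
  then have surj: "h ` carrier ?F = carrier H"
    using generate_hom_surj[OF h.group_hom_axioms letters] S(3) by simp
  define D where "D = metabelian_relators ?F"
  have DF: "D \<subseteq> carrier ?F" by (auto simp: D_def metabelian_relators_def)
  have N: "normal_closure ?F D \<lhd> ?F" by (rule normal_normal_closure[OF group_free_group DF])
  have fgQ: "finitely_generated (?F Mod normal_closure ?F D)"
    by (rule finitely_generated_image[OF FactGroup_hom_rcos[OF N]])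
       (auto simp: carrier_FactGroup X_def intro: finitely_generated_free_group)
  have metQ: "metabelian (?F Mod normal_closure ?F D)"
    by (rule metabelian_FactGroup[OF group_free_group N]) (simp add: normal_closure_incl flip: D_def)
  obtain E where E: "finite E" "E \<subseteq> kernel ?F H h" "kernel ?F H h = normal_closure ?F (E \<union> D)"
    using normal_closure_preimage[OF group_free_group DF h.normal_kernel _ fgQ metQ]
      metabelian_relators_kernel[OF h.group_hom_axioms met] unfolding D_def by blast
  have "E \<subseteq> word_class X ` group_words X" using E(2) by (auto simp: kernel_def carrier_free_group)
  then obtain U where U: "U \<subseteq> group_words X" "finite U" "E = word_class X ` U"
    using finite_subset_image[OF E(1)] by metis
  have "?F Mod kernel ?F H h \<cong> H" by (rule h.FactGroup_iso[OF surj])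
  then have "H \<cong> ?F Mod kernel ?F H h"
    by (rule group.iso_sym[OF normal.factorgroup_is_group[OF h.normal_kernel]])
  then have "H \<cong> ?F Mod normal_closure ?F (word_class X ` U \<union> D)" unfolding E(3) U(3) .
  then show ?thesis using U(1,2) unfolding X_def D_def by blast
qed

text \<open>Codes \<open>(d, U)\<close> with finite \<open>U\<close> range over a countable set, and
  groups with the same code are isomorphic.\<close>

lemma countable_metabelian_classes:
  assumes \<G>: "\<And>H. H \<in> \<G> \<Longrightarrow> finitely_generated H \<and> metabelian H"
  shows "countable (\<G> // {(H, K). H \<in> \<G> \<and> K \<in> \<G> \<and> H \<cong> K})"
proof -
  let ?R = "{(H, K). H \<in> \<G> \<and> K \<in> \<G> \<and> H \<cong> K}"
  define model where "model = (\<lambda>(d :: nat, U). free_group {..<d} Mod normal_closure (free_group {..<d})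
      (word_class {..<d} ` U \<union> metabelian_relators (free_group {..<d})))"
  have "\<forall>H\<in>\<G>. \<exists>c. finite (snd c) \<and> H \<cong> model c"
    using finitely_generated_metabelian_presentation \<G> by (fastforce simp: model_def)
  then obtain code where code: "\<And>H. H \<in> \<G> \<Longrightarrow> finite (snd (code H)) \<and> H \<cong> model (code H)" by metis
  have grp: "group H" if "H \<in> \<G>" for H using \<G>[OF that] by (simp add: finitely_generated_def)
  have same: "H \<cong> K" if HK: "H \<in> \<G>" "K \<in> \<G>" "code H = code K" for H K
  proof -
    have "K \<cong> model (code H)" using code[OF HK(2)] HK(3) by simp
    then have "model (code H) \<cong> K" using grp[OF HK(2)] group.iso_sym by blast
    then show ?thesis using code[OF HK(1)] iso_trans by blast
  qed
  have Req: "?R `` {H} = ?R `` {K}" if HK: "H \<in> \<G>" "K \<in> \<G>" "code H = code K" for H K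
  proof -
    have "H \<cong> K" "K \<cong> H" using same HK by auto
    then show ?thesis using HK(1,2) by (auto intro: iso_trans)
  qed
  then have cls: "?R `` {H} = ?R `` {SOME K. K \<in> \<G> \<and> code K = code H}" if H: "H \<in> \<G>" for H
  proof -
    have "(SOME K. K \<in> \<G> \<and> code K = code H) \<in> \<G> \<and> code (SOME K. K \<in> \<G> \<and> code K = code H) = code H"
      by (rule someI[of _ H]) (use H in simp)
    then show ?thesis using Req[OF H] by simp
  qed
  have "countable {c :: nat \<times> (bool \<times> nat) list set. finite (snd c)}"
  proof -
    have "{c :: nat \<times> (bool \<times> nat) list set. finite (snd c)} = UNIV \<times> {U. finite U}" by auto
    then show ?thesis by (simp add: countable_Collect_finite)
  qed
  then have "countable (code ` \<G>)" by (rule countable_subset[rotated]) (use code in auto)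
  then have "countable ((\<lambda>c. ?R `` {SOME K. K \<in> \<G> \<and> code K = c}) ` code ` \<G>)" by (rule countable_image)
  moreover have "\<G> // ?R \<subseteq> (\<lambda>c. ?R `` {SOME K. K \<in> \<G> \<and> code K = c}) ` code ` \<G>"
    using cls by (auto simp: quotient_def)
  ultimately show ?thesis by (rule countable_subset[rotated])
qed

section \<open>The genus of a metabelian group\<close>

lemma metabelian_embedding:
  assumes "group_hom G H h" "inj_on h (carrier G)" "metabelian H"
  shows "metabelian G"
  unfolding metabelian_def
proof (intro ballI)
  interpret group_hom G H h by fact
  fix a b c d assume abcd: "a \<in> carrier G" "b \<in> carrier G" "c \<in> carrier G" "d \<in> carrier G"
  let ?x = "commutator G (commutator G a b) (commutator G c d)"
  have "?x \<in> metabelian_relators G" using abcd unfolding metabelian_relators_def by blast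
  then have "h ?x = \<one>\<^bsub>H\<^esub>" using metabelian_relators_kernel[OF assms(1,3)] by (auto simp: kernel_def)
  then show "?x = \<one>\<^bsub>G\<^esub>" using assms(2) abcd by (simp add: inj_on_one_iff)
qed

text \<open>The completion consists of families of elements of the metabelian quotients
  \<open>G/N\<close>, and the law can be checked in each component.\<close>

lemma metabelian_profinite_completion:
  assumes G: "group G" and met: "metabelian G"
  shows "metabelian (profinite_completion G)"
  unfolding metabelian_def
proof (intro ballI)
  interpret P: group "profinite_completion G" by (rule group_profinite_completion[OF G])
  fix a b c d
  assume "a \<in> carrier (profinite_completion G)" "b \<in> carrier (profinite_completion G)"
    "c \<in> carrier (profinite_completion G)" "d \<in> carrier (profinite_completion G)"
  note abcd = this
  let ?c = "commutator (profinite_completion G)"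
  let ?x = "?c (?c a b) (?c c d)"
  have x: "?x \<in> carrier (profinite_completion G)" using abcd by simp
  have "?x N = \<one>\<^bsub>profinite_completion G\<^esub> N" if N: "N \<in> finite_index_normal G" for N
  proof -
    have nor: "N \<lhd> G" using N by (simp add: finite_index_normal_def)
    interpret Q: group "G Mod N" by (rule normal.factorgroup_is_group[OF nor])
    have "(\<lambda>f. f N) \<in> hom (profinite_completion G) (G Mod N)"
    proof (rule homI)
      show "f N \<in> carrier (G Mod N)" if "f \<in> carrier (profinite_completion G)" for f
        using that N unfolding profinite_completion_mem carrier_FactGroup by blast
      show "(f \<otimes>\<^bsub>profinite_completion G\<^esub> g) N = f N \<otimes>\<^bsub>G Mod N\<^esub> g N" for f g
        using N by (simp add: profinite_completion_def)
    qed
    then interpret e: group_hom "profinite_completion G" "G Mod N" "\<lambda>f. f N"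
      by (simp add: group_hom_def group_hom_axioms_def)
    have "metabelian_relators G \<subseteq> {\<one>\<^bsub>G\<^esub>}" using met by (auto simp: metabelian_relators_def metabelian_def)
    then have "metabelian (G Mod N)"
      using metabelian_FactGroup[OF G nor] subgroup.one_closed[OF normal_imp_subgroup[OF nor]] by blast
    then have "?x \<in> kernel (profinite_completion G) (G Mod N) (\<lambda>f. f N)"
      using metabelian_relators_kernel[OF e.group_hom_axioms] abcd
      unfolding metabelian_relators_def by blast
    then show ?thesis using e.hom_one by (simp add: kernel_def)
  qed
  moreover note ext = profinite_completion_mem[THEN iffD1, THEN conjunct1]
  ultimately show "?x = \<one>\<^bsub>profinite_completion G\<^esub>"
    using extensionalityI[OF ext[OF x] ext[OF P.one_closed]] by blast
qed

lemma metabelian_genus: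
  assumes G: "group G" "metabelian G" and H: "residually_finite H" "isomorphic_profinite_completions H G"
  shows "metabelian H"
proof -
  have gH: "group H" using H(1) by (simp add: residually_finite_def)
  obtain i where i: "i \<in> hom H (profinite_completion H)" "inj_on i (carrier H)"
    using residually_finite_embedding[OF H(1)] by blast
  obtain \<phi> where \<phi>: "\<phi> \<in> iso (profinite_completion H) (profinite_completion G)"
    using H(2) by (auto simp: isomorphic_profinite_completions_def)
  show ?thesis
  proof (rule metabelian_embedding)
    show "group_hom H (profinite_completion G) (\<phi> \<circ> i)"
      using i(1) \<phi> gH group_profinite_completion[OF G(1)] hom_compose
      by (auto simp: group_hom_def group_hom_axioms_def iso_def)
    show "inj_on (\<phi> \<circ> i) (carrier H)"
      using i \<phi> by (intro comp_inj_on) (auto simp: iso_def bij_betw_def hom_def intro: inj_on_subset)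
    show "metabelian (profinite_completion G)" by (rule metabelian_profinite_completion[OF G])
  qed
qed

lemma countable_profinite_genus:
  assumes "group G" "metabelian G"
  shows "countable (profinite_genus G)"
  unfolding profinite_genus_def
  by (rule countable_metabelian_classes) (use assms metabelian_genus in \<open>auto simp: genus_groups_def\<close>)

section \<open>The ring of integer Laurent polynomials with \<open>1 + x\<close> inverted\<close>

text \<open>
  The ring \<open>\<int>[x, 1/x, 1/(1+x)]\<close> is realised by the values of its elements at \<open>\<i>\<close> and at the
  positive integers.
\<close>

definition pt :: "nat \<Rightarrow> complex"
  where "pt n = (if n = 0 then \<i> else of_nat n)"

definition chi :: "int \<Rightarrow> int \<Rightarrow> nat \<Rightarrow> complex"
  where "chi i j n = pt n powi i * (1 + pt n) powi j"

text \<open>The additive group spanned by the monomials \<open>x^i (1 + x)^j\<close>. It is a ring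
  because these are closed under products, and its induction rule lets additive statements be
  checked on monomials alone.\<close>

inductive_set BR :: "(nat \<Rightarrow> complex) set"
  where
    BR_chi: "chi i j \<in> BR"
  | BR_diff: "f \<in> BR \<Longrightarrow> g \<in> BR \<Longrightarrow> f - g \<in> BR"

lemma pt_nonzero [simp]: "pt n \<noteq> 0" "1 + pt n \<noteq> 0"
proof -
  show "pt n \<noteq> 0" by (simp add: pt_def)
  show "1 + pt n \<noteq> 0"
  proof (cases "n = 0")
    case True
    then show ?thesis by (simp add: pt_def complex_eq_iff)
  next
    case False
    have "1 + pt n = of_nat (Suc n)" using False by (simp add: pt_def)
    then show ?thesis using of_nat_neq_0 by metis
  qed
qed

lemma chi_nonzero [simp]: "chi i j n \<noteq> 0"
  by (simp add: chi_def)

lemma chi_mult: "chi i j * chi k l = chi (i + k) (j + l)"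
  by (simp add: fun_eq_iff chi_def power_int_add)

lemma chi_0 [simp]: "chi 0 0 = 1"
  by (simp add: fun_eq_iff chi_def)

lemma chi_Y: "chi 0 1 = 1 + chi 1 0"
  by (simp add: fun_eq_iff chi_def)

lemma fun_diff_apply [simp]: "(f - g) n = f n - (g n :: complex)"
  by (simp add: fun_diff_def)

lemma fun_power_apply [simp]: "(f ^ k) n = (f n :: complex) ^ k"
  by (induction k) simp_all

lemma BR_0 [simp]: "0 \<in> BR"
  using BR_diff[OF BR_chi[of 0 0] BR_chi[of 0 0]] by simp

lemma BR_1 [simp]: "1 \<in> BR"
  using BR_chi[of 0 0] by simp

lemma BR_uminus: "f \<in> BR \<Longrightarrow> - f \<in> BR"
  using BR_diff[OF BR_0] by fastforce

lemma BR_add: "f \<in> BR \<Longrightarrow> g \<in> BR \<Longrightarrow> f + g \<in> BR"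
  using BR_diff[OF _ BR_uminus] by fastforce

lemma BR_mult:
  assumes "f \<in> BR" "g \<in> BR"
  shows "f * g \<in> BR"
proof -
  have "chi i j * g \<in> BR" for i j
    using assms(2) by induction (simp_all only: chi_mult right_diff_distrib BR.intros)
  note chi = this
  show ?thesis
    using assms(1) by (induction f rule: BR.induct) (simp_all only: left_diff_distrib BR_diff chi)
qed

lemma BR_power: "f \<in> BR \<Longrightarrow> f ^ n \<in> BR"
  by (induction n) (auto intro: BR_mult)

lemma BR_of_nat: "of_nat n \<in> BR"
  by (induction n) (simp_all only: of_nat_0 of_nat_Suc BR_0 BR_1 BR_add)

lemma BR_numeral: "numeral n \<in> BR"
  using BR_of_nat[of "numeral n"] by simp

lemma BR_sum: "(\<And>i. i \<in> A \<Longrightarrow> f i \<in> BR) \<Longrightarrow> sum f A \<in> BR"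
  by (induction A rule: infinite_finite_induct) (auto intro: BR_add)

lemmas BR_closed = BR_chi BR_0 BR_1 BR_diff BR_uminus BR_add BR_mult BR_power BR_numeral BR_sum

section \<open>Clearing denominators, zeros and units\<close>

definition int_poly :: "complex poly \<Rightarrow> bool"
  where "int_poly P \<longleftrightarrow> (\<forall>i. coeff P i \<in> \<int>)"

lemma int_poly_mult: "int_poly P \<Longrightarrow> int_poly Q \<Longrightarrow> int_poly (P * Q)"
  by (auto simp: int_poly_def coeff_mult intro!: Ints_sum Ints_mult)

lemma int_poly_diff: "int_poly P \<Longrightarrow> int_poly Q \<Longrightarrow> int_poly (P - Q)"
  by (auto simp: int_poly_def)

lemma int_poly_power: "int_poly P \<Longrightarrow> int_poly (P ^ n)"
  by (induction n) (auto simp: int_poly_mult, auto simp: int_poly_def coeff_1)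

lemma int_poly_X: "int_poly [:0, 1:]" "int_poly [:1, 1:]"
  by (auto simp: int_poly_def coeff_pCons split: nat.splits)

lemma BR_poly:
  assumes "f \<in> BR"
  shows "\<exists>k P. int_poly P \<and> (\<forall>n. f n * (pt n * (1 + pt n)) ^ k = poly P (pt n))"
  using assms
proof induction
  case (BR_chi i j)
  define k where "k = nat \<bar>i\<bar> + nat \<bar>j\<bar>"
  let ?P = "[:0, 1:] ^ nat (i + int k) * [:1, 1:] ^ nat (j + int k)"
  have "chi i j n * (pt n * (1 + pt n)) ^ k = poly ?P (pt n)" for n
  proof -
    have "chi i j n * (pt n * (1 + pt n)) ^ k = pt n powi (i + int k) * (1 + pt n) powi (j + int k)"
      by (simp add: chi_def power_int_add power_mult_distrib)
    moreover have "i + int k \<ge> 0" "j + int k \<ge> 0" by (auto simp: k_def)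
    ultimately show ?thesis by (simp add: power_int_def add.commute)
  qed
  moreover have "int_poly ?P" by (intro int_poly_mult int_poly_power int_poly_X)
  ultimately show ?case by blast
next
  case (BR_diff f g)
  then obtain k P l Q where
    P: "int_poly P" "\<And>n. f n * (pt n * (1 + pt n)) ^ k = poly P (pt n)" and
    Q: "int_poly Q" "\<And>n. g n * (pt n * (1 + pt n)) ^ l = poly Q (pt n)" by blast
  let ?R = "P * ([:0, 1:] * [:1, 1:]) ^ l - Q * ([:0, 1:] * [:1, 1:]) ^ k"
  have "(f - g) n * (pt n * (1 + pt n)) ^ (k + l) = poly ?R (pt n)" for n
    by (simp add: P(2)[symmetric] Q(2)[symmetric] power_add algebra_simps)
  moreover have "int_poly ?R"
    by (intro int_poly_diff int_poly_mult int_poly_power int_poly_X P(1) Q(1))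
  ultimately show ?case by blast
qed

lemma pt_inj: "inj pt"
  by (rule injI) (auto simp: pt_def complex_eq_iff split: if_splits)

text \<open>After clearing denominators the values are those of one polynomial, and a polynomial
  with infinitely many zeros vanishes. Hence this ring of functions has no zero divisors.\<close>

lemma BR_eq_0I:
  assumes "f \<in> BR" "infinite {n. f n = 0}"
  shows "f = 0"
proof -
  obtain k P where P: "\<And>n. f n * (pt n * (1 + pt n)) ^ k = poly P (pt n)"
    using BR_poly[OF assms(1)] by blast
  have "pt ` {n. f n = 0} \<subseteq> {z. poly P z = 0}" using P by (auto simp flip: P)
  then have "infinite {z. poly P z = 0}"
    using assms(2) pt_inj by (meson finite_imageD finite_subset inj_on_subset subset_UNIV)
  then have "P = 0" using poly_roots_finite by blast
  then have "f n = 0" for n using P[of n] by simp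
  then show ?thesis by (simp add: fun_eq_iff)
qed

lemma BR_nonzero:
  assumes "f \<in> BR" "f \<noteq> 0"
  shows "\<exists>n\<ge>m. f n \<noteq> 0"
proof (rule ccontr)
  assume "\<not> ?thesis"
  then have "{m..} \<subseteq> {n. f n = 0}" by auto
  then have "infinite {n. f n = 0}" using infinite_Ici infinite_super by blast
  then show False using BR_eq_0I assms by blast
qed

lemma BR_mult_eq_0:
  assumes "f \<in> BR" "g \<in> BR" "f * g = 0"
  shows "f = 0 \<or> g = 0"
proof -
  have "f n = 0 \<or> g n = 0" for n using fun_cong[OF assms(3), of n] by simp
  then have "{n. f n = 0} \<union> {n. g n = 0} = UNIV" by auto
  then have "infinite {n. f n = 0} \<or> infinite {n. g n = 0}" by (metis finite_Un infinite_UNIV_nat)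
  then show ?thesis using BR_eq_0I assms by blast
qed

lemma BR_cancel:
  assumes "f \<in> BR" "g \<in> BR" "h \<in> BR" "f \<noteq> 0" "f * g = f * h"
  shows "g = h"
  using BR_mult_eq_0[of f "g - h"] assms by (auto simp: right_diff_distrib BR_diff)

text \<open>Consecutive integers are coprime and both exceed 1 here, so a single point
  \<open>n \<ge> 2\<close> separates the monomials.\<close>

lemma chi_eq_1:
  assumes "chi i j n = 1" "n \<ge> 2"
  shows "i = 0 \<and> j = 0"
proof -
  \<comment> \<open>Positive and negative parts of the exponents, in order to reach an equation
    between natural numbers.\<close>
  define a b where "a = nat i" and "b = nat (- i)"
  define c d where "c = nat j" and "d = nat (- j)"
  have i: "i = int a - int b" "a = 0 \<or> b = 0" by (auto simp: a_def b_def)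
  have j: "j = int c - int d" "c = 0 \<or> d = 0" by (auto simp: c_def d_def)
  have n: "pt n = of_nat n" "1 + pt n = of_nat (Suc n)" using assms(2) by (auto simp: pt_def)
  have nz: "of_nat n \<noteq> (0 :: complex)" "of_nat (Suc n) \<noteq> (0 :: complex)" using assms(2) by (auto simp del: of_nat_Suc)
  have "of_nat n ^ a / of_nat n ^ b * (of_nat (Suc n) ^ c / of_nat (Suc n) ^ d) = (1 :: complex)"
    using assms(1) unfolding chi_def n i(1) j(1)
    using nz by (simp only: of_nat_Suc power_int_diff power_int_of_nat simp_thms)
  then have "of_nat n ^ a * of_nat (Suc n) ^ c = of_nat n ^ b * (of_nat (Suc n) ^ d :: complex)"
    using nz by (simp add: field_simps del: of_nat_Suc)
  then have "of_nat (n ^ a * Suc n ^ c) = (of_nat (n ^ b * Suc n ^ d) :: complex)"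
    by (simp del: of_nat_Suc)
  then have eq: "n ^ a * Suc n ^ c = n ^ b * Suc n ^ d" by (simp only: of_nat_eq_iff)
  have cop: "coprime (n ^ k) (Suc n ^ l)" for k l by simp
  have 1: "k = 0" if "n ^ k dvd Suc n ^ l" for k l
  proof -
    have "n ^ k dvd 1" using that cop[of k l] by (metis coprime_common_divisor dvd_refl)
    then show ?thesis using assms(2) by (cases k) auto
  qed
  have 2: "l = 0" if "Suc n ^ l dvd n ^ k" for k l
  proof -
    have "Suc n ^ l dvd 1" using that cop[of k l] by (metis coprime_common_divisor dvd_refl)
    then have "Suc n ^ l = 1" by (simp only: nat_dvd_1_iff_1)
    then show ?thesis using assms(2) power_eq_1_iff[of "Suc n" l] by (cases "l = 0") auto
  qed
  have "a = 0"
  proof (cases "a = 0")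
    case False
    then have "b = 0" using i(2) by simp
    then have "n ^ a dvd Suc n ^ d" using eq by (metis dvd_triv_left mult_1 power_0)
    then show ?thesis by (rule 1)
  qed
  moreover have "b = 0"
  proof (cases "b = 0")
    case False
    then have "a = 0" using i(2) by simp
    then have "n ^ b dvd Suc n ^ c" using eq by (metis dvd_triv_left mult_1 power_0)
    then show ?thesis by (rule 1)
  qed
  ultimately have "Suc n ^ c = Suc n ^ d" using eq by simp
  then have "c = d" using assms(2) by (metis One_nat_def Suc_le_eq numeral_2_eq_2 power_inject_exp lessI less_SucI)
  then show ?thesis using i j \<open>a = 0\<close> \<open>b = 0\<close> by simp
qed

text \<open>Unique factorization by hand: the roots 0 and -1 are divided out one at a time, from
  whichever factor vanishes there.\<close>

lemma poly_unit_factors: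
  fixes P Q :: "complex poly"
  assumes "P * Q = [:0, 1:] ^ c * [:1, 1:] ^ d"
  shows "\<exists>a b u. P = smult u ([:0, 1:] ^ a * [:1, 1:] ^ b)"
  using assms
proof (induction "c + d" arbitrary: P Q c d)
  case 0
  then have "P dvd 1" by (metis add_is_0 dvd_triv_left mult_1 power_0)
  then obtain u where "P = [:u:]" by (auto simp: is_unit_poly_iff)
  then show ?case by (intro exI[of _ 0] exI[of _ u]) simp
next
  case (Suc s)
  have step: ?case if lin: "[:z, 1:] * R = [:0, 1:] ^ c * [:1, 1:] ^ d"
    "R = [:0, 1:] ^ c' * [:1, 1:] ^ d'" "s = c' + d'" "z = 0 \<or> z = 1" for z :: complex and R c' d'
  proof -
    have PQ: "P * Q = [:z, 1:] * R" using Suc.prems lin by simp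
    have "poly (P * Q) (- z) = 0" unfolding PQ by simp
    then consider "poly P (- z) = 0" | "poly Q (- z) = 0" by auto
    then show ?thesis
    proof cases
      case 1
      then have "[:z, 1:] dvd P" using poly_eq_0_iff_dvd[of P "- z"] by simp
      then obtain P' where P': "P = [:z, 1:] * P'" by blast
      have nz: "[:z, 1:] \<noteq> 0" by simp
      have "[:z, 1:] * (P' * Q) = [:z, 1:] * R" using PQ P' by (simp only: mult.assoc)
      then have "P' * Q = R" using nz by (simp only: mult_cancel_left) simp
      then obtain a b u where "P' = smult u ([:0, 1:] ^ a * [:1, 1:] ^ b)"
        using Suc.hyps(1)[OF lin(3), of P' Q] lin(2) by metis
      then have "P = smult u ([:z, 1:] * ([:0, 1:] ^ a * [:1, 1:] ^ b))" using P' by (simp only: mult_smult_right)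
      moreover have "[:z, 1:] * ([:0, 1:] ^ a * [:1, 1:] ^ b) =
          (if z = 0 then [:0, 1:] ^ Suc a * [:1, 1:] ^ b else [:0, 1:] ^ a * [:1, 1:] ^ Suc b)"
        using lin(4) by (auto simp only: power_Suc mult_ac split: if_splits)
      ultimately show ?thesis by metis
    next
      case 2
      then have "[:z, 1:] dvd Q" using poly_eq_0_iff_dvd[of Q "- z"] by simp
      then obtain Q' where Q': "Q = [:z, 1:] * Q'" by blast
      have nz: "[:z, 1:] \<noteq> 0" by simp
      have "[:z, 1:] * (P * Q') = [:z, 1:] * R" using PQ Q' by (simp only: mult_ac)
      then have "P * Q' = R" using nz by (simp only: mult_cancel_left) simp
      then show ?thesis using Suc.hyps(1)[OF lin(3), of P Q'] lin(2) by metis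
    qed
  qed
  show ?case
  proof (cases c)
    case 0
    then have "d = Suc s" using Suc.hyps(2) by simp
    then show ?thesis using step[of 1 "[:1, 1:] ^ s" 0 s] 0 by simp
  next
    case (Suc c')
    then show ?thesis
      using step[of 0 "[:0, 1:] ^ c' * [:1, 1:] ^ d" c' d] \<open>Suc s = c + d\<close> by (simp only: power_Suc mult.assoc) simp
  qed
qed

text \<open>Clearing denominators gives integer polynomials whose product is a power of
  \<open>x (1 + x)\<close>, so \<open>P\<close> is a constant times a monomial. As the monomials are
  monic, the constant is an integer dividing 1.\<close>

lemma BR_unit:
  assumes "f \<in> BR" "g \<in> BR" "f * g = 1"
  shows "\<exists>i j s. (s = 1 \<or> s = -1) \<and> (\<forall>n. f n = s * chi i j n)"
proof -
  obtain k P where P: "int_poly P" "\<And>n. f n * (pt n * (1 + pt n)) ^ k = poly P (pt n)"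
    using BR_poly[OF assms(1)] by blast
  obtain l Q where Q: "int_poly Q" "\<And>n. g n * (pt n * (1 + pt n)) ^ l = poly Q (pt n)"
    using BR_poly[OF assms(2)] by blast
  let ?R = "[:0, 1:] ^ (k + l) * [:1, 1:] ^ (k + l) :: complex poly"
  \<comment> \<open>The identity of functions becomes one of polynomials because it holds at
    infinitely many points.\<close>
  have "poly (P * Q - ?R) (pt n) = 0" for n
  proof -
    have "f n * g n = 1" using fun_cong[OF assms(3), of n] by simp
    then have "f n * (pt n * (1 + pt n)) ^ k * (g n * (pt n * (1 + pt n)) ^ l) = (pt n * (1 + pt n)) ^ (k + l)"
      by (simp add: power_add mult_ac)
    then have "poly P (pt n) * poly Q (pt n) = (pt n * (1 + pt n)) ^ (k + l)" by (simp only: P(2) Q(2))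
    then show ?thesis by (simp add: power_mult_distrib add.commute)
  qed
  then have "range pt \<subseteq> {z. poly (P * Q - ?R) z = 0}" by auto
  then have "infinite {z. poly (P * Q - ?R) z = 0}"
    using pt_inj by (meson finite_imageD finite_subset infinite_UNIV_nat)
  then have "P * Q - ?R = 0" using poly_roots_finite by blast
  then have PQ: "P * Q = ?R" by (simp only: right_minus_eq)
  obtain a b u where Pu: "P = smult u ([:0, 1:] ^ a * [:1, 1:] ^ b)" using poly_unit_factors[OF PQ] by blast
  have lead: "lead_coeff ([:0, 1:] ^ a * [:1, 1:] ^ b :: complex poly) = 1" for a b
    by (simp add: lead_coeff_mult lead_coeff_power)
  have "lead_coeff P = u" unfolding Pu lead_coeff_smult lead by simp
  then have "u \<in> \<int>" using P(1) by (auto simp: int_poly_def)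
  moreover have "u * lead_coeff Q = 1"
    using arg_cong[OF PQ, of lead_coeff] \<open>lead_coeff P = u\<close> unfolding lead by (simp only: lead_coeff_mult)
  moreover have "lead_coeff Q \<in> \<int>" using Q(1) by (auto simp: int_poly_def)
  ultimately obtain m m' :: int where m: "u = of_int m" "of_int m * of_int m' = (1 :: complex)"
    by (auto elim!: Ints_cases)
  then have "m * m' = 1" by (metis of_int_eq_1_iff of_int_mult)
  then have u: "u = 1 \<or> u = -1" using m(1) zmult_eq_1_iff by auto
  have "f n = u * chi (int a - int k) (int b - int k) n" for n
  proof -
    have "f n * (pt n * (1 + pt n)) ^ k = u * (pt n ^ a * (1 + pt n) ^ b)"
      unfolding P(2) Pu by (simp add: add.commute)
    then show ?thesis
      unfolding power_mult_distrib by (simp add: chi_def power_int_diff nonzero_eq_divide_eq mult_ac)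
  qed
  then show ?thesis using u by blast
qed

section \<open>The groups\<close>

definition phi :: "nat \<Rightarrow> complex"
  where "phi = chi 4 0 - 1"

definition phiB :: "(nat \<Rightarrow> complex) set"
  where "phiB = (\<lambda>b. phi * b) ` BR"

lemma phi_BR: "phi \<in> BR"
  unfolding phi_def by (intro BR_closed)

lemma phiB_I: "b \<in> BR \<Longrightarrow> phi * b \<in> phiB"
  by (auto simp only: phiB_def)

lemma phiB_E: "f \<in> phiB \<Longrightarrow> (\<And>b. b \<in> BR \<Longrightarrow> f = phi * b \<Longrightarrow> P) \<Longrightarrow> P"
  by (auto simp only: phiB_def)

lemma phiB_BR: "f \<in> phiB \<Longrightarrow> f \<in> BR"
  by (erule phiB_E) (simp only: BR_mult phi_BR)

lemma phiB_0: "0 \<in> phiB"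
  using phiB_I[OF BR_0] by (simp only: mult_zero_right)

lemma phiB_diff: "f \<in> phiB \<Longrightarrow> g \<in> phiB \<Longrightarrow> f - g \<in> phiB"
  by (elim phiB_E) (simp only: right_diff_distrib[symmetric] phiB_I BR_diff)

lemma phiB_uminus: "f \<in> phiB \<Longrightarrow> - f \<in> phiB"
  using phiB_diff[OF phiB_0] by (simp only: diff_0)

lemma phiB_add: "f \<in> phiB \<Longrightarrow> g \<in> phiB \<Longrightarrow> f + g \<in> phiB"
  by (elim phiB_E) (simp only: distrib_left[symmetric] phiB_I BR_add)

lemma phiB_mult: "c \<in> BR \<Longrightarrow> f \<in> phiB \<Longrightarrow> c * f \<in> phiB"
  by (erule phiB_E) (simp only: mult.left_commute[of c phi] phiB_I BR_mult)

lemma phiB_mult': "c \<in> BR \<Longrightarrow> f \<in> phiB \<Longrightarrow> f * c \<in> phiB"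
  using phiB_mult by (simp only: mult.commute)

lemmas phiB_closed = phiB_0 phiB_diff phiB_uminus phiB_add phiB_mult phiB_mult'

lemma chi_4_minus_1: "chi (4 * r) 0 - 1 \<in> phiB"
proof -
  have nat: "chi (4 * int n) 0 - 1 \<in> phiB" for n
  proof (induction n)
    case 0
    then show ?case by (simp only: of_nat_0 mult_zero_right chi_0 diff_self phiB_0)
  next
    case (Suc n)
    have "4 * int (Suc n) = 4 + 4 * int n" by simp
    then have "chi (4 * int (Suc n)) 0 - 1 = chi 4 0 * (chi (4 * int n) 0 - 1) + phi * 1"
      by (simp only: phi_def right_diff_distrib chi_mult add_0_right mult_1_right) (simp add: algebra_simps)
    then show ?case using Suc by (simp only: phiB_closed phiB_I BR_closed)
  qed
  show ?thesis
  proof (cases "r \<ge> 0")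
    case True
    then show ?thesis using nat[of "nat r"] by simp
  next
    case False
    then have r: "r = - int (nat (- r))" by simp
    have "chi (- (4 * int n)) 0 - 1 \<in> phiB" for n
    proof -
      have "chi (- (4 * int n)) 0 - 1 = - (chi (- (4 * int n)) 0 * (chi (4 * int n) 0 - 1))"
        by (simp only: right_diff_distrib chi_mult) simp
      then show ?thesis using nat[of n] by (simp only: phiB_closed BR_closed)
    qed
    then show ?thesis using r by (metis mult_minus_right)
  qed
qed

lemma chi_shift: "chi (i + 4 * r) j - chi i j \<in> phiB"
proof -
  have "chi (i + 4 * r) j - chi i j = chi i j * (chi (4 * r) 0 - 1)"
    by (simp only: right_diff_distrib chi_mult mult_1_right add_0_right)
  then show ?thesis using chi_4_minus_1 by (simp only: phiB_closed BR_closed)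
qed

type_synonym gelt = "(nat \<Rightarrow> complex) \<times> (nat \<Rightarrow> complex) \<times> int \<times> int \<times> int"

text \<open>
  The element \<open>(f, g, i, j, r)\<close> is the product of the module element \<open>(f, g)\<close> with
  \<open>x^i y^j w^r\<close>. Here \<open>x\<close> acts as multiplication by \<open>x\<close>, \<open>y\<close> as multiplication by \<open>1 + x\<close>, and
  \<open>w\<close> fixes the first coordinate and multiplies the second one by \<open>x^4\<close>.
\<close>

definition gam :: "(nat \<Rightarrow> complex) \<Rightarrow> gelt monoid"
  where "gam e = \<lparr>carrier = {(f, g, i, j, r). f \<in> BR \<and> g \<in> BR \<and> f - e * g \<in> phiB},
    monoid.mult = (\<lambda>(f, g, i, j, r) (f', g', i', j', r').
      (f + chi i j * f', g + chi (i + 4 * r) j * g', i + i', j + j', r + r')),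
    one = (0, 0, 0, 0, 0)\<rparr>"

lemma gam_carrier: "(f, g, i, j, r) \<in> carrier (gam e) \<longleftrightarrow> f \<in> BR \<and> g \<in> BR \<and> f - e * g \<in> phiB"
  by (simp add: gam_def)

lemma gam_mult: "(f, g, i, j, r) \<otimes>\<^bsub>gam e\<^esub> (f', g', i', j', r') =
    (f + chi i j * f', g + chi (i + 4 * r) j * g', i + i', j + j', r + r')"
  by (simp add: gam_def)

lemma gam_one: "\<one>\<^bsub>gam e\<^esub> = (0, 0, 0, 0, 0)"
  by (simp add: gam_def)

lemma gam_mem_E:
  assumes "a \<in> carrier (gam e)"
  obtains f g i j r where "a = (f, g, i, j, r)" "f \<in> BR" "g \<in> BR" "f - e * g \<in> phiB"
  using assms by (cases a) (auto simp: gam_carrier)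

text \<open>Modulo \<phi> the actions on the two coordinates coincide, because
  \<open>x^(4 r)\<close> is 1 there; so the congruence defining the module survives.\<close>

lemma gam_action_closed:
  assumes "e \<in> BR" "f \<in> BR" "g \<in> BR" "f - e * g \<in> phiB"
  shows "chi i j * f - e * (chi (i + 4 * r) j * g) \<in> phiB"
proof -
  have "chi i j * f - e * (chi (i + 4 * r) j * g) =
      chi i j * (f - e * g) - (e * g) * (chi (i + 4 * r) j - chi i j)"
    by (simp only: right_diff_distrib mult_ac) (simp add: algebra_simps)
  then show ?thesis
    using assms chi_shift by (simp only: phiB_closed BR_closed)
qed

lemma group_gam:
  assumes e: "e \<in> BR"
  shows "group (gam e)"
proof (rule groupI)
  show "\<one>\<^bsub>gam e\<^esub> \<in> carrier (gam e)"
    unfolding gam_one gam_carrier by (simp only: mult_zero_right diff_self BR_closed phiB_closed)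
  show "a \<otimes>\<^bsub>gam e\<^esub> b \<in> carrier (gam e)" if "a \<in> carrier (gam e)" "b \<in> carrier (gam e)" for a b
  proof -
    obtain f g i j r where a: "a = (f, g, i, j, r)" "f \<in> BR" "g \<in> BR" "f - e * g \<in> phiB"
      using \<open>a \<in> carrier (gam e)\<close> by (rule gam_mem_E)
    obtain f' g' i' j' r' where b: "b = (f', g', i', j', r')" "f' \<in> BR" "g' \<in> BR" "f' - e * g' \<in> phiB"
      using \<open>b \<in> carrier (gam e)\<close> by (rule gam_mem_E)
    have "(f + chi i j * f') - e * (g + chi (i + 4 * r) j * g') =
        (f - e * g) + (chi i j * f' - e * (chi (i + 4 * r) j * g'))"
      by (simp add: algebra_simps)
    then show ?thesis
      using a b gam_action_closed[OF e b(2-4)]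
      by (simp only: gam_mult gam_carrier phiB_closed BR_closed)
  qed
  show "a \<otimes>\<^bsub>gam e\<^esub> b \<otimes>\<^bsub>gam e\<^esub> c = a \<otimes>\<^bsub>gam e\<^esub> (b \<otimes>\<^bsub>gam e\<^esub> c)" for a b c
    by (cases a; cases b; cases c)
      (simp only: gam_mult chi_mult[symmetric] distrib_left mult.assoc[symmetric] add.assoc[symmetric]
        prod.inject, simp add: chi_mult algebra_simps)
  show "\<one>\<^bsub>gam e\<^esub> \<otimes>\<^bsub>gam e\<^esub> a = a" for a
    by (cases a) (simp only: gam_mult gam_one add_0_left mult_zero_right chi_0 mult_1_left)
  show "\<exists>b\<in>carrier (gam e). b \<otimes>\<^bsub>gam e\<^esub> a = \<one>\<^bsub>gam e\<^esub>" if "a \<in> carrier (gam e)" for a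
  proof -
    obtain f g i j r where a: "a = (f, g, i, j, r)" "f \<in> BR" "g \<in> BR" "f - e * g \<in> phiB"
      using \<open>a \<in> carrier (gam e)\<close> by (rule gam_mem_E)
    let ?b = "(- (chi (- i) (- j) * f), - (chi (- i + 4 * (- r)) (- j) * g), - i, - j, - r)"
    have "- (chi (- i) (- j) * f) - e * (- (chi (- i + 4 * (- r)) (- j) * g)) =
        - (chi (- i) (- j) * f - e * (chi (- i + 4 * (- r)) (- j) * g))"
      by (simp add: algebra_simps)
    then have "?b \<in> carrier (gam e)"
      unfolding gam_carrier using a gam_action_closed[OF e a(2-4)] by (simp only: phiB_closed BR_closed)
    moreover have "?b \<otimes>\<^bsub>gam e\<^esub> a = \<one>\<^bsub>gam e\<^esub>" by (simp add: a gam_mult gam_one)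
    ultimately show ?thesis by blast
  qed
qed

lemma gam_inv:
  assumes e: "e \<in> BR" and a: "(f, g, i, j, r) \<in> carrier (gam e)"
  shows "inv\<^bsub>gam e\<^esub> (f, g, i, j, r) =
    (- (chi (- i) (- j) * f), - (chi (- i - 4 * r) (- j) * g), - i, - j, - r)"
proof -
  interpret group "gam e" by (rule group_gam[OF e])
  obtain f' g' i' j' r' where b: "inv\<^bsub>gam e\<^esub> (f, g, i, j, r) = (f', g', i', j', r')"
    by (cases "inv\<^bsub>gam e\<^esub> (f, g, i, j, r)") auto
  have "(f', g', i', j', r') \<otimes>\<^bsub>gam e\<^esub> (f, g, i, j, r) = (0, 0, 0, 0, 0)"
    using l_inv[OF a] b gam_one by simp
  then have eq: "f' + chi i' j' * f = 0" "g' + chi (i' + 4 * r') j' * g = 0" "i' = - i" "j' = - j" "r' = - r"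
    by (auto simp: gam_mult)
  have "f' = - (chi i' j' * f)" "g' = - (chi (i' + 4 * r') j' * g)"
    using eq(1,2) by (simp_all only: eq_neg_iff_add_eq_0)
  then show ?thesis using b eq by simp
qed

lemma gam_commutator:
  assumes e: "e \<in> BR" and "a \<in> carrier (gam e)" "b \<in> carrier (gam e)"
  shows "\<exists>f g. commutator (gam e) a b = (f, g, 0, 0, 0)"
proof -
  obtain f g i j r where a: "a = (f, g, i, j, r)" using assms(2) by (rule gam_mem_E)
  obtain f' g' i' j' r' where b: "b = (f', g', i', j', r')" using assms(3) by (rule gam_mem_E)
  show ?thesis using assms unfolding a b by (simp add: commutator_def gam_inv gam_mult)
qed

lemma metabelian_gam:
  assumes e: "e \<in> BR"
  shows "metabelian (gam e)"
  unfolding metabelian_def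
proof (intro ballI)
  interpret group "gam e" by (rule group_gam[OF e])
  fix a b c d assume ab: "a \<in> carrier (gam e)" "b \<in> carrier (gam e)"
    and cd: "c \<in> carrier (gam e)" "d \<in> carrier (gam e)"
  obtain f g where 1: "commutator (gam e) a b = (f, g, 0, 0, 0)" using gam_commutator[OF e ab] by blast
  obtain f' g' where 2: "commutator (gam e) c d = (f', g', 0, 0, 0)" using gam_commutator[OF e cd] by blast
  have "commutator (gam e) a b \<otimes>\<^bsub>gam e\<^esub> commutator (gam e) c d =
      commutator (gam e) c d \<otimes>\<^bsub>gam e\<^esub> commutator (gam e) a b"
    unfolding 1 2 gam_mult by (simp add: add.commute)
  then show "commutator (gam e) (commutator (gam e) a b) (commutator (gam e) c d) = \<one>\<^bsub>gam e\<^esub>"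
    using commutator_eq_one_iff ab cd by simp
qed

text \<open>\<open>(f, g) = c (\<phi>, 0) + g (e, 1)\<close> with \<open>c\<close> the quotient of
  \<open>f - e g\<close> by \<phi>, so two elements generate the module; conjugation by monomials in
  \<open>x\<close> and \<open>y\<close> supplies the coefficients.\<close>

lemma generate_gam:
  assumes e: "e \<in> BR"
  shows "generate (gam e) {(phi, 0, 0, 0, 0), (e, 1, 0, 0, 0), (0, 0, 1, 0, 0), (0, 0, 0, 1, 0), (0, 0, 0, 0, 1)} =
    carrier (gam e)"
proof -
  let ?S = "{(phi, 0, 0, 0, 0), (e, 1, 0, 0, 0), (0, 0, 1, 0, 0), (0, 0, 0, 1, 0), (0, 0, 0, 0, 1)} :: gelt set"
  interpret group "gam e" by (rule group_gam[OF e])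
  have z: "(0, 0, i, j, r) \<in> carrier (gam e)" for i j r
    unfolding gam_carrier by (simp only: mult_zero_right diff_self BR_closed phiB_closed)
  have ab: "(phi, 0, 0, 0, 0) \<in> carrier (gam e)" "(e, 1, 0, 0, 0) \<in> carrier (gam e)"
    unfolding gam_carrier using phi_BR e phiB_I[OF BR_1]
    by (simp_all only: mult_zero_right mult_1_right diff_self diff_0_right BR_closed phiB_closed)
  have S: "?S \<subseteq> carrier (gam e)" using z ab by simp
  define H where "H = generate (gam e) ?S"
  have H: "subgroup H (gam e)" unfolding H_def by (rule generate_is_subgroup[OF S])
  have m: "a \<otimes>\<^bsub>gam e\<^esub> b \<in> H" if "a \<in> H" "b \<in> H" for a b using that subgroup.m_closed[OF H] by blast
  have inv: "inv\<^bsub>gam e\<^esub> a \<in> H" if "a \<in> H" for a using subgroup.m_inv_closed[OF H that] .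
  have gen: "a \<in> H" if "a \<in> ?S" for a unfolding H_def using that by (rule generate.incl)
  have x: "(0, 0, 1, 0, 0) \<in> H" "(0, 0, -1, 0, 0) \<in> H"
    using gen[of "(0, 0, 1, 0, 0)"] inv[of "(0, 0, 1, 0, 0)"] z by (simp_all add: gam_inv[OF e])
  have y: "(0, 0, 0, 1, 0) \<in> H" "(0, 0, 0, -1, 0) \<in> H"
    using gen[of "(0, 0, 0, 1, 0)"] inv[of "(0, 0, 0, 1, 0)"] z by (simp_all add: gam_inv[OF e])
  have w: "(0, 0, 0, 0, 1) \<in> H" "(0, 0, 0, 0, -1) \<in> H"
    using gen[of "(0, 0, 0, 0, 1)"] inv[of "(0, 0, 0, 0, 1)"] z by (simp_all add: gam_inv[OF e])
  have one: "(0, 0, 0, 0, 0) \<in> H" using subgroup.one_closed[OF H] by (simp only: gam_one)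
  have X: "(0, 0, i, 0, 0) \<in> H" for i
  proof (induction i rule: int_induct[where k = 0])
    case (step1 i)
    then show ?case using m[OF step1(2) x(1)] by (simp add: gam_mult)
  next
    case (step2 i)
    then show ?case using m[OF step2(2) x(2)] by (simp add: gam_mult)
  qed (rule one)
  have Y: "(0, 0, 0, j, 0) \<in> H" for j
  proof (induction j rule: int_induct[where k = 0])
    case (step1 i)
    then show ?case using m[OF step1(2) y(1)] by (simp add: gam_mult)
  next
    case (step2 i)
    then show ?case using m[OF step2(2) y(2)] by (simp add: gam_mult)
  qed (rule one)
  have W: "(0, 0, 0, 0, r) \<in> H" for r
  proof (induction r rule: int_induct[where k = 0])
    case (step1 i)
    then show ?case using m[OF step1(2) w(1)] by (simp add: gam_mult)
  next
    case (step2 i)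
    then show ?case using m[OF step2(2) w(2)] by (simp add: gam_mult)
  qed (rule one)
  have Q: "(0, 0, i, j, r) \<in> H" for i j r
    using m[OF m[OF X Y] W, of i j r] by (simp add: gam_mult)
  have diff: "(f - f', g - g', 0, 0, 0) \<in> H" if "(f, g, 0, 0, 0) \<in> H" "(f', g', 0, 0, 0) \<in> H" for f g f' g'
    using m[OF that(1) inv[OF that(2)]] subgroup.mem_carrier[OF H that(2)] by (simp add: gam_mult gam_inv[OF e])
  have act: "(chi i j * f, chi i j * g, 0, 0, 0) \<in> H" if "(f, g, 0, 0, 0) \<in> H" for f g i j
    using m[OF m[OF Q[of i j 0] that] Q[of "-i" "-j" 0]] by (simp add: gam_mult)
  have mod: "(c * f, c * g, 0, 0, 0) \<in> H" if c: "c \<in> BR" and fg: "(f, g, 0, 0, 0) \<in> H" for c f g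
    using c
  proof induction
    case (BR_diff c d)
    then show ?case using diff[OF BR_diff(3,4)] by (simp only: left_diff_distrib)
  qed (rule act[OF fg])
  have "carrier (gam e) \<subseteq> H"
  proof
    fix a assume "a \<in> carrier (gam e)"
    then obtain f g i j r where a: "a = (f, g, i, j, r)" "f \<in> BR" "g \<in> BR" "f - e * g \<in> phiB"
      by (rule gam_mem_E)
    obtain c where c: "c \<in> BR" "f - e * g = phi * c" using a(4) by (rule phiB_E)
    have "(c * phi, c * 0, 0, 0, 0) \<in> H" by (rule mod[OF c(1)]) (rule gen, simp)
    moreover have "(g * e, g * 1, 0, 0, 0) \<in> H" by (rule mod[OF a(3)]) (rule gen, simp)
    ultimately have "(c * phi, c * 0, 0, 0, 0) \<otimes>\<^bsub>gam e\<^esub> (g * e, g * 1, 0, 0, 0) \<otimes>\<^bsub>gam e\<^esub> (0, 0, i, j, r) \<in> H"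
      using m Q by blast
    moreover have "(c * phi, c * 0, 0, 0, 0) \<otimes>\<^bsub>gam e\<^esub> (g * e, g * 1, 0, 0, 0) \<otimes>\<^bsub>gam e\<^esub> (0, 0, i, j, r) = a"
      using c(2) by (simp add: gam_mult a(1) algebra_simps)
    ultimately show "a \<in> H" by simp
  qed
  then show ?thesis using subgroup.subset[OF H] unfolding H_def by blast
qed

lemma finitely_generated_gam:
  assumes e: "e \<in> BR"
  shows "finitely_generated (gam e)"
  unfolding finitely_generated_def
proof (intro conjI exI)
  show "group (gam e)" by (rule group_gam[OF e])
  interpret group "gam e" by (rule group_gam[OF e])
  let ?S = "{(phi, 0, 0, 0, 0), (e, 1, 0, 0, 0), (0, 0, 1, 0, 0), (0, 0, 0, 1, 0), (0, 0, 0, 0, 1)} :: gelt set"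
  show "generate (gam e) ?S = carrier (gam e)" by (rule generate_gam[OF e])
  then show "?S \<subseteq> carrier (gam e)" using generate.incl[of _ ?S "gam e"] by blast
  show "finite ?S" by simp
qed

section \<open>Residual finiteness by reduction modulo primes\<close>

definition localized_ints :: "nat \<Rightarrow> complex set"
  where "localized_ints m = {z. \<exists>k. z * of_nat m ^ k \<in> \<int>}"

lemma localized_common:
  assumes "z * of_nat m ^ k \<in> \<int>"
  shows "z * of_nat m ^ (k + l) \<in> (\<int> :: complex set)"
proof -
  have "z * of_nat m ^ (k + l) = z * of_nat m ^ k * of_nat (m ^ l)" by (simp add: power_add)
  then show ?thesis using assms by (metis Ints_mult Ints_of_nat)
qed

lemma localized_diff: "z \<in> localized_ints m \<Longrightarrow> w \<in> localized_ints m \<Longrightarrow> z - w \<in> localized_ints m"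
proof -
  assume "z \<in> localized_ints m" "w \<in> localized_ints m"
  then obtain k l where "z * of_nat m ^ k \<in> \<int>" "w * of_nat m ^ l \<in> \<int>" by (auto simp: localized_ints_def)
  then have "z * of_nat m ^ (k + l) - w * of_nat m ^ (k + l) \<in> \<int>"
    using localized_common[of z m k l] localized_common[of w m l k] by (simp add: add.commute)
  then show ?thesis by (auto simp: localized_ints_def left_diff_distrib)
qed

lemma localized_mult: "z \<in> localized_ints m \<Longrightarrow> w \<in> localized_ints m \<Longrightarrow> z * w \<in> localized_ints m"
proof -
  assume "z \<in> localized_ints m" "w \<in> localized_ints m"
  then obtain k l where "z * of_nat m ^ k \<in> \<int>" "w * of_nat m ^ l \<in> \<int>" by (auto simp: localized_ints_def)
  then have "(z * of_nat m ^ k) * (w * of_nat m ^ l) \<in> \<int>" by (rule Ints_mult)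
  then have "z * w * of_nat m ^ (k + l) \<in> \<int>" by (simp add: power_add mult_ac)
  then show ?thesis by (auto simp: localized_ints_def)
qed

lemma localized_of_int: "of_int a \<in> localized_ints m"
  by (auto simp: localized_ints_def intro!: exI[of _ 0])

text \<open>The inverse of \<open>m^k\<close> modulo \<open>p\<close> turns a fraction into a
  residue, so 0, ..., \<open>p - 1\<close> represent all classes of \<open>Z[1/m]\<close> modulo
  \<open>p\<close>.\<close>

lemma localized_residue:
  assumes p: "prime p" "\<not> p dvd m" and z: "z \<in> localized_ints m"
  shows "\<exists>t<p. \<exists>d\<in>localized_ints m. z - of_nat t = of_nat p * d"
proof -
  obtain k where "z * of_nat m ^ k \<in> \<int>" using z by (auto simp: localized_ints_def)
  then obtain a where a: "z * of_nat m ^ k = of_int a" by (auto elim: Ints_cases)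
  have m0: "m \<noteq> 0" using p(2) by (metis dvd_0_right)
  have "coprime (int m ^ k) (int p)"
    using prime_imp_coprime[OF p] by (simp add: coprime_commute)
  then obtain u v where uv: "u * int m ^ k + v * int p = 1" by (metis bezout_int coprime_iff_gcd_eq_1)
  define t where "t = nat ((a * u) mod int p)"
  have p0: "p > 0" using p(1) prime_gt_0_nat by blast
  have t: "int t = (a * u) mod int p" using p0 by (simp add: t_def)
  then have "a * u = int t + int p * (a * u div int p)" by (simp add: minus_mult_div_eq_mod)
  then have "a * u * int m ^ k = int t * int m ^ k + int p * ((a * u div int p) * int m ^ k)"
    by (metis distrib_right mult.assoc)
  moreover have "a - a * u * int m ^ k = int p * (a * v)"
  proof -
    have "a - a * u * int m ^ k = a * (1 - u * int m ^ k)" by (simp add: algebra_simps)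
    also have "1 - u * int m ^ k = v * int p" using uv by simp
    finally show ?thesis by (simp add: mult_ac)
  qed
  ultimately have "a - int t * int m ^ k = int p * (a * v + (a * u div int p) * int m ^ k)"
    by (simp add: algebra_simps)
  then obtain c where c: "a - int t * int m ^ k = int p * c" by blast
  let ?d = "of_int c / of_nat m ^ k :: complex"
  have "?d \<in> localized_ints m" using m0 by (auto simp: localized_ints_def intro!: exI[of _ k])
  moreover have "z - of_nat t = of_nat p * ?d"
  proof -
    have "(z - of_nat t) * of_nat m ^ k = of_int (a - int t * int m ^ k)" using a by (simp add: left_diff_distrib)
    then have "(z - of_nat t) * of_nat m ^ k = of_nat p * of_int c" unfolding c by simp
    then show ?thesis using m0 by (simp add: field_simps)
  qed
  moreover have "t < p" using t p0 by (metis of_nat_less_iff pos_mod_bound of_nat_0_less_iff)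
  ultimately show ?thesis by blast
qed

lemma localized_not_divisible:
  assumes p: "prime p" "\<not> p dvd m" and z: "z * of_nat m ^ k = of_int a" "\<not> int p dvd a"
    and d: "d \<in> localized_ints m"
  shows "z \<noteq> of_nat p * d"
proof
  assume eq: "z = of_nat p * d"
  obtain l where "d * of_nat m ^ l \<in> \<int>" using d by (auto simp: localized_ints_def)
  then obtain b where b: "d * of_nat m ^ l = of_int b" by (auto elim: Ints_cases)
  have "of_int (a * int m ^ l) = z * of_nat m ^ k * of_nat m ^ l" by (simp add: z(1))
  also have "\<dots> = of_nat p * (d * of_nat m ^ l) * of_nat m ^ k" by (simp add: eq mult_ac)
  also have "\<dots> = of_int (int p * b * int m ^ k)" unfolding b by simp
  finally have "a * int m ^ l = int p * b * int m ^ k" by (simp only: of_int_eq_iff)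
  then have "int p dvd a * int m ^ l" by (metis dvd_triv_left mult.assoc)
  moreover have pp: "prime (int p)" using p(1) by simp
  ultimately have "int p dvd int m" using z(2) by (meson prime_dvd_mult_iff prime_dvd_power)
  then show False using p(2) by simp
qed

text \<open>
  A crossed homomorphism with values in \<open>\<int>[1/m]\<close> can be reduced modulo a prime not dividing \<open>m\<close>.
\<close>

lemma affine_separation:
  fixes F \<kappa> :: "'a \<Rightarrow> complex"
  assumes G: "group G" and m: "m > 0"
    and F: "\<And>g. g \<in> carrier G \<Longrightarrow> F g \<in> localized_ints m" and \<kappa>: "\<And>g. g \<in> carrier G \<Longrightarrow> \<kappa> g \<in> localized_ints m"
    and F_mult: "\<And>g h. g \<in> carrier G \<Longrightarrow> h \<in> carrier G \<Longrightarrow> F (g \<otimes>\<^bsub>G\<^esub> h) = F g + \<kappa> g * F h"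
    and \<kappa>_mult: "\<And>g h. g \<in> carrier G \<Longrightarrow> h \<in> carrier G \<Longrightarrow> \<kappa> (g \<otimes>\<^bsub>G\<^esub> h) = \<kappa> g * \<kappa> h"
    and \<kappa>_nz: "\<And>g. g \<in> carrier G \<Longrightarrow> \<kappa> g \<noteq> 0"
    and x: "x \<in> carrier G" "F x \<noteq> 0"
  shows "\<exists>N\<in>finite_index_normal G. x \<notin> N"
proof -
  interpret group G by (rule G)
  obtain k where "F x * of_nat m ^ k \<in> \<int>" using F[OF x(1)] by (auto simp: localized_ints_def)
  then obtain a where a: "F x * of_nat m ^ k = of_int a" by (auto elim: Ints_cases)
  have a0: "a \<noteq> 0" using a x(2) m by auto
  \<comment> \<open>Larger than \<open>m\<close> and than the numerator of \<open>F x\<close>, so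
    that \<open>p\<close> divides neither.\<close>
  obtain p where p: "prime p" "p > max m (nat \<bar>a\<bar>)" using bigger_prime by blast
  have pm: "\<not> p dvd m" using p(2) m by (auto dest: dvd_imp_le)
  have pa: "\<not> int p dvd a" using p(2) a0 zdvd_imp_le[of "int p" "\<bar>a\<bar>"] by auto
  define I where "I = (\<lambda>d. of_nat p * d) ` localized_ints m"
  have I_diff: "z - w \<in> I" if "z \<in> I" "w \<in> I" for z w
    using that localized_diff unfolding I_def by (auto simp flip: right_diff_distrib)
  have I_mult: "d * z \<in> I" if "d \<in> localized_ints m" "z \<in> I" for z d
    using that localized_mult unfolding I_def by (auto simp: mult.left_commute)
  have I_0: "0 \<in> I" using localized_of_int[of 0 m] unfolding I_def by force
  have I_uminus: "- z \<in> I" if "z \<in> I" for z using I_diff[OF I_0 that] by simp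
  have I_add: "z + w \<in> I" if "z \<in> I" "w \<in> I" for z w using I_diff[OF that(1) I_uminus[OF that(2)]] by simp
  have \<kappa>1: "\<kappa> \<one>\<^bsub>G\<^esub> = 1" using \<kappa>_mult[of "\<one>\<^bsub>G\<^esub>" "\<one>\<^bsub>G\<^esub>"] \<kappa>_nz[of "\<one>\<^bsub>G\<^esub>"] by simp
  have F1: "F \<one>\<^bsub>G\<^esub> = 0" using F_mult[of "\<one>\<^bsub>G\<^esub>" "\<one>\<^bsub>G\<^esub>"] \<kappa>1 by simp
  have \<kappa>inv: "\<kappa> g * \<kappa> (inv\<^bsub>G\<^esub> g) = 1" if "g \<in> carrier G" for g
    using \<kappa>_mult[OF that inv_closed[OF that]] that \<kappa>1 by simp
  have Finv: "F (inv\<^bsub>G\<^esub> g) = - \<kappa> (inv\<^bsub>G\<^esub> g) * F g" if "g \<in> carrier G" for g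
    using F_mult[OF inv_closed[OF that] that] that F1 by (simp add: eq_neg_iff_add_eq_0)
  \<comment> \<open>The elements that act trivially on \<open>Z[1/m]\<close> modulo \<open>p\<close>
    through the affine maps \<open>z \<mapsto> F g + \<kappa> g z\<close>.\<close>
  define N where "N = {g \<in> carrier G. F g \<in> I \<and> \<kappa> g - 1 \<in> I}"
  have "subgroup N G"
  proof (rule subgroupI)
    show "N \<subseteq> carrier G" by (auto simp: N_def)
    have "\<one>\<^bsub>G\<^esub> \<in> N" using F1 \<kappa>1 I_0 by (simp add: N_def)
    then show "N \<noteq> {}" by blast
    show "inv\<^bsub>G\<^esub> g \<in> N" if "g \<in> N" for g
    proof -
      have g: "g \<in> carrier G" "F g \<in> I" "\<kappa> g - 1 \<in> I" using that by (auto simp: N_def)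
      have "F (inv\<^bsub>G\<^esub> g) = - (\<kappa> (inv\<^bsub>G\<^esub> g) * F g)" using Finv[OF g(1)] by simp
      moreover have "\<kappa> (inv\<^bsub>G\<^esub> g) - 1 = - (\<kappa> (inv\<^bsub>G\<^esub> g) * (\<kappa> g - 1))"
        using \<kappa>inv[OF g(1)] by (simp add: algebra_simps)
      ultimately show ?thesis
        using g I_uminus I_mult \<kappa>[OF inv_closed[OF g(1)]] by (simp add: N_def)
    qed
    show "g \<otimes>\<^bsub>G\<^esub> h \<in> N" if "g \<in> N" "h \<in> N" for g h
    proof -
      have g: "g \<in> carrier G" "F g \<in> I" "\<kappa> g - 1 \<in> I" using that by (auto simp: N_def)
      have h: "h \<in> carrier G" "F h \<in> I" "\<kappa> h - 1 \<in> I" using that by (auto simp: N_def)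
      have "\<kappa> (g \<otimes>\<^bsub>G\<^esub> h) - 1 = \<kappa> g * (\<kappa> h - 1) + (\<kappa> g - 1)"
        using \<kappa>_mult g h by (simp add: algebra_simps)
      then have "\<kappa> (g \<otimes>\<^bsub>G\<^esub> h) - 1 \<in> I" using I_add[OF I_mult[OF \<kappa>[OF g(1)] h(3)] g(3)] by (simp only:)
      then show ?thesis using g h I_add I_mult \<kappa> F_mult by (simp add: N_def)
    qed
  qed
  moreover have "g \<otimes>\<^bsub>G\<^esub> h \<otimes>\<^bsub>G\<^esub> inv\<^bsub>G\<^esub> g \<in> N" if g: "g \<in> carrier G" and "h \<in> N" for g h
  proof -
    have h: "h \<in> carrier G" "F h \<in> I" "\<kappa> h - 1 \<in> I" using \<open>h \<in> N\<close> by (auto simp: N_def)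
    have "F (g \<otimes>\<^bsub>G\<^esub> h \<otimes>\<^bsub>G\<^esub> inv\<^bsub>G\<^esub> g) = F g + \<kappa> g * F h - \<kappa> h * (\<kappa> g * \<kappa> (inv\<^bsub>G\<^esub> g)) * F g"
      using g h by (simp add: F_mult \<kappa>_mult Finv algebra_simps)
    then have "F (g \<otimes>\<^bsub>G\<^esub> h \<otimes>\<^bsub>G\<^esub> inv\<^bsub>G\<^esub> g) = \<kappa> g * F h - F g * (\<kappa> h - 1)"
      by (simp add: \<kappa>inv[OF g] algebra_simps)
    moreover have "\<kappa> (g \<otimes>\<^bsub>G\<^esub> h \<otimes>\<^bsub>G\<^esub> inv\<^bsub>G\<^esub> g) = \<kappa> h * (\<kappa> g * \<kappa> (inv\<^bsub>G\<^esub> g))"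
      using g h by (simp add: \<kappa>_mult)
    ultimately show ?thesis
      using g h I_diff I_mult F \<kappa> by (simp add: N_def \<kappa>inv)
  qed
  ultimately have N: "N \<lhd> G" by (simp add: normal_inv_iff)
  define res where "res = (\<lambda>z. SOME t. t < p \<and> z - of_nat t \<in> I)"
  have res: "res z < p \<and> z - of_nat (res z) \<in> I" if "z \<in> localized_ints m" for z
  proof -
    have "\<exists>t. t < p \<and> z - of_nat t \<in> I" using localized_residue[OF p(1) pm that] by (auto simp: I_def)
    then show ?thesis unfolding res_def by (rule someI_ex)
  qed
  have res_eq: "z - w \<in> I" if "z \<in> localized_ints m" "w \<in> localized_ints m" "res z = res w" for z w
    using I_diff[of "z - of_nat (res z)" "w - of_nat (res w)"] res[OF that(1)] res[OF that(2)] that(3) by simp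
  have "N \<in> finite_index_normal G"
  proof (rule finite_index_normalI[OF N])
    show "finite ((\<lambda>g. (res (F g), res (\<kappa> g))) ` carrier G)"
      by (rule finite_subset[of _ "{..<p} \<times> {..<p}"]) (use res F \<kappa> in auto)
    fix g h assume g: "g \<in> carrier G" and h: "h \<in> carrier G"
      and "(res (F g), res (\<kappa> g)) = (res (F h), res (\<kappa> h))"
    then have Fgh: "F g - F h \<in> I" and \<kappa>gh: "\<kappa> g - \<kappa> h \<in> I" using res_eq F \<kappa> by auto
    let ?u = "\<kappa> (inv\<^bsub>G\<^esub> h)"
    have u: "?u \<in> localized_ints m" using \<kappa> h by simp
    have "\<kappa> (g \<otimes>\<^bsub>G\<^esub> inv\<^bsub>G\<^esub> h) - 1 = ?u * (\<kappa> g - \<kappa> h)"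
      using g h \<kappa>inv[OF h] by (simp add: \<kappa>_mult algebra_simps)
    then have 1: "\<kappa> (g \<otimes>\<^bsub>G\<^esub> inv\<^bsub>G\<^esub> h) - 1 \<in> I" using I_mult[OF u \<kappa>gh] by simp
    have "F (g \<otimes>\<^bsub>G\<^esub> inv\<^bsub>G\<^esub> h) = (F g - F h) - F h * (\<kappa> (g \<otimes>\<^bsub>G\<^esub> inv\<^bsub>G\<^esub> h) - 1)"
      using g h by (simp add: F_mult \<kappa>_mult Finv algebra_simps)
    then have "F (g \<otimes>\<^bsub>G\<^esub> inv\<^bsub>G\<^esub> h) \<in> I" using I_diff[OF Fgh I_mult[OF F[OF h] 1]] by simp
    then show "g \<otimes>\<^bsub>G\<^esub> inv\<^bsub>G\<^esub> h \<in> N" using 1 g h by (simp add: N_def)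
  qed
  moreover have "x \<notin> N"
    using localized_not_divisible[OF p(1) pm a pa] by (auto simp: N_def I_def)
  ultimately show ?thesis by blast
qed

lemma BR_localized:
  assumes "f \<in> BR" "n > 0"
  shows "f n \<in> localized_ints (n * Suc n)"
  using assms(1)
proof induction
  case (BR_chi i j)
  define k where "k = nat \<bar>i\<bar> + nat \<bar>j\<bar>"
  have n: "pt n = of_nat n" "1 + pt n = of_nat (Suc n)" using assms(2) by (auto simp: pt_def)
  have "chi i j n * of_nat (n * Suc n) ^ k = chi i j n * (pt n * (1 + pt n)) ^ k"
    unfolding n(2) unfolding n(1) by (simp add: distrib_left)
  also have "\<dots> = pt n powi (i + int k) * (1 + pt n) powi (j + int k)"
    by (simp add: chi_def power_int_add power_mult_distrib)
  also have "\<dots> = pt n ^ nat (i + int k) * (1 + pt n) ^ nat (j + int k)"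
    by (simp add: power_int_def k_def)
  also have "\<dots> = of_nat (n ^ nat (i + int k) * Suc n ^ nat (j + int k))"
    unfolding n(2) unfolding n(1) by simp
  also have "\<dots> \<in> \<int>" by (rule Ints_of_nat)
  finally show ?case by (auto simp: localized_ints_def)
next
  case (BR_diff f g)
  then show ?case using localized_diff by simp
qed

text \<open>A nontrivial element has a nonzero coordinate. The values of the first two coordinates
  at a positive integer \<open>n\<close> are crossed homomorphisms into
  \<open>Z[1/(n (n + 1))]\<close>; the other three are homomorphisms to the integers, treated with
  the trivial character.\<close>

lemma residually_finite_gam:
  assumes e: "e \<in> BR"
  shows "residually_finite (gam e)"
  unfolding residually_finite_def
proof (intro conjI ballI impI)
  show G: "group (gam e)" by (rule group_gam[OF e])
  fix a assume a: "a \<in> carrier (gam e)" and "a \<noteq> \<one>\<^bsub>gam e\<^esub>"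
  obtain f g i j r where fg: "a = (f, g, i, j, r)" "f \<in> BR" "g \<in> BR" using a by (rule gam_mem_E)
  consider "f \<noteq> 0" | "g \<noteq> 0" | "i \<noteq> 0" | "j \<noteq> 0" | "r \<noteq> 0"
    using \<open>a \<noteq> \<one>\<^bsub>gam e\<^esub>\<close> fg(1) gam_one by metis
  then show "\<exists>N\<in>finite_index_normal (gam e). a \<notin> N"
  proof cases
    case 1
    \<comment> \<open>Index 0 is excluded because it stands for \<i>, where the values need not be
      rational.\<close>
    then obtain n where n: "n \<ge> 1" "f n \<noteq> 0" using BR_nonzero[OF fg(2)] by blast
    show ?thesis
    proof (rule affine_separation[OF G, of "n * Suc n" "\<lambda>(f, g, i, j, r). f n" "\<lambda>(f, g, i, j, r). chi i j n"])
      show "(case a of (f, g, i, j, r) \<Rightarrow> f n) \<noteq> 0" using n fg by simp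
    qed (use n a BR_localized BR_chi in \<open>auto elim!: gam_mem_E simp: gam_mult simp flip: chi_mult\<close>)
  next
    case 2
    then obtain n where n: "n \<ge> 1" "g n \<noteq> 0" using BR_nonzero[OF fg(3)] by blast
    show ?thesis
    proof (rule affine_separation[OF G, of "n * Suc n" "\<lambda>(f, g, i, j, r). g n" "\<lambda>(f, g, i, j, r). chi (i + 4 * r) j n"])
      show "(case a of (f, g, i, j, r) \<Rightarrow> g n) \<noteq> 0" using n fg by simp
      fix a b assume "a \<in> carrier (gam e)" "b \<in> carrier (gam e)"
      show "(case a \<otimes>\<^bsub>gam e\<^esub> b of (f, g, i, j, r) \<Rightarrow> chi (i + 4 * r) j n) =
          (case a of (f, g, i, j, r) \<Rightarrow> chi (i + 4 * r) j n) * (case b of (f, g, i, j, r) \<Rightarrow> chi (i + 4 * r) j n)"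
        by (cases a; cases b) (simp add: gam_mult chi_def power_int_add distrib_left mult_ac)
    qed (use n a BR_localized BR_chi in \<open>auto elim!: gam_mem_E simp: gam_mult\<close>)
  next
    case 3
    show ?thesis
      by (rule affine_separation[OF G, of 1 "\<lambda>(f, g, i, j, r). of_int i" "\<lambda>_. 1"])
        (use 3 fg a localized_of_int[of 1 1] localized_of_int[of _ 1] in \<open>auto elim!: gam_mem_E simp: gam_mult\<close>)
  next
    case 4
    show ?thesis
      by (rule affine_separation[OF G, of 1 "\<lambda>(f, g, i, j, r). of_int j" "\<lambda>_. 1"])
        (use 4 fg a localized_of_int[of 1 1] localized_of_int[of _ 1] in \<open>auto elim!: gam_mem_E simp: gam_mult\<close>)
  next
    case 5
    show ?thesis
      by (rule affine_separation[OF G, of 1 "\<lambda>(f, g, i, j, r). of_int r" "\<lambda>_. 1"])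
        (use 5 fg a localized_of_int[of 1 1] localized_of_int[of _ 1] in \<open>auto elim!: gam_mem_E simp: gam_mult\<close>)
  qed
qed

section \<open>Profinite completions of the groups\<close>

definition scale :: "(nat \<Rightarrow> complex) \<Rightarrow> gelt \<Rightarrow> gelt"
  where "scale c = (\<lambda>(f, g, i, j, r). (c * f, g, i, j, r))"

lemma scale_simp: "scale c (f, g, i, j, r) = (c * f, g, i, j, r)"
  by (simp add: scale_def)

text \<open>Multiplying the first coordinate by \<open>c\<close> turns the parameter
  \<open>e\<close> into \<open>c e\<close>, and the module depends on the parameter only modulo
  \<phi>.\<close>

lemma scale_hom:
  assumes "e \<in> BR" "c \<in> BR" "c * e - e' \<in> phiB"
  shows "scale c \<in> hom (gam e) (gam e')"
proof (rule homI)
  fix a assume "a \<in> carrier (gam e)"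
  then obtain f g i j r where a: "a = (f, g, i, j, r)" "f \<in> BR" "g \<in> BR" "f - e * g \<in> phiB"
    by (rule gam_mem_E)
  have "c * f - e' * g = c * (f - e * g) + (c * e - e') * g" by (simp add: algebra_simps)
  then show "scale c a \<in> carrier (gam e')"
    using assms a by (simp only: scale_simp gam_carrier phiB_closed BR_closed)
  fix b
  show "scale c (a \<otimes>\<^bsub>gam e\<^esub> b) = scale c a \<otimes>\<^bsub>gam e'\<^esub> scale c b"
    by (cases a; cases b) (simp add: scale_def gam_mult algebra_simps)
qed

text \<open>For a normal subgroup \<open>N\<close>, the largest ideal that lies in \<open>N\<close>
  when placed in the first coordinate; a pair \<open>(z, 0)\<close> belongs to the module exactly
  when \<phi> divides \<open>z\<close>.\<close>

definition mod_ideal :: "gelt set \<Rightarrow> (nat \<Rightarrow> complex) set"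
  where "mod_ideal N = {z \<in> phiB. \<forall>c\<in>BR. (z * c, 0, 0, 0, 0) \<in> N}"

context
  fixes e N
  assumes e: "e \<in> BR" and N: "N \<lhd> gam e"
begin

lemma phiB_gam: "z \<in> phiB \<Longrightarrow> (z, 0, 0, 0, 0) \<in> carrier (gam e)"
  unfolding gam_carrier using phiB_BR by (simp only: mult_zero_right diff_0_right BR_closed simp_thms)

lemma normal_diff:
  assumes "(z, 0, 0, 0, 0) \<in> N" "(z', 0, 0, 0, 0) \<in> N"
  shows "(z - z', 0, 0, 0, 0) \<in> N"
proof -
  interpret N: normal N "gam e" by (rule N)
  have "(z, 0, 0, 0, 0) \<otimes>\<^bsub>gam e\<^esub> inv\<^bsub>gam e\<^esub> (z', 0, 0, 0, 0) \<in> N"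
    using assms subgroup.m_closed[OF N.subgroup_axioms] subgroup.m_inv_closed[OF N.subgroup_axioms] by blast
  then show ?thesis using N.mem_carrier[OF assms(2)] by (simp add: gam_mult gam_inv[OF e])
qed

text \<open>Conjugation by \<open>x^i y^j\<close> is multiplication by a monomial, so a normal
  subgroup meets the first axis in an ideal.\<close>

lemma normal_module:
  assumes z: "(z, 0, 0, 0, 0) \<in> N" and c: "c \<in> BR"
  shows "(z * c, 0, 0, 0, 0) \<in> N"
  using c
proof induction
  case (BR_chi i j)
  interpret N: normal N "gam e" by (rule N)
  have q: "(0, 0, i, j, 0) \<in> carrier (gam e)"
    unfolding gam_carrier by (simp only: mult_zero_right diff_self BR_closed phiB_closed)
  have "(0, 0, i, j, 0) \<otimes>\<^bsub>gam e\<^esub> (z, 0, 0, 0, 0) \<otimes>\<^bsub>gam e\<^esub> inv\<^bsub>gam e\<^esub> (0, 0, i, j, 0) =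
      (z * chi i j, 0, 0, 0, 0)"
    using q by (simp add: gam_mult gam_inv[OF e] mult.commute)
  then show ?case using N.inv_op_closed2[OF q z] by (simp only:)
next
  case (BR_diff c d)
  then show ?case using normal_diff by (simp only: right_diff_distrib)
qed

lemma mod_idealI: "z \<in> phiB \<Longrightarrow> (z, 0, 0, 0, 0) \<in> N \<Longrightarrow> z \<in> mod_ideal N"
  using normal_module by (simp add: mod_ideal_def)

lemma mod_ideal_diff: "z \<in> mod_ideal N \<Longrightarrow> z' \<in> mod_ideal N \<Longrightarrow> z - z' \<in> mod_ideal N"
  using normal_diff phiB_diff by (auto simp only: mod_ideal_def left_diff_distrib mem_Collect_eq)

lemma mod_ideal_mult:
  assumes "c \<in> BR" "z \<in> mod_ideal N"
  shows "c * z \<in> mod_ideal N"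
proof -
  have "c * z * d = z * (c * d)" for d by (simp only: mult_ac)
  then show ?thesis using assms phiB_mult BR_mult by (auto simp only: mod_ideal_def mem_Collect_eq)
qed

lemma mod_ideal_0: "0 \<in> mod_ideal N"
proof -
  have "\<one>\<^bsub>gam e\<^esub> \<in> N" using subgroup.one_closed[OF normal_imp_subgroup[OF N]] .
  then show ?thesis by (intro mod_idealI) (simp_all only: gam_one phiB_0)
qed

lemma mod_ideal_add: "z \<in> mod_ideal N \<Longrightarrow> z' \<in> mod_ideal N \<Longrightarrow> z + z' \<in> mod_ideal N"
  using mod_ideal_diff[OF _ mod_ideal_diff[OF mod_ideal_0], of z z'] by (simp only: diff_0 diff_minus_eq_add)

lemma mod_ideal_sum: "(\<And>i. i \<in> A \<Longrightarrow> z i \<in> mod_ideal N) \<Longrightarrow> sum z A \<in> mod_ideal N"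
proof (induction A rule: infinite_finite_induct)
  case (insert x A)
  then show ?case unfolding sum.insert[OF insert.hyps] by (intro mod_ideal_add) auto
qed (use mod_ideal_0 in \<open>simp_all only: sum.infinite sum.empty not_False_eq_True\<close>)

text \<open>The images of \<open>a\<close> under two scalings differ by an element of the first
  axis, so modulo \<open>N\<close> only the class of the factor counts.\<close>

lemma scale_coset:
  assumes c: "scale c a \<in> carrier (gam e)" "scale c' a \<in> carrier (gam e)"
    and a: "a \<in> carrier (gam e')" and cc: "c - c' \<in> mod_ideal N"
  shows "N #>\<^bsub>gam e\<^esub> scale c a = N #>\<^bsub>gam e\<^esub> scale c' a"
proof -
  obtain f g i j r where fg: "a = (f, g, i, j, r)" "f \<in> BR" using a by (rule gam_mem_E)
  have "scale c a \<otimes>\<^bsub>gam e\<^esub> inv\<^bsub>gam e\<^esub> scale c' a = ((c - c') * f, 0, 0, 0, 0)"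
    using c(2) unfolding fg(1) scale_simp
    by (simp add: gam_inv[OF e] gam_mult mult.assoc[symmetric] chi_mult left_diff_distrib)
  moreover have "((c - c') * f, 0, 0, 0, 0) \<in> N" using cc fg(2) by (simp add: mod_ideal_def)
  ultimately show ?thesis using rcos_eq_iff[OF N c] by simp
qed

lemma geometric_factor:
  assumes "d dvd n"
  shows "\<exists>s\<in>BR. 1 - phi ^ n = (1 - phi ^ d) * s"
proof -
  obtain q where q: "n = d * q" using assms by blast
  have "1 - (phi ^ d) ^ q = (1 - phi ^ d) * (\<Sum>k<q. (phi ^ d) ^ k)" by (rule one_diff_power_eq)
  then show ?thesis
    unfolding q power_mult by (intro bexI[of _ "\<Sum>k<q. (phi ^ d) ^ k"] BR_sum BR_power phi_BR)
qed

text \<open>By the pigeonhole principle two of the elements \<open>(\<phi>^(i+1), 0)\<close> share a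
  coset, which gives a preperiod and a period \<open>d\<close> of the powers of \<phi>. Factorials
  serve as exponents because \<open>n!\<close> is divisible by \<open>d\<close> as soon as
  \<open>n \<ge> d\<close>.\<close>

lemma phi_eventually_idempotent:
  assumes "finite (rcosets\<^bsub>gam e\<^esub> N)"
  shows "\<exists>n0. \<forall>m\<ge>n0. \<forall>n\<ge>n0. phi ^ m * (1 - phi ^ fact n) \<in> mod_ideal N"
proof -
  interpret N: normal N "gam e" by (rule N)
  \<comment> \<open>Exponents start at 1, since \<open>(z, 0)\<close> lies in the module only for
    multiples \<open>z\<close> of \<phi>.\<close>
  define v where "v = (\<lambda>i. (phi ^ Suc i, 0, 0, 0, 0) :: gelt)"
  have phiB: "phi ^ Suc i \<in> phiB" for i unfolding power_Suc by (intro phiB_I BR_power phi_BR)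
  have v: "v i \<in> carrier (gam e)" for i unfolding v_def by (rule phiB_gam[OF phiB])
  have "finite (range (\<lambda>i. N #>\<^bsub>gam e\<^esub> v i))"
    by (rule finite_subset[OF _ assms]) (use v in \<open>auto simp: RCOSETS_def\<close>)
  then obtain i j where ij: "i < j" "N #>\<^bsub>gam e\<^esub> v i = N #>\<^bsub>gam e\<^esub> v j"
    by (metis (mono_tags, lifting) finite_imageD infinite_UNIV_nat injI nat_neq_iff)
  define d where "d = j - i"
  have "v i \<otimes>\<^bsub>gam e\<^esub> inv\<^bsub>gam e\<^esub> v j \<in> N" using rcos_eq_iff[OF N v v] ij(2) by blast
  then have "(phi ^ Suc i - phi ^ Suc j, 0, 0, 0, 0) \<in> N"
    using v[of j] unfolding v_def by (simp add: gam_inv[OF e] gam_mult)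
  then have z: "phi ^ Suc i - phi ^ Suc j \<in> mod_ideal N" by (intro mod_idealI phiB_diff phiB)
  have "Suc j = Suc i + d" using ij(1) by (simp add: d_def)
  then have z: "phi ^ Suc i * (1 - phi ^ d) \<in> mod_ideal N"
    using z by (simp only: power_add right_diff_distrib mult_1_right)
  have "phi ^ m * (1 - phi ^ fact n) \<in> mod_ideal N" if m: "m \<ge> max (Suc i) d" and n: "n \<ge> max (Suc i) d" for m n
  proof -
    have "d dvd fact n" using ij(1) n by (intro dvd_fact) (auto simp: d_def)
    then obtain s where s: "s \<in> BR" "1 - phi ^ fact n = (1 - phi ^ d) * s" using geometric_factor by blast
    have "m = (m - Suc i) + Suc i" using m by simp
    then have "phi ^ m = phi ^ (m - Suc i) * phi ^ Suc i" by (metis power_add)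
    then have "phi ^ m * (1 - phi ^ fact n) = (phi ^ (m - Suc i) * s) * (phi ^ Suc i * (1 - phi ^ d))"
      unfolding s(2) by (simp only: mult_ac)
    then show ?thesis using mod_ideal_mult[OF BR_mult[OF BR_power[OF phi_BR] s(1)] z] by (simp only:)
  qed
  then show ?thesis by blast
qed

text \<open>\<open>n! - n0!\<close> is a multiple of \<open>n0!\<close>, so the two powers differ by
  a multiple of \<open>\<phi>^(n0!) (1 - \<phi>^(n0!))\<close>.\<close>

lemma phi_fact_stable:
  assumes n0: "\<And>m n. m \<ge> n0 \<Longrightarrow> n \<ge> n0 \<Longrightarrow> phi ^ m * (1 - phi ^ fact n) \<in> mod_ideal N"
    and n: "n \<ge> n0"
  shows "phi ^ fact n0 - phi ^ fact n \<in> mod_ideal N"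
proof -
  have dv: "(fact n0 :: nat) dvd fact n" using n by (rule fact_dvd)
  have le: "(fact n0 :: nat) \<le> fact n" using n by (rule fact_mono)
  have "fact n0 dvd (fact n - fact n0 :: nat)" using dv by (simp add: dvd_diff_nat)
  then obtain s where s: "s \<in> BR" "1 - phi ^ (fact n - fact n0) = (1 - phi ^ fact n0) * s"
    using geometric_factor by blast
  have "phi ^ fact n = phi ^ fact n0 * phi ^ (fact n - fact n0)"
    using le by (simp flip: power_add)
  then have "phi ^ fact n0 - phi ^ fact n = phi ^ fact n0 * (1 - phi ^ (fact n - fact n0))"
    by (simp only: right_diff_distrib mult_1_right)
  also have "\<dots> = s * (phi ^ fact n0 * (1 - phi ^ fact n0))" unfolding s(2) by (simp only: mult_ac)
  finally show ?thesis using mod_ideal_mult[OF s(1) n0[OF fact_ge_self order_refl]] by (simp only:)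
qed

end

text \<open>
  If \<open>e\<close> is invertible modulo \<open>\<phi>\<close>, then in every finite quotient of the ring the elements
  \<open>unit_lift e n\<close> are eventually constant and equal to a unit which is congruent to \<open>e\<close> modulo
  \<open>\<phi>\<close>: they are \<open>e\<close> where \<open>\<phi>\<close> is nilpotent and \<open>1\<close> where \<open>\<phi>\<close> is invertible, since
  \<open>\<phi>^n!\<close> is eventually the idempotent which separates the two parts. Their inverses are given by
  \<open>unit_colift f h n\<close>, where \<open>e f = 1 - \<phi> h\<close>.
\<close>

definition unit_lift where
  "unit_lift e n = e + phi ^ fact n * (1 - e)"

definition unit_colift where
  "unit_colift f h n = f * (\<Sum>k\<le>n. (phi * h) ^ k) * (1 - phi ^ fact n) + phi ^ fact n"

lemma unit_lift_BR: "e \<in> BR \<Longrightarrow> unit_lift e n \<in> BR"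
  unfolding unit_lift_def by (intro BR_closed phi_BR)

lemma unit_colift_BR: "f \<in> BR \<Longrightarrow> h \<in> BR \<Longrightarrow> unit_colift f h n \<in> BR"
  unfolding unit_colift_def by (intro BR_closed phi_BR)

lemma phi_pow_phiB: "m > 0 \<Longrightarrow> phi ^ m \<in> phiB"
  by (cases m) (auto simp only: power_Suc intro!: phiB_I BR_power phi_BR)

lemma geometric_sum:
  "(1 - phi * h) * (\<Sum>k\<le>n. (phi * h) ^ k) = 1 - (phi * h) ^ Suc n"
  unfolding lessThan_Suc_atMost[symmetric] by (rule one_diff_power_eq[symmetric])

context
  fixes e f h
  assumes e: "e \<in> BR" and f: "f \<in> BR" and h: "h \<in> BR" and ef: "e * f = 1 - phi * h"
begin

lemma unit_lift_hom: "scale (unit_lift e n) \<in> hom (gam 1) (gam e)"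
proof (rule scale_hom[OF BR_1 unit_lift_BR[OF e]])
  have "unit_lift e n * 1 - e = phi ^ fact n * (1 - e)" by (simp add: unit_lift_def)
  then show "unit_lift e n * 1 - e \<in> phiB"
    using phi_pow_phiB[of "fact n"] e by (simp only: fact_gt_zero phiB_closed BR_closed)
qed

text \<open>Modulo \<phi> the scaling factor is \<open>f\<close>, the inverse of \<open>e\<close>,
  because only the first term of the geometric sum survives.\<close>

lemma unit_colift_hom: "scale (unit_colift f h n) \<in> hom (gam e) (gam 1)"
proof (rule scale_hom[OF e unit_colift_BR[OF f h]])
  let ?S = "\<Sum>k\<le>n. (phi * h) ^ k" and ?p = "phi ^ fact n"
  have "unit_colift f h n * e - 1 = (e * f) * ?S * (1 - ?p) + ?p * e - 1"
    unfolding unit_colift_def by (simp only: distrib_left distrib_right mult_ac)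
  also have "\<dots> = (1 - (phi * h) ^ Suc n) * (1 - ?p) + ?p * e - 1"
    unfolding ef geometric_sum ..
  also have "\<dots> = ?p * (e - 1) - phi ^ Suc n * (h ^ Suc n * (1 - ?p))"
    unfolding power_mult_distrib by (simp only: algebra_simps) simp
  finally have eq: "unit_colift f h n * e - 1 = ?p * (e - 1) - phi ^ Suc n * (h ^ Suc n * (1 - ?p))" .
  have "?p \<in> phiB" "phi ^ Suc n \<in> phiB" by (rule phi_pow_phiB, simp)+
  then show "unit_colift f h n * e - 1 \<in> phiB"
    unfolding eq using e h phi_BR by (intro phiB_closed BR_closed)
qed

context
  fixes e' N n0
  assumes e': "e' \<in> BR" and N: "N \<lhd> gam e'"
    and n0: "\<And>m n. m \<ge> n0 \<Longrightarrow> n \<ge> n0 \<Longrightarrow> phi ^ m * (1 - phi ^ fact n) \<in> mod_ideal N"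
begin

lemma unit_lift_stable:
  assumes "n \<ge> n0"
  shows "unit_lift e n - unit_lift e n0 \<in> mod_ideal N"
proof -
  have "unit_lift e n - unit_lift e n0 = (e - 1) * (phi ^ fact n0 - phi ^ fact n)"
    unfolding unit_lift_def by (simp add: algebra_simps)
  then show ?thesis
    using mod_ideal_mult[OF e' N BR_diff[OF e BR_1] phi_fact_stable[OF e' N n0 assms]] by simp
qed

lemma high_power: "m \<ge> n0 \<Longrightarrow> n \<ge> n0 \<Longrightarrow> (phi * h) ^ m * (1 - phi ^ fact n) \<in> mod_ideal N"
  using mod_ideal_mult[OF e' N BR_power[OF h] n0, of m n m] by (simp only: power_mult_distrib mult_ac)

lemma unit_colift_stable:
  assumes n: "n \<ge> n0"
  shows "unit_colift f h n - unit_colift f h n0 \<in> mod_ideal N"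
proof -
  let ?S = "\<lambda>n. \<Sum>k\<le>n. (phi * h) ^ k" and ?p = "\<lambda>n. phi ^ fact n"
  \<comment> \<open>The terms of the geometric sum beyond \<open>n0\<close>; modulo the ideal, the
    factor \<open>1 - \<phi>^(n!)\<close> kills each of them.\<close>
  let ?T = "\<Sum>k\<in>{n0<..n}. (phi * h) ^ k * (1 - ?p n)"
  have "{..n} = {..n0} \<union> {n0<..n}" "{..n0} \<inter> {n0<..n} = {}" using n by auto
  then have "?S n = ?S n0 + (\<Sum>k\<in>{n0<..n}. (phi * h) ^ k)" by (simp only: sum.union_disjoint finite_atMost finite_greaterThanAtMost)
  then have "unit_colift f h n - unit_colift f h n0 =
      f * ?T + f * ?S n0 * (?p n0 - ?p n) - (?p n0 - ?p n)"
  proof -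
    have "(f * (A + D) * (1 - p) + p) - (f * A * (1 - q) + q) = f * (D * (1 - p)) + f * A * (q - p) - (q - p)"
      for A D p q :: "nat \<Rightarrow> complex" by (simp add: algebra_simps)
    then show ?thesis
      unfolding unit_colift_def sum_distrib_right[symmetric] \<open>?S n = ?S n0 + (\<Sum>k\<in>{n0<..n}. (phi * h) ^ k)\<close> .
  qed
  moreover have "?T \<in> mod_ideal N"
    by (rule mod_ideal_sum[OF e' N]) (use high_power n in auto)
  moreover have "?p n0 - ?p n \<in> mod_ideal N" by (rule phi_fact_stable[OF e' N n0 n])
  moreover have "f * ?S n0 \<in> BR" using f h phi_BR by (intro BR_closed)
  ultimately show ?thesis
    using mod_ideal_add[OF e' N] mod_ideal_diff[OF e' N] mod_ideal_mult[OF e' N] f by (simp only:)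
qed

text \<open>Write \<open>p = \<phi>^(n!)\<close>, an idempotent modulo the ideal. Where
  \<open>p = 1\<close> both factors are 1; where \<open>p = 0\<close> high powers of \<phi> vanish,
  and the truncated geometric series inverts \<open>e f = 1 - \<phi> h\<close>.\<close>

lemma unit_lift_colift:
  assumes n: "n \<ge> n0"
  shows "unit_lift e n * unit_colift f h n - 1 \<in> mod_ideal N"
proof -
  let ?S = "\<Sum>k\<le>n. (phi * h) ^ k" and ?p = "phi ^ fact n"
  have "unit_lift e n * unit_colift f h n - 1 = (e * f) * ?S * (1 - ?p) + ?p * (1 - e) * f * ?S * (1 - ?p)
      + e * ?p + ?p * (1 - e) * ?p - 1"
    unfolding unit_lift_def unit_colift_def by (simp only: distrib_left distrib_right mult_ac add_ac)
  also have "(e * f) * ?S = 1 - (phi * h) ^ Suc n" unfolding ef geometric_sum ..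
  also have "(1 - (phi * h) ^ Suc n) * (1 - ?p) + ?p * (1 - e) * f * ?S * (1 - ?p) + e * ?p + ?p * (1 - e) * ?p - 1
      = ((1 - e) * f * ?S + (e - 1)) * (?p * (1 - ?p)) - (phi * h) ^ Suc n * (1 - ?p)"
    by (simp only: algebra_simps) simp
  finally have eq: "unit_lift e n * unit_colift f h n - 1 =
      ((1 - e) * f * ?S + (e - 1)) * (?p * (1 - ?p)) - (phi * h) ^ Suc n * (1 - ?p)" .
  have "(1 - e) * f * ?S + (e - 1) \<in> BR" using e f h phi_BR by (intro BR_closed)
  moreover have "?p * (1 - ?p) \<in> mod_ideal N" by (rule n0) (use n fact_ge_self[of n] in auto)
  moreover have "(phi * h) ^ Suc n * (1 - ?p) \<in> mod_ideal N" by (rule high_power) (use n in auto)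
  ultimately show ?thesis
    unfolding eq using mod_ideal_diff[OF e' N] mod_ideal_mult[OF e' N] by blast
qed

end

lemma scale_scale: "scale c (scale d a) = scale (c * d) a"
  by (cases a) (simp add: scale_def mult.assoc)

lemma scale_1: "scale 1 a = a"
  by (cases a) (simp add: scale_def)

lemma isomorphic_profinite_completions_gam:
  "isomorphic_profinite_completions (gam 1) (gam e)"
proof (rule isomorphic_profinite_completionsI)
  let ?\<Phi> = "\<lambda>n. scale (unit_lift e n)" and ?\<Psi> = "\<lambda>n. scale (unit_colift f h n)"
  note lift = hom_in_carrier[OF unit_lift_hom] and colift = hom_in_carrier[OF unit_colift_hom]
  show "group (gam 1)" "group (gam e)" using group_gam e by auto
  have idem: "\<exists>n0. \<forall>m\<ge>n0. \<forall>n\<ge>n0. phi ^ m * (1 - phi ^ fact n) \<in> mod_ideal N"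
    if "e' \<in> BR" "N \<in> finite_index_normal (gam e')" for e' N
    using phi_eventually_idempotent that by (simp add: finite_index_normal_def)
  show "profinitely_convergent (gam 1) (gam e) ?\<Phi>"
    unfolding profinitely_convergent_def
  proof (intro conjI allI ballI unit_lift_hom)
    fix N assume N: "N \<in> finite_index_normal (gam e)"
    then have nor: "N \<lhd> gam e" by (simp add: finite_index_normal_def)
    obtain n0 where n0: "\<And>m n. m \<ge> n0 \<Longrightarrow> n \<ge> n0 \<Longrightarrow> phi ^ m * (1 - phi ^ fact n) \<in> mod_ideal N"
      using idem[OF e N] by blast
    show "\<exists>n0. \<forall>n\<ge>n0. \<forall>a\<in>carrier (gam 1). N #>\<^bsub>gam e\<^esub> ?\<Phi> n a = N #>\<^bsub>gam e\<^esub> ?\<Phi> n0 a"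
    proof (intro exI[of _ n0] allI impI ballI)
      fix n a assume "n \<ge> n0" "a \<in> carrier (gam 1)"
      then show "N #>\<^bsub>gam e\<^esub> ?\<Phi> n a = N #>\<^bsub>gam e\<^esub> ?\<Phi> n0 a"
        using scale_coset[OF e nor lift lift] unit_lift_stable[OF e nor n0] by blast
    qed
  qed
  show "profinitely_convergent (gam e) (gam 1) ?\<Psi>"
    unfolding profinitely_convergent_def
  proof (intro conjI allI ballI unit_colift_hom)
    fix N assume N: "N \<in> finite_index_normal (gam 1)"
    then have nor: "N \<lhd> gam 1" by (simp add: finite_index_normal_def)
    obtain n0 where n0: "\<And>m n. m \<ge> n0 \<Longrightarrow> n \<ge> n0 \<Longrightarrow> phi ^ m * (1 - phi ^ fact n) \<in> mod_ideal N"
      using idem[OF BR_1 N] by blast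
    show "\<exists>n0. \<forall>n\<ge>n0. \<forall>a\<in>carrier (gam e). N #>\<^bsub>gam 1\<^esub> ?\<Psi> n a = N #>\<^bsub>gam 1\<^esub> ?\<Psi> n0 a"
    proof (intro exI[of _ n0] allI impI ballI)
      fix n a assume "n \<ge> n0" "a \<in> carrier (gam e)"
      then show "N #>\<^bsub>gam 1\<^esub> ?\<Psi> n a = N #>\<^bsub>gam 1\<^esub> ?\<Psi> n0 a"
        using scale_coset[OF BR_1 nor colift colift] unit_colift_stable[OF BR_1 nor n0] by blast
    qed
  qed
  show "\<exists>n0. \<forall>n\<ge>n0. \<forall>a\<in>carrier (gam 1). N #>\<^bsub>gam 1\<^esub> ?\<Psi> n (?\<Phi> n a) = N #>\<^bsub>gam 1\<^esub> a"
    if N: "N \<in> finite_index_normal (gam 1)" for N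
  proof -
    have nor: "N \<lhd> gam 1" using N by (simp add: finite_index_normal_def)
    obtain n0 where n0: "\<And>m n. m \<ge> n0 \<Longrightarrow> n \<ge> n0 \<Longrightarrow> phi ^ m * (1 - phi ^ fact n) \<in> mod_ideal N"
      using idem[OF BR_1 N] by blast
    have "N #>\<^bsub>gam 1\<^esub> ?\<Psi> n (?\<Phi> n a) = N #>\<^bsub>gam 1\<^esub> a" if "n \<ge> n0" "a \<in> carrier (gam 1)" for n a
    proof -
      have "unit_colift f h n * unit_lift e n - 1 \<in> mod_ideal N"
        using unit_lift_colift[OF BR_1 nor n0 that(1)] by (simp only: mult.commute)
      then show ?thesis
        using scale_coset[OF BR_1 nor, of "unit_colift f h n * unit_lift e n" a 1] that(2) colift[OF lift[OF that(2)]]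
        by (simp only: scale_scale scale_1)
    qed
    then show ?thesis by blast
  qed
  show "\<exists>n0. \<forall>n\<ge>n0. \<forall>a\<in>carrier (gam e). N #>\<^bsub>gam e\<^esub> ?\<Phi> n (?\<Psi> n a) = N #>\<^bsub>gam e\<^esub> a"
    if N: "N \<in> finite_index_normal (gam e)" for N
  proof -
    have nor: "N \<lhd> gam e" using N by (simp add: finite_index_normal_def)
    obtain n0 where n0: "\<And>m n. m \<ge> n0 \<Longrightarrow> n \<ge> n0 \<Longrightarrow> phi ^ m * (1 - phi ^ fact n) \<in> mod_ideal N"
      using idem[OF e N] by blast
    have "N #>\<^bsub>gam e\<^esub> ?\<Phi> n (?\<Psi> n a) = N #>\<^bsub>gam e\<^esub> a" if "n \<ge> n0" "a \<in> carrier (gam e)" for n a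
      using scale_coset[OF e nor, of "unit_lift e n * unit_colift f h n" a 1] that(2) lift[OF colift[OF that(2)]]
        unit_lift_colift[OF e nor n0 that(1)]
      by (simp only: scale_scale scale_1)
    then show ?thesis by blast
  qed
qed

end

section \<open>A finite presentation\<close>

definition cj :: "('a, 'b) monoid_scheme \<Rightarrow> 'a \<Rightarrow> 'a \<Rightarrow> 'a"
  where "cj G g c = g \<otimes>\<^bsub>G\<^esub> c \<otimes>\<^bsub>G\<^esub> inv\<^bsub>G\<^esub> g"

section \<open>Conjugation and Baumslag's trick\<close>

context group
begin

lemma cj_closed [simp]: "g \<in> carrier G \<Longrightarrow> c \<in> carrier G \<Longrightarrow> cj G g c \<in> carrier G"
  by (simp add: cj_def)

lemma cj_mult [simp]:
  assumes "g \<in> carrier G" "c \<in> carrier G" "d \<in> carrier G"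
  shows "cj G g (c \<otimes> d) = cj G g c \<otimes> cj G g d"
proof -
  have "cj G g c \<otimes> cj G g d = g \<otimes> c \<otimes> (inv g \<otimes> g) \<otimes> d \<otimes> inv g"
    unfolding cj_def using assms by (simp only: m_assoc m_closed inv_closed)
  then show ?thesis using assms by (simp add: cj_def m_assoc)
qed

lemma cj_cj: "g \<in> carrier G \<Longrightarrow> h \<in> carrier G \<Longrightarrow> c \<in> carrier G \<Longrightarrow> cj G g (cj G h c) = cj G (g \<otimes> h) c"
  by (simp add: cj_def inv_mult_group m_assoc)

lemma cj_one [simp]: "c \<in> carrier G \<Longrightarrow> cj G \<one> c = c" "g \<in> carrier G \<Longrightarrow> cj G g \<one> = \<one>"
  by (simp_all add: cj_def)

lemma cj_group_hom: "g \<in> carrier G \<Longrightarrow> group_hom G G (cj G g)"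
  by (auto simp: group_hom_def group_hom_axioms_def hom_def is_group)

lemma cj_inv_cj [simp]:
  assumes "g \<in> carrier G" "c \<in> carrier G"
  shows "cj G (inv g) (cj G g c) = c" "cj G g (cj G (inv g) c) = c"
  using assms by (simp_all add: cj_cj)

lemma cj_commute:
  assumes "g \<in> carrier G" "h \<in> carrier G" "c \<in> carrier G" "g \<otimes> h = h \<otimes> g"
  shows "cj G g (cj G h c) = cj G h (cj G g c)"
  using assms by (simp add: cj_cj)

lemma cj_inj:
  assumes "g \<in> carrier G" "c \<in> carrier G" "d \<in> carrier G" "cj G g c = cj G g d"
  shows "c = d"
  using assms cj_inv_cj(1) by metis

text \<open>Meant for \<open>p, q\<close> and \<open>u, v\<close> neighbouring conjugates of two
  elements: three of the four pairs are at distances already treated, and the product relation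
  yields the fourth, one step further. The next lemma does the same in the negative
  direction.\<close>

lemma commute_cancel_outer:
  assumes "p \<in> carrier G" "q \<in> carrier G" "u \<in> carrier G" "v \<in> carrier G"
    and "(p \<otimes> q) \<otimes> (u \<otimes> v) = (u \<otimes> v) \<otimes> (p \<otimes> q)"
    and "p \<otimes> u = u \<otimes> p" "q \<otimes> u = u \<otimes> q" "q \<otimes> v = v \<otimes> q"
  shows "p \<otimes> v = v \<otimes> p"
proof -
  have "u \<otimes> (p \<otimes> v) \<otimes> q = (u \<otimes> p) \<otimes> (v \<otimes> q)" using assms(1-4) by (simp add: m_assoc)
  also have "\<dots> = (p \<otimes> u) \<otimes> (q \<otimes> v)" by (simp only: assms(6,8))
  also have "\<dots> = p \<otimes> (u \<otimes> q) \<otimes> v" using assms(1-4) by (simp add: m_assoc)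
  also have "\<dots> = p \<otimes> (q \<otimes> u) \<otimes> v" by (simp only: assms(7))
  also have "\<dots> = (p \<otimes> q) \<otimes> (u \<otimes> v)" using assms(1-4) by (simp add: m_assoc)
  also have "\<dots> = u \<otimes> (v \<otimes> p) \<otimes> q" using assms(1-4) by (simp add: assms(5) m_assoc)
  finally show ?thesis using assms(1-4) by simp
qed

lemma commute_cancel_inner:
  assumes "p \<in> carrier G" "q \<in> carrier G" "u \<in> carrier G" "v \<in> carrier G"
    and "(p \<otimes> q) \<otimes> (u \<otimes> v) = (u \<otimes> v) \<otimes> (p \<otimes> q)"
    and "p \<otimes> u = u \<otimes> p" "p \<otimes> v = v \<otimes> p" "q \<otimes> v = v \<otimes> q"
  shows "q \<otimes> u = u \<otimes> q"
proof -
  have "p \<otimes> (q \<otimes> u) \<otimes> v = (u \<otimes> v) \<otimes> (p \<otimes> q)" using assms(1-4) by (simp add: assms(5)[symmetric] m_assoc)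
  also have "\<dots> = u \<otimes> (v \<otimes> p) \<otimes> q" using assms(1-4) by (simp add: m_assoc)
  also have "\<dots> = u \<otimes> (p \<otimes> v) \<otimes> q" by (simp only: assms(7))
  also have "\<dots> = (u \<otimes> p) \<otimes> (v \<otimes> q)" using assms(1-4) by (simp add: m_assoc)
  also have "\<dots> = (p \<otimes> u) \<otimes> (q \<otimes> v)" by (simp only: assms(6,8))
  also have "\<dots> = p \<otimes> (u \<otimes> q) \<otimes> v" using assms(1-4) by (simp add: m_assoc)
  finally show ?thesis using assms(1-4) by simp
qed

text \<open>
  Baumslag's trick: since conjugation by \<open>y\<close> acts as \<open>1 + x\<close>, it turns the commutation of
  conjugates at distance \<open>n\<close> into commutation at distance \<open>n + 1\<close>.
\<close>

lemma baumslag_commute: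
  fixes x y c d
  defines "s \<equiv> \<lambda>(n :: int) c. cj G (x [^] n) c"
  assumes xy: "x \<in> carrier G" "y \<in> carrier G" "x \<otimes> y = y \<otimes> x"
    and cd: "c \<in> carrier G" "d \<in> carrier G"
    and yc: "cj G y c = c \<otimes> cj G x c" and yd: "cj G y d = d \<otimes> cj G x d"
    and base: "c \<otimes> d = d \<otimes> c" "c \<otimes> cj G x d = cj G x d \<otimes> c" "d \<otimes> cj G x c = cj G x c \<otimes> d"
  shows "s i c \<otimes> s j d = s j d \<otimes> s i c"
proof -
  have s_closed: "s n e \<in> carrier G" if "e \<in> carrier G" for n e using xy(1) that by (simp add: s_def)
  have s_s: "s m (s n e) = s (m + n) e" if "e \<in> carrier G" for m n e
    using xy(1) that by (simp add: s_def cj_cj int_pow_mult)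
  have s0: "s 0 e = e" if "e \<in> carrier G" for e using that by (simp add: s_def)
  have s1: "s 1 e = cj G x e" for e using xy(1) by (simp add: s_def)
  have s_mult: "s n (e \<otimes> e') = s n e \<otimes> s n e'" if "e \<in> carrier G" "e' \<in> carrier G" for n e e'
    using xy(1) that by (simp add: s_def)
  have xyn: "x [^] n \<otimes> y = y \<otimes> x [^] n" for n :: int
  proof -
    have "x [^] n \<in> generate G {x}" by (rule subgroup_int_pow_closed[OF generate_is_subgroup]) (use xy in \<open>auto intro: generate.incl\<close>)
    then show ?thesis
      using generate_commute[of "{x}" "{y}" "x [^] n" y] xy by (auto intro: generate.incl)
  qed
  have y_s: "cj G y (s n e) = s n (cj G y e)" if "e \<in> carrier G" for n e
    unfolding s_def by (rule cj_commute) (use xy that xyn in auto)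
  have yc': "cj G y (s n c) = s n c \<otimes> s (n + 1) c" for n
    using cd by (simp add: y_s yc s_mult s1[symmetric] s_s s_closed)
  have yd': "cj G y (s n d) = s n d \<otimes> s (n + 1) d" for n
    using cd by (simp add: y_s yd s_mult s1[symmetric] s_s s_closed)
  \<comment> \<open>Conjugation by powers of \<open>x\<close> makes commutation depend only on the
    difference \<open>k\<close> of the exponents.\<close>
  define C where "C = (\<lambda>k. c \<otimes> s k d = s k d \<otimes> c)"
  have shift: "s i c \<otimes> s (i + k) d = s (i + k) d \<otimes> s i c" if "C k" for i k
  proof -
    have "s i (c \<otimes> s k d) = s i (s k d \<otimes> c)" using that by (simp add: C_def)
    then show ?thesis using cd by (simp add: s_mult s_closed s_s)
  qed
  have unshift: "C k" if "s i c \<otimes> s (i + k) d = s (i + k) d \<otimes> s i c" for i k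
  proof -
    have "s (- i) (s i c \<otimes> s (i + k) d) = s (- i) (s (i + k) d \<otimes> s i c)" using that by simp
    then show ?thesis using cd by (simp add: C_def s_mult s_closed s_s s0)
  qed
  have sh: "s i c \<otimes> s j d = s j d \<otimes> s i c" if "C (j - i)" for i j
    using shift[OF that, of i] by simp
  have "\<forall>k. \<bar>k\<bar> \<le> int (Suc n) \<longrightarrow> C k" for n
  proof (induction n)
    case 0
    have "C 0" "C 1" using base cd by (simp_all add: C_def s0 s1)
    moreover have "C (-1)" by (rule unshift[of 1]) (use base(3) cd in \<open>simp add: s0 s1\<close>)
    moreover have "k = 0 \<or> k = 1 \<or> k = -1" if "\<bar>k\<bar> \<le> int (Suc 0)" for k using that by auto
    ultimately show ?case by metis
  next
    case (Suc n)
    let ?m = "int (Suc n)"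
    have known: "s i c \<otimes> s j d = s j d \<otimes> s i c" if "\<bar>j - i\<bar> \<le> ?m" for i j
      using Suc.IH that by (intro sh) blast
    \<comment> \<open>Conjugating the known relation at distance \<open>k\<close> by
      \<open>y\<close> replaces each of the two elements by the product of two neighbours.\<close>
    have step: "(s 0 c \<otimes> s 1 c) \<otimes> (s k d \<otimes> s (k + 1) d) = (s k d \<otimes> s (k + 1) d) \<otimes> (s 0 c \<otimes> s 1 c)" if "\<bar>k\<bar> \<le> ?m" for k
    proof -
      have "cj G y (s 0 c \<otimes> s k d) = cj G y (s k d \<otimes> s 0 c)" using known[of k 0] that by simp
      then show ?thesis using cd xy yc'[of 0] yd'[of k] by (simp add: s_closed)
    qed
    have "C (?m + 1)"
    proof (rule unshift[of 0])
      show "s 0 c \<otimes> s (0 + (?m + 1)) d = s (0 + (?m + 1)) d \<otimes> s 0 c"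
        by (rule commute_cancel_outer[of "s 0 c" "s 1 c" "s ?m d"])
          (use cd step[of ?m] in \<open>auto simp: s_closed intro!: known\<close>)
    qed
    \<comment> \<open>\<open>c\<close> and \<open>d\<close> play different roles, so negative
      distances do not follow by symmetry.\<close>
    moreover have "C (- ?m - 1)"
    proof (rule unshift[of 1])
      have "s 1 c \<otimes> s (- ?m) d = s (- ?m) d \<otimes> s 1 c"
        by (rule commute_cancel_inner[of "s 0 c" "s 1 c" "s (- ?m) d" "s (- ?m + 1) d"])
          (use cd step[of "- ?m"] in \<open>auto simp: s_closed intro!: known\<close>)
      then show "s 1 c \<otimes> s (1 + (- ?m - 1)) d = s (1 + (- ?m - 1)) d \<otimes> s 1 c" by simp
    qed
    moreover have "\<bar>k\<bar> \<le> ?m \<or> k = ?m + 1 \<or> k = - ?m - 1" if "\<bar>k\<bar> \<le> int (Suc (Suc n))" for k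
      using that by auto
    ultimately show ?case using Suc.IH by metis
  qed
  then have "C k" for k by (metis abs_ge_self int_nat_eq abs_ge_zero lessI less_imp_le nat_le_iff of_nat_mono order_trans nat_int)
  then show ?thesis by (rule sh)
qed

end

text \<open>
  In \<open>gam 1\<close> the generators are \<open>a = (\<phi>, 0)\<close> and \<open>b = (1, 1)\<close>, so that the last relation for \<open>w\<close> is
  \<open>(1, x^4) = x^4 (1, 1) - (\<phi>, 0)\<close>.
\<close>

locale presented = group G for G (structure) +
  fixes a b x y w
  assumes in_G [simp]: "a \<in> carrier G" "b \<in> carrier G" "x \<in> carrier G" "y \<in> carrier G" "w \<in> carrier G"
    and xy: "x \<otimes> y = y \<otimes> x" and xw: "x \<otimes> w = w \<otimes> x" and yw: "y \<otimes> w = w \<otimes> y"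
    and ya: "cj G y a = a \<otimes> cj G x a" and yb: "cj G y b = b \<otimes> cj G x b"
    and wa: "cj G w a = a" and wb: "cj G w b = cj G (x [^] (4 :: int)) b \<otimes> inv a"
    and c_aa: "a \<otimes> cj G x a = cj G x a \<otimes> a" and c_bb: "b \<otimes> cj G x b = cj G x b \<otimes> b"
    and c_ab: "a \<otimes> b = b \<otimes> a" and c_axb: "a \<otimes> cj G x b = cj G x b \<otimes> a"
    and c_bxa: "b \<otimes> cj G x a = cj G x a \<otimes> b"
begin

definition K where "K = (\<lambda>n :: int. cj G (x [^] n) a) ` UNIV \<union> (\<lambda>n :: int. cj G (x [^] n) b) ` UNIV"

text \<open>The module over \<open>Z[x, 1/x]\<close> generated by \<open>a\<close> and
  \<open>b\<close>. Conjugation by \<open>y\<close> maps it into itself, but conjugation by the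
  inverse of \<open>y\<close> may leave it, which is why the set \<open>N\<close> is introduced
  below.\<close>

definition A where "A = generate G K"

lemma K_carrier: "K \<subseteq> carrier G"
  by (auto simp: K_def)

lemma A_subgroup: "subgroup A G"
  unfolding A_def by (rule generate_is_subgroup[OF K_carrier])

lemma A_carrier [simp]: "c \<in> A \<Longrightarrow> c \<in> carrier G"
  using subgroup.mem_carrier[OF A_subgroup] .

lemma A_closed [simp]: "c \<in> A \<Longrightarrow> d \<in> A \<Longrightarrow> c \<otimes> d \<in> A" "c \<in> A \<Longrightarrow> inv c \<in> A" "\<one> \<in> A" "c \<in> A \<Longrightarrow> c [^] (k :: int) \<in> A"
  using subgroup.m_closed[OF A_subgroup] subgroup.m_inv_closed[OF A_subgroup]
    subgroup.one_closed[OF A_subgroup] subgroup_int_pow_closed[OF A_subgroup] by auto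

text \<open>The relations contain the base cases for the pairs \<open>(a, a)\<close>,
  \<open>(b, b)\<close> and \<open>(a, b)\<close>, and Baumslag's argument extends each to all
  conjugates.\<close>

lemma A_commute: "c \<in> A \<Longrightarrow> d \<in> A \<Longrightarrow> c \<otimes> d = d \<otimes> c"
proof -
  note B = baumslag_commute[OF in_G(3,4) xy]
  have "s \<otimes> t = t \<otimes> s" if "s \<in> K" "t \<in> K" for s t
    using that B[OF in_G(1,1) ya ya refl c_aa c_aa] B[OF in_G(2,2) yb yb refl c_bb c_bb]
      B[OF in_G(1,2) ya yb c_ab c_axb c_bxa] unfolding K_def by (auto simp: eq_commute)
  then show "c \<in> A \<Longrightarrow> d \<in> A \<Longrightarrow> c \<otimes> d = d \<otimes> c"
    unfolding A_def by (rule generate_commute[OF K_carrier _ K_carrier])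
qed

lemma A_cj_x: "c \<in> A \<Longrightarrow> cj G x c \<in> A"
proof -
  interpret h: group_hom G G "cj G x" by (rule cj_group_hom) simp
  have "cj G x ` generate G K = generate G (cj G x ` K)" using h.generate_img[OF K_carrier] by simp
  moreover have "cj G x ` K \<subseteq> K"
  proof -
    have "cj G x (cj G (x [^] n) c) = cj G (x [^] (1 + n)) c" if "c \<in> carrier G" for n :: int and c
      using that int_pow_mult[of x 1 n] by (simp add: cj_cj)
    then show ?thesis unfolding K_def by auto
  qed
  ultimately show "c \<in> A \<Longrightarrow> cj G x c \<in> A" unfolding A_def using mono_generate[of "cj G x ` K" K] by blast
qed

lemma ab_A [simp]: "a \<in> A" "b \<in> A"
proof -
  have "cj G (x [^] (0 :: int)) a \<in> K" "cj G (x [^] (0 :: int)) b \<in> K" unfolding K_def by blast+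
  then show "a \<in> A" "b \<in> A" unfolding A_def by (auto intro: generate.incl)
qed

text \<open>
  The module action of the polynomial \<open>p\<close> in \<open>x\<close> on \<open>c\<close>, written multiplicatively.
\<close>

definition E :: "'a \<Rightarrow> int poly \<Rightarrow> 'a"
  where "E c p = fold_coeffs (\<lambda>k t. c [^] k \<otimes> cj G x t) p \<one>"

lemma E_0 [simp]: "E c 0 = \<one>"
  by (simp add: E_def)

lemma E_pCons: "c \<in> carrier G \<Longrightarrow> E c (pCons k p) = c [^] k \<otimes> cj G x (E c p)"
  by (cases "p = 0 \<and> k = 0") (auto simp: E_def)

lemma E_A [simp]: "c \<in> A \<Longrightarrow> E c p \<in> A"
  by (induction p) (auto simp: E_pCons A_cj_x)

lemma E_carrier [simp]: "c \<in> A \<Longrightarrow> E c p \<in> carrier G"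
  using E_A A_carrier by blast

lemma A_rearrange:
  assumes "p \<in> A" "q \<in> A" "u \<in> A" "v \<in> A"
  shows "(p \<otimes> q) \<otimes> (u \<otimes> v) = (p \<otimes> u) \<otimes> (q \<otimes> v)"
proof -
  have "(p \<otimes> q) \<otimes> (u \<otimes> v) = p \<otimes> (q \<otimes> u) \<otimes> v" using assms by (simp add: m_assoc)
  also have "q \<otimes> u = u \<otimes> q" by (rule A_commute[OF assms(2,3)])
  finally show ?thesis using assms by (simp add: m_assoc)
qed

lemma E_add: "c \<in> A \<Longrightarrow> E c (p + q) = E c p \<otimes> E c q"
proof (induction p q rule: poly_induct2)
  case (pCons k p l q)
  have "E c (pCons k p + pCons l q) = (c [^] k \<otimes> c [^] l) \<otimes> (cj G x (E c p) \<otimes> cj G x (E c q))"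
    using pCons by (simp add: E_pCons int_pow_mult)
  also have "\<dots> = (c [^] k \<otimes> cj G x (E c p)) \<otimes> (c [^] l \<otimes> cj G x (E c q))"
    by (rule A_rearrange) (use pCons in \<open>auto simp: A_cj_x\<close>)
  finally show ?case using pCons by (simp add: E_pCons)
qed simp

lemma E_x: "c \<in> A \<Longrightarrow> cj G x (E c p) = E c ([:0, 1:] * p)"
  by (simp add: E_pCons A_cj_x)

lemma cj_int_pow:
  assumes "g \<in> carrier G" "c \<in> carrier G"
  shows "cj G g (c [^] (k :: int)) = cj G g c [^] k"
proof -
  interpret h: group_hom G G "cj G g" by (rule cj_group_hom[OF assms(1)])
  show ?thesis using h.hom_int_pow[OF assms(2)] by simp
qed

lemma A_int_pow_distrib:
  assumes "c \<in> A" "d \<in> A"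
  shows "(c \<otimes> d) [^] (k :: int) = c [^] k \<otimes> d [^] k"
  using assms A_commute by (simp add: int_pow_mult_distrib)

text \<open>\<open>y\<close> acts on \<open>c\<close> as \<open>1 + x\<close>, and since it commutes
  with \<open>x\<close>, it acts so on all polynomial multiples of \<open>c\<close>.\<close>

lemma E_y:
  assumes c: "c \<in> A" and yc: "cj G y c = c \<otimes> cj G x c"
  shows "cj G y (E c p) = E c ([:1, 1:] * p)"
proof (induction p)
  case (pCons k p)
  have "cj G y (E c (pCons k p)) = (c \<otimes> cj G x c) [^] k \<otimes> cj G x (cj G y (E c p))"
    using c by (simp add: E_pCons cj_int_pow yc[symmetric] cj_commute[of y x] xy)
  also have "(c \<otimes> cj G x c) [^] k = c [^] k \<otimes> cj G x (c [^] k)"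
    using c A_cj_x[OF c] by (simp add: A_int_pow_distrib cj_int_pow)
  also have "cj G y (E c p) = E c p \<otimes> cj G x (E c p)"
    unfolding pCons.IH using E_add[OF c, of p "pCons 0 p"] c by (simp add: E_pCons A_cj_x)
  also have "(c [^] k \<otimes> cj G x (c [^] k)) \<otimes> cj G x (E c p \<otimes> cj G x (E c p)) =
      (c [^] k \<otimes> cj G x (c [^] k)) \<otimes> (cj G x (E c p) \<otimes> cj G x (cj G x (E c p)))"
    using c by simp
  also have "\<dots> = (c [^] k \<otimes> cj G x (E c p)) \<otimes> (cj G x (c [^] k) \<otimes> cj G x (cj G x (E c p)))"
    by (rule A_rearrange) (use c in \<open>auto intro!: A_cj_x\<close>)
  also have "\<dots> = E c (pCons k p) \<otimes> E c (pCons 0 (pCons k p))"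
    using c by (simp add: E_pCons A_cj_x)
  also have "\<dots> = E c ([:1, 1:] * pCons k p)"
  proof -
    have "[:1, 1:] * q = q + pCons 0 q" for q :: "int poly" by simp
    then show ?thesis by (simp only: E_add[OF c])
  qed
  finally show ?case .
qed simp

lemma E_w_a: "cj G w (E a p) = E a p"
  by (induction p) (simp_all add: E_pCons cj_int_pow wa cj_commute[of w x] xw)

lemma E_x_pow: "c \<in> A \<Longrightarrow> cj G (x [^] n) (E c p) = E c ([:0, 1:] ^ n * p)" for n :: nat
proof (induction n)
  case (Suc n)
  have "cj G (x [^] Suc n) (E c p) = cj G x (cj G (x [^] n) (E c p))"
    using Suc.prems nat_pow_Suc2[of x n] by (simp only: cj_cj in_G nat_pow_closed E_carrier)
  then show ?case using Suc E_x by (simp add: mult.assoc del: mult_pCons_left mult_pCons_right)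
qed simp

text \<open>In additive notation \<open>w\<close> sends \<open>b\<close> to
  \<open>x^4 b - a\<close>, hence \<open>p b\<close> to \<open>x^4 p b - p a\<close>, as
  \<open>w\<close> commutes with \<open>x\<close>.\<close>

lemma E_w_b: "cj G w (E b p) = E b ([:0, 1:] ^ 4 * p) \<otimes> E a (- p)"
proof (induction p)
  case (pCons k p)
  let ?q = "[:0, 1:] ^ 4 * p" and ?u = "cj G (x [^] (4 :: nat)) b"
  have x4: "x [^] (4 :: int) = x [^] (4 :: nat)" using int_pow_int[of G x 4] by simp
  have u: "?u = E b ([:0, 1:] ^ 4 * [:1:])"
    using E_x_pow[of b 4 "[:1:]"] by (simp add: E_pCons)
  then have uA: "?u \<in> A" by simp
  have "cj G w (E b (pCons k p)) = (?u \<otimes> inv a) [^] k \<otimes> cj G x (cj G w (E b p))"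
    by (simp add: E_pCons cj_int_pow wb x4 cj_commute[of w x] xw)
  also have "(?u \<otimes> inv a) [^] k = ?u [^] k \<otimes> a [^] (- k)"
    using uA by (simp add: A_int_pow_distrib int_pow_inv int_pow_neg)
  also have "cj G w (E b p) = E b ?q \<otimes> E a (- p)" by (rule pCons.IH)
  also have "(?u [^] k \<otimes> a [^] (- k)) \<otimes> cj G x (E b ?q \<otimes> E a (- p)) =
      (?u [^] k \<otimes> a [^] (- k)) \<otimes> (cj G x (E b ?q) \<otimes> cj G x (E a (- p)))"
    by simp
  also have "\<dots> = (?u [^] k \<otimes> cj G x (E b ?q)) \<otimes> (a [^] (- k) \<otimes> cj G x (E a (- p)))"
    by (rule A_rearrange) (use uA in \<open>auto intro!: A_cj_x\<close>)
  also have "a [^] (- k) \<otimes> cj G x (E a (- p)) = E a (- pCons k p)" by (simp add: E_pCons)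
  also have "?u [^] k \<otimes> cj G x (E b ?q) = E b ([:0, 1:] ^ 4 * pCons k p)"
  proof -
    have "?u [^] k \<otimes> cj G x (E b ?q) = cj G (x [^] (4 :: nat)) (b [^] k) \<otimes> cj G x (cj G (x [^] (4 :: nat)) (E b p))"
      by (simp add: cj_int_pow E_x_pow)
    also have "cj G x (cj G (x [^] (4 :: nat)) (E b p)) = cj G (x [^] (4 :: nat)) (cj G x (E b p))"
      by (rule cj_commute) (simp_all add: nat_pow_comm nat_pow_Suc2[symmetric] flip: nat_pow_Suc)
    also have "cj G (x [^] (4 :: nat)) (b [^] k) \<otimes> \<dots> = cj G (x [^] (4 :: nat)) (E b (pCons k p))"
      by (simp add: E_pCons)
    finally show ?thesis by (simp only: E_x_pow ab_A)
  qed
  finally show ?case .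
qed simp

text \<open>
  The element \<open>x y\<close> acts as \<open>x (1 + x)\<close>, so conjugation by its powers clears denominators.
\<close>

definition N where
  "N = {n \<in> carrier G. \<exists>k p r. cj G ((x \<otimes> y) [^] (k :: nat)) n = E a p \<otimes> E b r}"

definition Z :: "int poly" where "Z = [:0, 1:] * [:1, 1:]"

lemma E_z_pow: "cj G ((x \<otimes> y) [^] n) (E a p \<otimes> E b r) = E a (Z ^ n * p) \<otimes> E b (Z ^ n * r)" for n :: nat
proof (induction n arbitrary: p r)
  case (Suc n)
  have "cj G ((x \<otimes> y) [^] Suc n) (E a p \<otimes> E b r) = cj G ((x \<otimes> y) [^] n) (cj G x (cj G y (E a p \<otimes> E b r)))"
    by (simp add: cj_cj m_assoc)
  also have "cj G x (cj G y (E a p \<otimes> E b r)) = E a (Z * p) \<otimes> E b (Z * r)"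
    by (simp add: E_y ya yb E_x mult.assoc Z_def del: mult_pCons_left mult_pCons_right)
  finally show ?case using Suc.IH by (simp add: mult_ac)
qed simp

lemma z_commute: "g \<in> {x, y, w, inv x, inv y, inv w} \<Longrightarrow> (x \<otimes> y) [^] (k :: nat) \<otimes> g = g \<otimes> (x \<otimes> y) [^] k"
proof -
  have "(x \<otimes> y) [^] k \<in> generate G {x, y, w}"
  proof (induction k)
    case 0
    then show ?case by (simp add: generate.one)
  next
    case (Suc k)
    have "x \<otimes> y \<in> generate G {x, y, w}" by (intro generate.eng generate.incl) auto
    then show ?case using Suc generate.eng by (simp add: generate.eng)
  qed
  moreover have "g \<in> {x, y, w, inv x, inv y, inv w} \<Longrightarrow> g \<in> generate G {x, y, w}"
    by (auto intro: generate.incl generate.inv)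
  moreover have "s \<otimes> t = t \<otimes> s" if "s \<in> {x, y, w}" "t \<in> {x, y, w}" for s t using that xy xw yw by auto
  ultimately show "g \<in> {x, y, w, inv x, inv y, inv w} \<Longrightarrow> ?thesis"
    using generate_commute[of "{x, y, w}" "{x, y, w}"] by simp
qed

lemma N_raise:
  fixes k l :: nat
  assumes "cj G ((x \<otimes> y) [^] k) n = E a p \<otimes> E b r" "n \<in> carrier G"
  shows "cj G ((x \<otimes> y) [^] (l + k)) n = E a (Z ^ l * p) \<otimes> E b (Z ^ l * r)"
proof -
  have "cj G ((x \<otimes> y) [^] (l + k)) n = cj G ((x \<otimes> y) [^] l) (cj G ((x \<otimes> y) [^] k) n)"
    using assms(2) by (simp add: cj_cj nat_pow_mult)
  then show ?thesis using assms(1) E_z_pow by simp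
qed

lemma E_mult: "(E a p \<otimes> E b r) \<otimes> (E a p' \<otimes> E b r') = E a (p + p') \<otimes> E b (r + r')"
  using A_rearrange[of "E a p" "E b r" "E a p'" "E b r'"] by (simp add: E_add)

lemma N_mult:
  assumes "n \<in> N" "m \<in> N"
  shows "n \<otimes> m \<in> N"
proof -
  obtain k p r where n: "n \<in> carrier G" "cj G ((x \<otimes> y) [^] (k :: nat)) n = E a p \<otimes> E b r"
    using assms(1) by (auto simp: N_def)
  obtain l p' r' where m: "m \<in> carrier G" "cj G ((x \<otimes> y) [^] (l :: nat)) m = E a p' \<otimes> E b r'"
    using assms(2) by (auto simp: N_def)
  have "cj G ((x \<otimes> y) [^] (l + k)) (n \<otimes> m) =
      (E a (Z ^ l * p) \<otimes> E b (Z ^ l * r)) \<otimes> (E a (Z ^ k * p') \<otimes> E b (Z ^ k * r'))"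
    using n(1) m(1) N_raise[OF n(2,1), of l] N_raise[OF m(2,1), of k] by (simp add: add.commute)
  then show ?thesis using n m E_mult by (auto simp: N_def)
qed

text \<open>The inverses of \<open>x\<close>, \<open>y\<close> and \<open>w\<close> require division
  by \<open>x\<close>, \<open>1 + x\<close> and \<open>x^4\<close>; the factor \<open>Z^4\<close>
  makes all these divisions possible within polynomials.\<close>

lemma E_conj:
  assumes "g \<in> {x, y, w, inv x, inv y, inv w}"
  shows "\<exists>p' r'. cj G g (E a (Z ^ 4 * p) \<otimes> E b (Z ^ 4 * r)) = E a p' \<otimes> E b r'"
proof -
  have Z4: "Z ^ 4 * q = [:0, 1:] * ([:0, 1:] ^ 3 * [:1, 1:] ^ 4 * q)"
    "Z ^ 4 * q = [:1, 1:] * ([:0, 1:] ^ 4 * [:1, 1:] ^ 3 * q)"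
    "Z ^ 4 * q = [:0, 1:] ^ 4 * ([:1, 1:] ^ 4 * q)" for q
    by (simp_all only: Z_def power_mult_distrib power4_eq_xxxx power3_eq_cube mult_ac)
  have inv_conj: "cj G (inv g) c = d" if "cj G g d = c" "g \<in> carrier G" "d \<in> carrier G" for g c d
    using that by (metis cj_inv_cj(1))
  consider "g = x" | "g = y" | "g = w" | "g = inv x" | "g = inv y" | "g = inv w" using assms by auto
  then show ?thesis
  proof cases
    case 1
    then show ?thesis by (auto simp: E_x simp del: mult_pCons_left mult_pCons_right)
  next
    case 2
    then show ?thesis by (auto simp: E_y ya yb simp del: mult_pCons_left mult_pCons_right)
  next
    case 3
    have "cj G w (E a (Z ^ 4 * p) \<otimes> E b (Z ^ 4 * r)) =
        (E a (Z ^ 4 * p) \<otimes> E b 0) \<otimes> (E a (- (Z ^ 4 * r)) \<otimes> E b ([:0, 1:] ^ 4 * (Z ^ 4 * r)))"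
      using A_commute[of "E b ([:0, 1:] ^ 4 * (Z ^ 4 * r))" "E a (- (Z ^ 4 * r))"]
      by (simp add: E_w_a E_w_b del: mult_pCons_left mult_pCons_right)
    then show ?thesis unfolding 3 E_mult by blast
  next
    case 4
    have "cj G x (E a ([:0, 1:] ^ 3 * [:1, 1:] ^ 4 * p) \<otimes> E b ([:0, 1:] ^ 3 * [:1, 1:] ^ 4 * r)) =
        E a (Z ^ 4 * p) \<otimes> E b (Z ^ 4 * r)"
      unfolding Z4(1) by (simp add: E_x del: mult_pCons_left mult_pCons_right)
    from inv_conj[OF this] show ?thesis unfolding 4 by auto
  next
    case 5
    have "cj G y (E a ([:0, 1:] ^ 4 * [:1, 1:] ^ 3 * p) \<otimes> E b ([:0, 1:] ^ 4 * [:1, 1:] ^ 3 * r)) =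
        E a (Z ^ 4 * p) \<otimes> E b (Z ^ 4 * r)"
      unfolding Z4(2) by (simp add: E_y ya yb del: mult_pCons_left mult_pCons_right)
    from inv_conj[OF this] show ?thesis unfolding 5 by auto
  next
    case 6
    \<comment> \<open>Chosen so that \<open>x^4\<close> times it is \<open>Z^4 r\<close>; the extra
      summand in the \<open>a\<close> part compensates the term \<open>- ?s\<close> that
      \<open>w\<close> contributes.\<close>
    let ?s = "[:1, 1:] ^ 4 * r"
    have "cj G w (E a (Z ^ 4 * p + ?s) \<otimes> E b ?s) =
        (E a (Z ^ 4 * p + ?s) \<otimes> E b 0) \<otimes> (E a (- ?s) \<otimes> E b ([:0, 1:] ^ 4 * ?s))"
      using A_commute[of "E b ([:0, 1:] ^ 4 * ?s)" "E a (- ?s)"]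
      by (simp add: E_w_a E_w_b del: mult_pCons_left mult_pCons_right)
    then have "cj G w (E a (Z ^ 4 * p + ?s) \<otimes> E b ?s) = E a (Z ^ 4 * p) \<otimes> E b (Z ^ 4 * r)"
      unfolding E_mult Z4(3)[of r] by simp
    from inv_conj[OF this] show ?thesis unfolding 6 by auto
  qed
qed

lemma N_conj:
  assumes "n \<in> N" "g \<in> {x, y, w, inv x, inv y, inv w}"
  shows "cj G g n \<in> N"
proof -
  obtain k p r where n: "n \<in> carrier G" "cj G ((x \<otimes> y) [^] (k :: nat)) n = E a p \<otimes> E b r"
    using assms(1) by (auto simp: N_def)
  have g: "g \<in> carrier G" using assms(2) by auto
  obtain p' r' where "cj G g (E a (Z ^ 4 * p) \<otimes> E b (Z ^ 4 * r)) = E a p' \<otimes> E b r'"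
    using E_conj[OF assms(2)] by blast
  \<comment> \<open>Four additional powers of \<open>x y\<close> leave room for the division that
    conjugation by \<open>g\<close> may require.\<close>
  then have "cj G g (cj G ((x \<otimes> y) [^] (4 + k)) n) = E a p' \<otimes> E b r'"
    using N_raise[OF n(2,1), of 4] by simp
  moreover have "cj G g (cj G ((x \<otimes> y) [^] (4 + k)) n) = cj G ((x \<otimes> y) [^] (4 + k)) (cj G g n)"
    by (rule cj_commute) (use g n z_commute[OF assms(2)] in auto)
  ultimately show ?thesis using g n(1) unfolding N_def by auto
qed

lemma N_gens: "a \<in> N" "b \<in> N" "inv a \<in> N" "inv b \<in> N" "\<one> \<in> N"
proof -
  have Nz: "n \<in> N" if "n \<in> carrier G" "n = E a p \<otimes> E b r" for n p r
  proof -
    have "cj G ((x \<otimes> y) [^] (0 :: nat)) n = E a p \<otimes> E b r" using that by simp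
    then show ?thesis unfolding N_def using that(1) by blast
  qed
  show "a \<in> N" by (rule Nz[of a "[:1:]" 0]) (simp_all add: E_pCons)
  show "b \<in> N" by (rule Nz[of b 0 "[:1:]"]) (simp_all add: E_pCons)
  show "inv a \<in> N" by (rule Nz[of "inv a" "[:-1:]" 0]) (simp_all add: E_pCons int_pow_neg)
  show "inv b \<in> N" by (rule Nz[of "inv b" 0 "[:-1:]"]) (simp_all add: E_pCons int_pow_neg)
  show "\<one> \<in> N" by (rule Nz[of \<one> 0 0]) simp_all
qed

definition T where "T = generate G {x, y, w}"

lemma T_subgroup: "subgroup T G"
  unfolding T_def by (rule generate_is_subgroup) simp

lemma T_carrier: "q \<in> T \<Longrightarrow> q \<in> carrier G"
  using subgroup.mem_carrier[OF T_subgroup] .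

lemma T_commute: "q \<in> T \<Longrightarrow> q' \<in> T \<Longrightarrow> q \<otimes> q' = q' \<otimes> q"
  unfolding T_def by (rule generate_commute[of "{x, y, w}" "{x, y, w}"]) (use xy xw yw in auto)

lemma T_form:
  assumes "q \<in> T"
  shows "\<exists>(i :: int) (j :: int) (l :: int). q = x [^] i \<otimes> y [^] j \<otimes> w [^] l"
proof -
  have xyw: "x [^] i \<in> T" "y [^] i \<in> T" "w [^] i \<in> T" for i :: int
    by (intro subgroup_int_pow_closed[OF T_subgroup], simp add: T_def generate.incl)+
  show ?thesis using assms unfolding T_def
  proof induction
    case one
    show ?case by (rule exI[of _ 0], rule exI[of _ 0], rule exI[of _ 0]) simp
  next
    case (incl h)
    then consider "h = x" | "h = y" | "h = w" by auto
    then show ?case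
    proof cases
      case 1 show ?thesis unfolding 1 by (rule exI[of _ 1], rule exI[of _ 0], rule exI[of _ 0]) simp
    next
      case 2 show ?thesis unfolding 2 by (rule exI[of _ 0], rule exI[of _ 1], rule exI[of _ 0]) simp
    next
      case 3 show ?thesis unfolding 3 by (rule exI[of _ 0], rule exI[of _ 0], rule exI[of _ 1]) simp
    qed
  next
    case (inv h)
    then consider "h = x" | "h = y" | "h = w" by auto
    then show ?case
    proof cases
      case 1 show ?thesis unfolding 1 by (rule exI[of _ "-1"], rule exI[of _ 0], rule exI[of _ 0]) (simp add: int_pow_neg)
    next
      case 2 show ?thesis unfolding 2 by (rule exI[of _ 0], rule exI[of _ "-1"], rule exI[of _ 0]) (simp add: int_pow_neg)
    next
      case 3 show ?thesis unfolding 3 by (rule exI[of _ 0], rule exI[of _ 0], rule exI[of _ "-1"]) (simp add: int_pow_neg)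
    qed
  next
    case (eng q q')
    then obtain i j l i' j' l' :: int where q: "q = x [^] i \<otimes> y [^] j \<otimes> w [^] l"
      and q': "q' = x [^] i' \<otimes> y [^] j' \<otimes> w [^] l'" by blast
    have "q \<otimes> q' = x [^] i \<otimes> (y [^] j \<otimes> (w [^] l \<otimes> x [^] i')) \<otimes> y [^] j' \<otimes> w [^] l'"
      by (simp add: q q' m_assoc)
    also have "w [^] l \<otimes> x [^] i' = x [^] i' \<otimes> w [^] l" by (rule T_commute[OF xyw(3,1)])
    also have "x [^] i \<otimes> (y [^] j \<otimes> (x [^] i' \<otimes> w [^] l)) \<otimes> y [^] j' \<otimes> w [^] l' =
        x [^] i \<otimes> (y [^] j \<otimes> x [^] i') \<otimes> (w [^] l \<otimes> y [^] j') \<otimes> w [^] l'"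
      by (simp add: m_assoc)
    also have "y [^] j \<otimes> x [^] i' = x [^] i' \<otimes> y [^] j" by (rule T_commute[OF xyw(2,1)])
    also have "w [^] l \<otimes> y [^] j' = y [^] j' \<otimes> w [^] l" by (rule T_commute[OF xyw(3,2)])
    also have "x [^] i \<otimes> (x [^] i' \<otimes> y [^] j) \<otimes> (y [^] j' \<otimes> w [^] l) \<otimes> w [^] l' =
        x [^] (i + i') \<otimes> y [^] (j + j') \<otimes> w [^] (l + l')"
      by (simp add: m_assoc int_pow_mult)
    finally show ?case by blast
  qed
qed

lemma N_carrier: "n \<in> N \<Longrightarrow> n \<in> carrier G"
  by (simp add: N_def)

lemma N_conj_T:
  assumes "q \<in> T" "n \<in> N"
  shows "cj G q n \<in> N"
  using assms unfolding T_def
proof (induction arbitrary: n)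
  case one
  then show ?case using N_carrier by simp
next
  case (incl h)
  then show ?case using N_conj by blast
next
  case (inv h)
  then show ?case using N_conj by blast
next
  case (eng q q')
  then have "q \<in> carrier G" "q' \<in> carrier G" using T_carrier by (auto simp: T_def)
  then have "cj G (q \<otimes> q') n = cj G q (cj G q' n)" using N_carrier eng.prems by (simp add: cj_cj)
  then show ?case using eng by simp
qed

text \<open>Elements of \<open>T\<close> move past those of \<open>N\<close> by conjugation, under
  which \<open>N\<close> is stable.\<close>

lemma semidirect:
  assumes "g \<in> generate G {a, b, x, y, w}"
  shows "\<exists>n\<in>N. \<exists>q\<in>T. g = n \<otimes> q"
  using assms
proof induction
  case one
  show ?case by (intro bexI[of _ \<one>]) (auto simp: N_gens subgroup.one_closed[OF T_subgroup])
next
  case (incl h)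
  have T: "\<one> \<in> T" "x \<in> T" "y \<in> T" "w \<in> T"
    by (auto simp: T_def intro: generate.incl generate.one)
  consider "h \<in> {a, b}" | "h \<in> {x, y, w}" using incl by blast
  then show ?case
  proof cases
    case 1
    then have "h \<in> N" "h = h \<otimes> \<one>" using N_gens by auto
    then show ?thesis using T by blast
  next
    case 2
    then have "h \<in> T" "h = \<one> \<otimes> h" using T by auto
    then show ?thesis using N_gens by blast
  qed
next
  case (inv h)
  have T: "\<one> \<in> T" "inv x \<in> T" "inv y \<in> T" "inv w \<in> T"
    by (auto simp: T_def intro: generate.inv generate.one)
  consider "h \<in> {a, b}" | "h \<in> {x, y, w}" using inv by blast
  then show ?case
  proof cases
    case 1
    then have "inv h \<in> N" "inv h = inv h \<otimes> \<one>" using N_gens by auto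
    then show ?thesis using T by blast
  next
    case 2
    then have "inv h \<in> T" "inv h = \<one> \<otimes> inv h" using T by auto
    then show ?thesis using N_gens by blast
  qed
next
  case (eng g g')
  then obtain n q n' q' where nq: "n \<in> N" "q \<in> T" "g = n \<otimes> q" "n' \<in> N" "q' \<in> T" "g' = n' \<otimes> q'" by blast
  then have c: "n \<in> carrier G" "q \<in> carrier G" "n' \<in> carrier G" "q' \<in> carrier G"
    using N_carrier T_carrier by auto
  have "(n \<otimes> cj G q n') \<otimes> (q \<otimes> q') = n \<otimes> (q \<otimes> n' \<otimes> (inv q \<otimes> q)) \<otimes> q'"
    unfolding cj_def using c by (simp only: m_assoc m_closed inv_closed)
  then have "g \<otimes> g' = (n \<otimes> cj G q n') \<otimes> (q \<otimes> q')"
    using c by (simp add: nq m_assoc)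
  then show ?case
    using N_mult[OF nq(1) N_conj_T[OF nq(2,4)]] subgroup.m_closed[OF T_subgroup nq(2,5)] by blast
qed

end

section \<open>Evaluation of polynomials and faithfulness of the presentation\<close>

definition ev :: "int poly \<Rightarrow> nat \<Rightarrow> complex"
  where "ev p n = poly (map_poly of_int p) (pt n)"

lemma ev_pCons: "ev (pCons k p) n = of_int k + pt n * ev p n"
  by (simp add: ev_def map_poly_pCons)

lemma ev_eq_0:
  assumes "\<And>n. n \<ge> m \<Longrightarrow> ev p n = 0"
  shows "p = 0"
proof -
  have "pt ` {m..} \<subseteq> {z. poly (map_poly of_int p) z = (0 :: complex)}"
    using assms by (auto simp: ev_def)
  then have "infinite {z. poly (map_poly of_int p) z = (0 :: complex)}"
    using pt_inj infinite_Ici by (meson finite_imageD finite_subset inj_on_subset subset_UNIV)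
  then have "map_poly of_int p = (0 :: complex poly)" using poly_roots_finite by blast
  then show ?thesis by (simp add: map_poly_eq_0_iff)
qed

lemma gam_int_pow_mod:
  assumes e: "e \<in> BR" and fg: "(f, g, 0, 0, 0) \<in> carrier (gam e)"
  shows "(f, g, 0, 0, 0) [^]\<^bsub>gam e\<^esub> (k :: int) = (\<lambda>n. of_int k * f n, \<lambda>n. of_int k * g n, 0, 0, 0)"
proof (induction k rule: int_induct[where k = 0])
  interpret group "gam e" by (rule group_gam[OF e])
  case base
  show ?case by (simp add: gam_one fun_eq_iff)
next
  interpret group "gam e" by (rule group_gam[OF e])
  case (step1 k)
  then show ?case using int_pow_mult[OF fg, of k 1] fg by (simp add: gam_mult fun_eq_iff algebra_simps)
next
  interpret group "gam e" by (rule group_gam[OF e])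
  case (step2 k)
  have "(f, g, 0, 0, 0) [^]\<^bsub>gam e\<^esub> (-1 :: int) = (- f, - g, 0, 0, 0)"
    using fg by (simp add: int_pow_neg gam_inv[OF e])
  then show ?case using int_pow_mult[OF fg, of k "-1"] step2 by (simp add: gam_mult fun_eq_iff algebra_simps)
qed

lemma gam_int_pow_Q:
  assumes e: "e \<in> BR"
  shows "(0, 0, i, j, r) [^]\<^bsub>gam e\<^esub> (k :: int) = (0, 0, k * i, k * j, k * r)"
proof (induction k rule: int_induct[where k = 0])
  interpret group "gam e" by (rule group_gam[OF e])
  case base
  show ?case by (simp add: gam_one zero_fun_def)
next
  interpret group "gam e" by (rule group_gam[OF e])
  case (step1 k)
  have q: "(0, 0, i, j, r) \<in> carrier (gam e)"
    unfolding gam_carrier by (simp only: mult_zero_right diff_self BR_closed phiB_closed)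
  show ?case using int_pow_mult[OF q, of k 1] q step1 by (simp add: gam_mult algebra_simps zero_fun_def fun_eq_iff)
next
  interpret group "gam e" by (rule group_gam[OF e])
  case (step2 k)
  have q: "(0, 0, i, j, r) \<in> carrier (gam e)"
    unfolding gam_carrier by (simp only: mult_zero_right diff_self BR_closed phiB_closed)
  have "(0, 0, i, j, r) [^]\<^bsub>gam e\<^esub> (-1 :: int) = (0, 0, - i, - j, - r)"
    using q by (simp add: int_pow_neg gam_inv[OF e])
  then show ?case using int_pow_mult[OF q, of k "-1"] step2 by (simp add: gam_mult algebra_simps zero_fun_def fun_eq_iff)
qed

lemma phi_nonzero: "n \<ge> 2 \<Longrightarrow> phi n \<noteq> 0"
  using chi_eq_1[of 4 0 n] by (auto simp: phi_def)

text \<open>Write \<open>g = n q\<close>. The exponents of \<open>x\<close>, \<open>y\<close>,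
  \<open>w\<close> in \<open>q\<close> can be read off in \<open>gam 1\<close>, so \<open>q\<close>
  is trivial. A conjugate of \<open>n\<close> is given by two integer polynomials \<open>p\<close>
  and \<open>r\<close>, and its image \<open>(\<phi> p + r, r)\<close> determines both.\<close>

lemma (in presented) faithful:
  assumes \<pi>: "\<pi> \<in> hom G (gam 1)"
    and gens: "\<pi> a = (phi, 0, 0, 0, 0)" "\<pi> b = (1, 1, 0, 0, 0)" "\<pi> x = (0, 0, 1, 0, 0)"
      "\<pi> y = (0, 0, 0, 1, 0)" "\<pi> w = (0, 0, 0, 0, 1)"
    and g: "g \<in> generate G {a, b, x, y, w}" "\<pi> g = \<one>\<^bsub>gam 1\<^esub>"
  shows "g = \<one>"
proof -
  interpret H: group "gam 1" by (rule group_gam[OF BR_1])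
  interpret \<pi>: group_hom G "gam 1" \<pi> using \<pi> by (simp add: group_hom_def group_hom_axioms_def is_group)
  have cjx: "\<pi> (cj G x c) = (chi 1 0 * f, chi 1 0 * f', 0, 0, 0)"
    if "c \<in> carrier G" "\<pi> c = (f, f', 0, 0, 0)" for c f f'
  proof -
    have "(0, 0, 1, 0, 0) \<in> carrier (gam 1)" using \<pi>.hom_closed[OF in_G(3)] gens(3) by simp
    then show ?thesis using that by (simp add: cj_def gens gam_inv[OF BR_1] gam_mult)
  qed
  have powa: "\<pi> (a [^] k) = (\<lambda>n. of_int k * phi n, 0, 0, 0, 0)" for k :: int
    using \<pi>.hom_int_pow[OF in_G(1), of k] gam_int_pow_mod[OF BR_1, of phi 0 k] \<pi>.hom_closed[OF in_G(1)]
    by (simp add: gens fun_eq_iff)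
  have powb: "\<pi> (b [^] k) = (\<lambda>n. of_int k, \<lambda>n. of_int k, 0, 0, 0)" for k :: int
    using \<pi>.hom_int_pow[OF in_G(2), of k] gam_int_pow_mod[OF BR_1, of 1 1 k] \<pi>.hom_closed[OF in_G(2)]
    by (simp add: gens fun_eq_iff)
  have Ea: "\<pi> (E a p) = (phi * ev p, 0, 0, 0, 0)" for p
  proof (induction p)
    case 0
    show ?case by (simp add: gam_one fun_eq_iff ev_def)
  next
    case (pCons k p)
    have "\<pi> (cj G x (E a p)) = (chi 1 0 * (phi * ev p), chi 1 0 * 0, 0, 0, 0)" by (rule cjx[OF _ pCons.IH]) simp
    then show ?case by (simp add: E_pCons powa gam_mult fun_eq_iff ev_pCons chi_def algebra_simps)
  qed
  have Eb: "\<pi> (E b p) = (ev p, ev p, 0, 0, 0)" for p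
  proof (induction p)
    case 0
    show ?case by (simp add: gam_one fun_eq_iff ev_def)
  next
    case (pCons k p)
    have "\<pi> (cj G x (E b p)) = (chi 1 0 * ev p, chi 1 0 * ev p, 0, 0, 0)" by (rule cjx[OF _ pCons.IH]) simp
    then show ?case by (simp add: E_pCons powb gam_mult fun_eq_iff ev_pCons chi_def algebra_simps)
  qed
  obtain n q where nq: "n \<in> N" "q \<in> T" "g = n \<otimes> q" using semidirect[OF g(1)] by blast
  obtain i j l :: int where q: "q = x [^] i \<otimes> y [^] j \<otimes> w [^] l" using T_form[OF nq(2)] by blast
  obtain k p r where n: "n \<in> carrier G" "cj G ((x \<otimes> y) [^] (k :: nat)) n = E a p \<otimes> E b r"
    using nq(1) by (auto simp: N_def)
  let ?z = "(x \<otimes> y) [^] k"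
  have Epi: "\<pi> (E a p \<otimes> E b r) = (phi * ev p + ev r, ev r, 0, 0, 0)"
    by (simp add: Ea Eb gam_mult)
  obtain f f' i' j' l' where \<pi>n: "\<pi> n = (f, f', i', j', l')" by (cases "\<pi> n") auto
  obtain z1 z2 z3 z4 z5 where \<pi>z: "\<pi> ?z = (z1, z2, z3, z4, z5)" by (cases "\<pi> ?z") auto
  have "(z1, z2, z3, z4, z5) \<in> carrier (gam 1)" using \<pi>.hom_closed[of ?z] \<pi>z by simp
  then have "\<exists>f f'. \<pi> (cj G ?z n) = (f, f', i', j', l')"
    using n(1) \<pi>z \<pi>n by (simp add: cj_def gam_inv[OF BR_1] gam_mult)
  \<comment> \<open>Conjugation does not change the three exponents, and those of the conjugate
    vanish.\<close>
  then have \<pi>n: "\<pi> n = (f, f', 0, 0, 0)" using \<pi>n n(2) Epi by auto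
  have "\<pi> q = (0, 0, i, j, l)"
    using \<pi>.hom_int_pow[OF in_G(3), of i] \<pi>.hom_int_pow[OF in_G(4), of j] \<pi>.hom_int_pow[OF in_G(5), of l]
    by (simp add: q gens gam_int_pow_Q[OF BR_1] gam_mult)
  then have "(f, f', i, j, l) = (0, 0, 0, 0, 0)"
    using g(2) nq n(1) \<pi>n T_carrier by (simp add: gam_mult gam_one)
  then have "q = \<one>" "\<pi> n = \<one>\<^bsub>gam 1\<^esub>" using q \<pi>n by (simp_all add: gam_one)
  then have "\<pi> (cj G ?z n) = \<one>\<^bsub>gam 1\<^esub>" using n(1) by (simp add: cj_def)
  then have "phi * ev p + ev r = 0" "ev r = 0" using n(2) Epi gam_one by auto
  then have "ev r n = 0" "phi n * ev p n = 0" for n by (simp_all add: fun_eq_iff)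
  \<comment> \<open>\<phi> vanishes at \<i> and at 1, that is at the indices 0 and 1, so
    \<open>p\<close> is known to vanish only from index 2 on.\<close>
  then have "r = 0" "p = 0" using ev_eq_0[of 0 r] ev_eq_0[of 2 p] phi_nonzero by auto
  then have "cj G ?z n = cj G ?z \<one>" using n(2) by simp
  then have "n = \<one>" using cj_inj[of ?z n \<one>] n(1) by simp
  then show ?thesis using nq \<open>q = \<one>\<close> by simp
qed

definition gam_gens :: "nat \<Rightarrow> gelt"
  where "gam_gens = (\<lambda>n. [(phi, 0, 0, 0, 0), (1, 1, 0, 0, 0), (0, 0, 1, 0, 0), (0, 0, 0, 1, 0), (0, 0, 0, 0, 1)] ! n)"

text \<open>The relations assumed in the locale \<open>presented\<close>, with
  \<open>a, b, x, y, w\<close> numbered 0 to 4 and primed letters standing for formal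
  inverses.\<close>

definition gam_relations :: "((bool \<times> nat) list \<times> (bool \<times> nat) list) set"
  where "gam_relations =
    (let a = (True, 0); a' = (False, 0); b = (True, 1); x = (True, 2); x' = (False, 2);
         y = (True, 3); y' = (False, 3); w = (True, 4); w' = (False, 4)
     in {([x, y], [y, x]), ([x, w], [w, x]), ([y, w], [w, y]),
       ([y, a, y'], [a, x, a, x']), ([y, b, y'], [b, x, b, x']),
       ([w, a, w'], [a]), ([w, b, w'], [x, x, x, x, b, x', x', x', x', a']),
       ([a, x, a, x'], [x, a, x', a]), ([b, x, b, x'], [x, b, x', b]),
       ([a, b], [b, a]), ([a, x, b, x'], [x, b, x', a]), ([b, x, a, x'], [x, a, x', b])})"

theorem finitely_presented_gam: "finitely_presented (gam 1)"
proof (rule finitely_presentedI)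
  interpret H: group "gam 1" by (rule group_gam[OF BR_1])
  let ?X = "{0, 1, 2, 3, 4} :: nat set"
  let ?S = "{(phi, 0, 0, 0, 0), (1, 1, 0, 0, 0), (0, 0, 1, 0, 0), (0, 0, 0, 1, 0), (0, 0, 0, 0, 1)} :: gelt set"
  have img: "gam_gens ` ?X = ?S" by (simp add: gam_gens_def)
  have S: "generate (gam 1) ?S = carrier (gam 1)" by (rule generate_gam[OF BR_1])
  then have mem: "s \<in> carrier (gam 1)" if "s \<in> ?S" for s using generate.incl[OF that, of "gam 1"] by blast
  show "group (gam 1)" by (rule H.is_group)
  show "finite ?X" by simp
  show "gam_gens \<in> ?X \<rightarrow> carrier (gam 1)" using mem img by blast
  show "generate (gam 1) (gam_gens ` ?X) = carrier (gam 1)" unfolding img by (rule S)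
  show "finite gam_relations" by (simp add: gam_relations_def Let_def)
  show "gam_relations \<subseteq> group_words ?X \<times> group_words ?X" by (simp add: gam_relations_def Let_def)
  show "word_eval (gam 1) gam_gens u = word_eval (gam 1) gam_gens v" if "(u, v) \<in> gam_relations" for u v
    using that mem
    by (auto simp: gam_relations_def Let_def gam_gens_def gam_mult gam_inv[OF BR_1] gam_one phi_def
        chi_Y chi_mult algebra_simps)
next
  fix P :: "(bool \<times> nat) list set set monoid" and p \<pi> g
  let ?X = "{0, 1, 2, 3, 4} :: nat set"
  assume P: "group P" and p: "p \<in> ?X \<rightarrow> carrier P" and gen: "generate P (p ` ?X) = carrier P"
    and rel: "\<And>u v. (u, v) \<in> gam_relations \<Longrightarrow> word_eval P p u = word_eval P p v"
    and \<pi>: "\<pi> \<in> hom P (gam 1)" "\<And>n. n \<in> ?X \<Longrightarrow> \<pi> (p n) = gam_gens n"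
    and g: "g \<in> carrier P" "\<pi> g = \<one>\<^bsub>gam 1\<^esub>"
  interpret P: group P by (rule P)
  have c: "p 0 \<in> carrier P" "p 1 \<in> carrier P" "p 2 \<in> carrier P" "p 3 \<in> carrier P" "p 4 \<in> carrier P"
    using p by auto
  have pow4: "z [^]\<^bsub>P\<^esub> (4 :: int) = z \<otimes>\<^bsub>P\<^esub> (z \<otimes>\<^bsub>P\<^esub> (z \<otimes>\<^bsub>P\<^esub> z))" if "z \<in> carrier P" for z
    using int_pow_int[of P z 4] that by (simp add: numeral_eq_Suc P.m_assoc)
  note R = rel[unfolded gam_relations_def Let_def]
  interpret presented P "p 0" "p 1" "p 2" "p 3" "p 4"
  proof unfold_locales
    show "cj P (p 4) (p 1) = cj P (p 2 [^]\<^bsub>P\<^esub> (4 :: int)) (p 1) \<otimes>\<^bsub>P\<^esub> inv\<^bsub>P\<^esub> p 0"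
      using R[of "[(True, 4), (True, 1), (False, 4)]"] c
      by (simp add: cj_def pow4 P.m_assoc P.inv_mult_group)
  qed (use c R[of "[(True, 2), (True, 3)]"] R[of "[(True, 2), (True, 4)]"] R[of "[(True, 3), (True, 4)]"]
      R[of "[(True, 3), (True, 0), (False, 3)]"] R[of "[(True, 3), (True, 1), (False, 3)]"]
      R[of "[(True, 4), (True, 0), (False, 4)]"]
      R[of "[(True, 0), (True, 2), (True, 0), (False, 2)]"] R[of "[(True, 1), (True, 2), (True, 1), (False, 2)]"]
      R[of "[(True, 0), (True, 1)]"] R[of "[(True, 0), (True, 2), (True, 1), (False, 2)]"]
      R[of "[(True, 1), (True, 2), (True, 0), (False, 2)]"] in \<open>simp_all add: cj_def P.m_assoc\<close>)
  have "p ` ?X = {p 0, p 1, p 2, p 3, p 4}" by simp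
  then show "g = \<one>\<^bsub>P\<^esub>"
    using faithful[OF \<pi>(1) _ _ _ _ _ _ g(2)] \<pi>(2) gen g(1) by (simp add: gam_gens_def)
qed

section \<open>Distinguishing the groups\<close>

lemma power_int_two_eq_one_plus:
  fixes j l :: int
  assumes "(2 :: real) powi l = 1 + 2 powi j"
  shows "j = 0 \<and> l = 1"
proof -
  have pos: "(2 :: real) powi j > 0" by simp
  have "l > 0"
  proof (rule ccontr)
    assume "\<not> l > 0"
    then have "(2 :: real) powi l \<le> 2 powi 0" by (intro power_int_increasing) auto
    then show False using assms pos by simp
  qed
  then obtain L where L: "l = int (Suc L)" by (metis zero_less_imp_eq_int Suc_pred gr0_conv_Suc)
  have "j \<ge> 0"
  proof (rule ccontr)
    assume "\<not> j \<ge> 0"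
    then have "(2 :: real) powi j < 2 powi 0" by (intro power_int_strict_increasing) auto
    moreover have "(2 :: real) ^ Suc L \<ge> 2" by simp
    ultimately show False using assms unfolding L power_int_of_nat by simp
  qed
  then obtain J where J: "j = int J" by (metis nonneg_int_cases)
  have "real (2 ^ Suc L) = real (1 + 2 ^ J)" using assms unfolding L J power_int_of_nat by simp
  then have eq: "(2 :: nat) ^ Suc L = 1 + 2 ^ J" by (simp only: of_nat_eq_iff)
  then have "odd ((1 :: nat) + 2 ^ J) \<longrightarrow> False" by (metis even_power dvd_triv_left power_Suc)
  then have "J = 0" by (cases J) auto
  then have "(2 :: nat) ^ Suc L = 2 ^ 1" using eq by simp
  then have "L = 0" by (simp only: power_inject_exp)
  then show ?thesis using \<open>J = 0\<close> J L by simp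
qed

lemma power_int_three_two:
  fixes k :: int
  assumes "3 * (2 :: real) powi k = 1 + 2 ^ I"
  shows "I = 1"
proof -
  have "k = 0 \<or> k > 0 \<or> k < 0" by auto
  then show ?thesis
  proof (elim disjE)
    assume "k = 0"
    then have "real (2 ^ I) = real 2" using assms by simp
    then have "(2 :: nat) ^ I = 2 ^ 1" by (simp only: of_nat_eq_iff) simp
    then show ?thesis by (simp only: power_inject_exp)
  next
    assume "k > 0"
    then obtain K where K: "k = int (Suc K)" by (metis zero_less_imp_eq_int Suc_pred gr0_conv_Suc)
    have "real (3 * 2 ^ Suc K) = real (1 + 2 ^ I)" using assms unfolding K power_int_of_nat by simp
    then have "(3 * 2 ^ Suc K :: nat) = 1 + 2 ^ I" by (simp only: of_nat_eq_iff)
    then have "even ((1 :: nat) + 2 ^ I)" by (metis even_mult_iff dvd_triv_left power_Suc)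
    then have "I = 0" by (cases I) auto
    then have "(3 * 2 ^ Suc K :: nat) = 2" using \<open>3 * 2 ^ Suc K = 1 + 2 ^ I\<close> by simp
    then show ?thesis by simp
  next
    assume "k < 0"
    then obtain K where K: "k = - int (Suc K)" by (metis neg_0_less_iff_less zero_less_imp_eq_int Suc_pred gr0_conv_Suc minus_minus)
    have "3 = (1 + 2 ^ I) * (2 :: real) ^ Suc K"
      using assms unfolding K power_int_minus power_int_of_nat by (simp add: field_simps)
    then have "real 3 = real ((1 + 2 ^ I) * 2 ^ Suc K)" by (simp add: algebra_simps)
    then have "(3 :: nat) = (1 + 2 ^ I) * 2 ^ Suc K" by (simp only: of_nat_eq_iff)
    then have "even (3 :: nat)" by (metis even_mult_iff dvd_triv_left power_Suc)
    then show ?thesis by simp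
  qed
qed

text \<open>At 1 the equation reads \<open>2^l = 1 + 2^j\<close>, at 2 it reads
  \<open>2^k 3^l = 1 + 2^i 3^j\<close>, and parity settles both. The solutions \<open>x\<close> and
  \<open>1/x\<close> are the only ways in which the image of \<open>x\<close> can act, given that
  \<open>y\<close> acts as \<open>1 + x\<close>.\<close>

lemma chi_unit_equation:
  assumes "chi k l = 1 + chi i j"
  shows "j = 0 \<and> (i = 1 \<or> i = -1)"
proof -
  have chi1: "chi i j 1 = of_real (2 powi j)" for i j by (simp add: chi_def pt_def)
  have chi2: "chi i j 2 = of_real (2 powi i * 3 powi j)" for i j by (simp add: chi_def pt_def)
  have "complex_of_real (2 powi l) = of_real (1 + 2 powi j)"
    using fun_cong[OF assms, of 1] unfolding plus_fun_apply chi1 by simp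
  then have jl: "j = 0" "l = 1" using power_int_two_eq_one_plus[of l j] of_real_eq_iff by blast+
  have "complex_of_real (2 powi k * 3) = of_real (1 + 2 powi i)"
    using fun_cong[OF assms, of 2] unfolding plus_fun_apply chi2 jl by simp
  then have eq: "3 * (2 :: real) powi k = 1 + 2 powi i" by (simp only: of_real_eq_iff mult.commute)
  have "i = 1 \<or> i = -1"
  proof (cases "i \<ge> 0")
    case True
    then obtain I where I: "i = int I" by (metis nonneg_int_cases)
    then show ?thesis using power_int_three_two[of k I] eq by simp
  next
    case False
    then obtain I where I: "i = - int I" by (metis int_cases2 of_nat_0_le_iff)
    have "3 * (2 :: real) powi (k + int I) = (1 + 2 powi i) * 2 ^ I"
      by (simp add: power_int_add eq[symmetric])
    also have "\<dots> = 1 + 2 ^ I" unfolding I by (simp add: power_int_minus field_simps)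
    finally show ?thesis using power_int_three_two I by simp
  qed
  then show ?thesis using jl by simp
qed

section \<open>The module part as an isomorphism invariant\<close>

lemma gam_conj:
  assumes e: "e \<in> BR" and a: "(u, v, i, j, r) \<in> carrier (gam e)"
  shows "cj (gam e) (u, v, i, j, r) (f, g, 0, 0, 0) = (chi i j * f, chi (i + 4 * r) j * g, 0, 0, 0)"
  using a by (simp add: cj_def gam_inv[OF e] gam_mult mult.assoc[symmetric] chi_mult)

text \<open>
  This isomorphism invariant of \<open>gam e\<close> is its module part.
\<close>

definition commutator_centralizer :: "('a, 'b) monoid_scheme \<Rightarrow> 'a set"
  where "commutator_centralizer G = {a \<in> carrier G. \<forall>b\<in>carrier G. \<forall>c\<in>carrier G.
    a \<otimes>\<^bsub>G\<^esub> commutator G b c = commutator G b c \<otimes>\<^bsub>G\<^esub> a}"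

lemma commutator_centralizer_iso:
  assumes G: "group G" and H: "group H" and h: "h \<in> iso G H" and a: "a \<in> carrier G"
  shows "h a \<in> commutator_centralizer H \<longleftrightarrow> a \<in> commutator_centralizer G"
proof -
  interpret group_hom G H h using G H h by (simp add: group_hom_def group_hom_axioms_def iso_def)
  have bij: "bij_betw h (carrier G) (carrier H)" using h by (simp add: iso_def)
  have inj: "h u = h v \<longleftrightarrow> u = v" if "u \<in> carrier G" "v \<in> carrier G" for u v
    using bij that by (auto simp: bij_betw_def inj_on_def)
  have "h a \<otimes>\<^bsub>H\<^esub> commutator H (h b) (h c) = commutator H (h b) (h c) \<otimes>\<^bsub>H\<^esub> h a \<longleftrightarrow>
      a \<otimes>\<^bsub>G\<^esub> commutator G b c = commutator G b c \<otimes>\<^bsub>G\<^esub> a"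
    if "b \<in> carrier G" "c \<in> carrier G" for b c
    using a that inj[of "a \<otimes>\<^bsub>G\<^esub> commutator G b c" "commutator G b c \<otimes>\<^bsub>G\<^esub> a"]
    by (simp add: hom_commutator)
  then show ?thesis
    using a unfolding commutator_centralizer_def bij_betw_imp_surj_on[OF bij, symmetric] by auto
qed

lemma gam_x_commutator:
  assumes e: "e \<in> BR" and fg: "(f, g, 0, 0, 0) \<in> carrier (gam e)"
  shows "commutator (gam e) (0, 0, 1, 0, 0) (f, g, 0, 0, 0) = ((chi 1 0 - 1) * f, (chi 1 0 - 1) * g, 0, 0, 0)"
proof -
  have "(0, 0, 1, 0, 0) \<in> carrier (gam e)"
    unfolding gam_carrier by (simp only: mult_zero_right diff_self BR_closed phiB_closed)
  then show ?thesis using fg by (simp add: commutator_def gam_inv[OF e] gam_mult mult.assoc[symmetric] chi_mult left_diff_distrib)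
qed

text \<open>Commutators lie in the module part, which is abelian and so centralizes them.
  Conversely, the commutators of \<open>x\<close> with \<open>(\<phi>, 0)\<close> and
  \<open>(e, 1)\<close> are nonzero in the first and the second coordinate, and an element commuting
  with them must act by the monomial 1 on both.\<close>

lemma gam_centralizer:
  assumes e: "e \<in> BR" and a: "(f, g, i, j, r) \<in> carrier (gam e)"
  shows "(f, g, i, j, r) \<in> commutator_centralizer (gam e) \<longleftrightarrow> i = 0 \<and> j = 0 \<and> r = 0"
proof
  assume C: "(f, g, i, j, r) \<in> commutator_centralizer (gam e)"
  have x: "(0, 0, 1, 0, 0) \<in> carrier (gam e)"
    unfolding gam_carrier by (simp only: mult_zero_right diff_self BR_closed phiB_closed)
  have ab: "(phi, 0, 0, 0, 0) \<in> carrier (gam e)" "(e, 1, 0, 0, 0) \<in> carrier (gam e)"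
    unfolding gam_carrier using phi_BR e phiB_I[OF BR_1]
    by (simp_all only: mult_zero_right mult_1_right diff_self diff_0_right BR_closed phiB_closed)
  have "(f, g, i, j, r) \<otimes>\<^bsub>gam e\<^esub> ((chi 1 0 - 1) * phi, (chi 1 0 - 1) * 0, 0, 0, 0) =
      ((chi 1 0 - 1) * phi, (chi 1 0 - 1) * 0, 0, 0, 0) \<otimes>\<^bsub>gam e\<^esub> (f, g, i, j, r)"
    using C x ab unfolding commutator_centralizer_def gam_x_commutator[OF e ab(1), symmetric] by blast
  then have 1: "chi i j * ((chi 1 0 - 1) * phi) = (chi 1 0 - 1) * phi" by (simp add: gam_mult add.commute)
  have "(f, g, i, j, r) \<otimes>\<^bsub>gam e\<^esub> ((chi 1 0 - 1) * e, (chi 1 0 - 1) * 1, 0, 0, 0) =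
      ((chi 1 0 - 1) * e, (chi 1 0 - 1) * 1, 0, 0, 0) \<otimes>\<^bsub>gam e\<^esub> (f, g, i, j, r)"
    using C x ab unfolding commutator_centralizer_def gam_x_commutator[OF e ab(2), symmetric] by blast
  then have 2: "chi (i + 4 * r) j * (chi 1 0 - 1) = chi 1 0 - 1" by (simp add: gam_mult add.commute)
  have x2: "chi 1 0 2 - 1 \<noteq> 0" using chi_eq_1[of 1 0 2] by auto
  have "chi i j 2 = 1" using fun_cong[OF 1, of 2] x2 phi_nonzero[of 2] by simp
  moreover have "chi (i + 4 * r) j 2 = 1" using fun_cong[OF 2, of 2] x2 by simp
  ultimately show "i = 0 \<and> j = 0 \<and> r = 0" using chi_eq_1[of i j 2] chi_eq_1[of "i + 4 * r" j 2] by simp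
next
  assume "i = 0 \<and> j = 0 \<and> r = 0"
  then have ijr: "i = 0" "j = 0" "r = 0" by auto
  have "(f, g, 0, 0, 0) \<otimes>\<^bsub>gam e\<^esub> commutator (gam e) b c = commutator (gam e) b c \<otimes>\<^bsub>gam e\<^esub> (f, g, 0, 0, 0)"
    if bc: "b \<in> carrier (gam e)" "c \<in> carrier (gam e)" for b c
  proof -
    obtain f' g' where "commutator (gam e) b c = (f', g', 0, 0, 0)" using gam_commutator[OF e bc] by blast
    then show ?thesis by (simp add: gam_mult add.commute)
  qed
  then show "(f, g, i, j, r) \<in> commutator_centralizer (gam e)"
    using a unfolding commutator_centralizer_def ijr by blast
qed

section \<open>Isomorphisms between two of the groups\<close>

locale gam_iso =
  fixes e c e' c' :: "nat \<Rightarrow> complex" and \<theta> :: "gelt \<Rightarrow> gelt"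
  assumes e: "e \<in> BR" and c: "c \<in> BR" and ec: "e * c - 1 \<in> phiB"
    and e': "e' \<in> BR" and c': "c' \<in> BR" and ec': "e' * c' - 1 \<in> phiB"
    and \<theta>: "\<theta> \<in> iso (gam e) (gam e')"
begin

sublocale \<theta>: group_hom "gam e" "gam e'" \<theta>
  using group_gam[OF e] group_gam[OF e'] \<theta> by (simp add: group_hom_def group_hom_axioms_def iso_def)

lemma \<theta>_inj: "u \<in> carrier (gam e) \<Longrightarrow> v \<in> carrier (gam e) \<Longrightarrow> \<theta> u = \<theta> v \<Longrightarrow> u = v"
  using \<theta> by (auto simp: iso_def bij_betw_def inj_on_def)

lemma \<theta>_surj: "v \<in> carrier (gam e') \<Longrightarrow> \<exists>u\<in>carrier (gam e). \<theta> u = v"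
proof -
  assume v: "v \<in> carrier (gam e')"
  have "\<theta> ` carrier (gam e) = carrier (gam e')" using \<theta> by (simp add: iso_def bij_betw_def)
  then have "v \<in> \<theta> ` carrier (gam e)" using v by simp
  then show "\<exists>u\<in>carrier (gam e). \<theta> u = v" by auto
qed

lemma \<theta>_module:
  assumes "(f, g, 0, 0, 0) \<in> carrier (gam e)"
  obtains f' g' where "\<theta> (f, g, 0, 0, 0) = (f', g', 0, 0, 0)" "f' \<in> BR" "g' \<in> BR" "f' - e' * g' \<in> phiB"
proof -
  obtain f' g' i j r where t: "\<theta> (f, g, 0, 0, 0) = (f', g', i, j, r)" "f' \<in> BR" "g' \<in> BR" "f' - e' * g' \<in> phiB"
    using \<theta>.hom_closed[OF assms] by (rule gam_mem_E)
  have "\<theta> (f, g, 0, 0, 0) \<in> commutator_centralizer (gam e')"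
    using commutator_centralizer_iso[OF group_gam[OF e] group_gam[OF e'] \<theta> assms] gam_centralizer[OF e assms] by blast
  then have "i = 0 \<and> j = 0 \<and> r = 0"
    using gam_centralizer[OF e', of f' g' i j r] t \<theta>.hom_closed[OF assms] by simp
  then show ?thesis using t that by simp
qed

lemma \<theta>_module_preimage:
  assumes "(f', g', 0, 0, 0) \<in> carrier (gam e')"
  obtains f g where "\<theta> (f, g, 0, 0, 0) = (f', g', 0, 0, 0)" "f \<in> BR" "g \<in> BR" "f - e * g \<in> phiB"
proof -
  obtain u where u: "u \<in> carrier (gam e)" "\<theta> u = (f', g', 0, 0, 0)" using \<theta>_surj[OF assms] by blast
  obtain f g i j r where fg: "u = (f, g, i, j, r)" "f \<in> BR" "g \<in> BR" "f - e * g \<in> phiB"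
    using u(1) by (rule gam_mem_E)
  have "u \<in> commutator_centralizer (gam e)"
    using commutator_centralizer_iso[OF group_gam[OF e] group_gam[OF e'] \<theta> u(1)] gam_centralizer[OF e' assms] u(2) by simp
  then have "i = 0 \<and> j = 0 \<and> r = 0" using gam_centralizer[OF e, of f g i j r] u(1) fg(1) by simp
  then show ?thesis using u fg that by simp
qed

lemma \<theta>_diff:
  assumes "(f, g, 0, 0, 0) \<in> carrier (gam e)" "(f', g', 0, 0, 0) \<in> carrier (gam e)"
    and "\<theta> (f, g, 0, 0, 0) = (s, t, 0, 0, 0)" "\<theta> (f', g', 0, 0, 0) = (s', t', 0, 0, 0)"
  shows "\<theta> (f - f', g - g', 0, 0, 0) = (s - s', t - t', 0, 0, 0)"
proof -
  have "(f - f', g - g', 0, 0, 0) = (f, g, 0, 0, 0) \<otimes>\<^bsub>gam e\<^esub> inv\<^bsub>gam e\<^esub> (f', g', 0, 0, 0)"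
    using assms(2) by (simp add: gam_inv[OF e] gam_mult)
  moreover have "(s, t, 0, 0, 0) \<otimes>\<^bsub>gam e'\<^esub> inv\<^bsub>gam e'\<^esub> (s', t', 0, 0, 0) = (s - s', t - t', 0, 0, 0)"
    using \<theta>.hom_closed[OF assms(2)] assms(4) by (simp add: gam_inv[OF e'] gam_mult)
  ultimately show ?thesis
    using assms by (simp only: \<theta>.hom_mult \<theta>.hom_inv \<theta>.G.inv_closed)
qed

lemma Q_mem: "(0, 0, i, j, r) \<in> carrier (gam e)"
  unfolding gam_carrier by (simp only: mult_zero_right diff_self BR_closed phiB_closed)

lemma \<theta>_action:
  assumes q: "\<theta> (0, 0, i, j, r) = (u, v, i', j', r')"
    and m: "(f, g, 0, 0, 0) \<in> carrier (gam e)" "\<theta> (f, g, 0, 0, 0) = (s, t, 0, 0, 0)"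
  shows "\<theta> (chi i j * f, chi (i + 4 * r) j * g, 0, 0, 0) = (chi i' j' * s, chi (i' + 4 * r') j' * t, 0, 0, 0)"
proof -
  have uv: "(u, v, i', j', r') \<in> carrier (gam e')" using \<theta>.hom_closed[OF Q_mem, of i j r] q by simp
  have "\<theta> (cj (gam e) (0, 0, i, j, r) (f, g, 0, 0, 0)) = cj (gam e') (u, v, i', j', r') (s, t, 0, 0, 0)"
    unfolding cj_def using Q_mem[of i j r] m q by simp
  then show ?thesis using gam_conj[OF e Q_mem[of i j r]] gam_conj[OF e' uv] by simp
qed

lemma phi_mem: "p \<in> phiB \<Longrightarrow> (p, 0, 0, 0, 0) \<in> carrier (gam e)" "p \<in> phiB \<Longrightarrow> (0, p, 0, 0, 0) \<in> carrier (gam e)"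
proof -
  assume p: "p \<in> phiB"
  show "(p, 0, 0, 0, 0) \<in> carrier (gam e)"
    unfolding gam_carrier using p phiB_BR[OF p] by (simp only: mult_zero_right diff_0_right BR_closed simp_thms)
  have "0 - e * p \<in> phiB" using p e by (intro phiB_closed)
  then show "(0, p, 0, 0, 0) \<in> carrier (gam e)" unfolding gam_carrier using phiB_BR[OF p] by (simp only: BR_closed simp_thms)
qed

lemma phi_phiB: "phi \<in> phiB"
  using phiB_I[OF BR_1] by (simp only: mult_1_right)

lemma phi_not_0: "phi \<noteq> 0"
  using phi_nonzero[of 2] by auto

lemma chi_fix:
  assumes "s \<in> BR" "s \<noteq> 0" "chi i j * s = s"
  shows "i = 0 \<and> j = 0"
proof -
  obtain n where n: "n \<ge> 2" "s n \<noteq> 0" using BR_nonzero[OF assms(1,2)] by blast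
  have "chi i j n * s n = s n" using fun_cong[OF assms(3), of n] by simp
  then show ?thesis using n chi_eq_1 by simp
qed

text \<open>\<open>w\<close> fixes \<open>(\<phi>, 0)\<close>. If both coordinates of the image were
  nonzero, the image of \<open>w\<close> would act trivially on both and hence lie in the module
  part, which \<open>\<theta>\<close> preserves.\<close>

lemma axis:
  assumes "\<theta> (phi, 0, 0, 0, 0) = (s, t, 0, 0, 0)"
  shows "s = 0 \<or> t = 0"
proof (rule ccontr)
  assume st: "\<not> (s = 0 \<or> t = 0)"
  have mem: "(s, t, 0, 0, 0) \<in> carrier (gam e')" using \<theta>.hom_closed[OF phi_mem(1)[OF phi_phiB]] assms by simp
  obtain u v i j r where w: "\<theta> (0, 0, 0, 0, 1) = (u, v, i, j, r)" by (cases "\<theta> (0, 0, 0, 0, 1)") auto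
  have "\<theta> (phi, 0, 0, 0, 0) = (chi i j * s, chi (i + 4 * r) j * t, 0, 0, 0)"
    using \<theta>_action[OF w phi_mem(1)[OF phi_phiB] assms] by simp
  then have "chi i j * s = s" "chi (i + 4 * r) j * t = t" using assms by auto
  then have ijr: "i = 0" "j = 0" "r = 0"
    using chi_fix[of s i j] chi_fix[of t "i + 4 * r" j] st mem gam_carrier by auto
  have "(u, v, i, j, r) \<in> carrier (gam e')" using \<theta>.hom_closed[OF Q_mem] w by metis
  then have "(0, 0, 0, 0, 1) \<in> commutator_centralizer (gam e)"
    using commutator_centralizer_iso[OF group_gam[OF e] group_gam[OF e'] \<theta> Q_mem[of 0 0 1]]
      gam_centralizer[OF e', of u v i j r] ijr w by simp
  then show False using gam_centralizer[OF e Q_mem[of 0 0 1]] by simp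
qed

lemma units_mod_phi:
  assumes "f \<in> BR" "d \<in> BR" "d * b - 1 \<in> phiB" "b \<in> BR" "d * f \<in> phiB"
  shows "f \<in> phiB"
proof -
  have "f = b * (d * f) - f * (d * b - 1)" by (simp add: algebra_simps)
  then show ?thesis using assms by (metis phiB_diff phiB_mult)
qed

text \<open>The case in which the first axis is mapped to the first; the other case is reduced to it
  by \<open>swap_iso\<close>.\<close>

context
  fixes s
  assumes first: "\<theta> (phi, 0, 0, 0, 0) = (s, 0, 0, 0, 0)"
begin

lemma s_phiB: "s \<in> phiB" and s_not_0: "s \<noteq> 0"
proof -
  have mem: "(s, 0, 0, 0, 0) \<in> carrier (gam e')" using \<theta>.hom_closed[OF phi_mem(1)[OF phi_phiB]] first by simp
  then show "s \<in> phiB" by (simp only: gam_carrier mult_zero_right diff_0_right)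
  show "s \<noteq> 0"
  proof
    assume "s = 0"
    then have "\<theta> (phi, 0, 0, 0, 0) = \<theta> \<one>\<^bsub>gam e\<^esub>" using first \<theta>.hom_one by (simp only: gam_one)
    then have "(phi, 0, 0, 0, 0) = \<one>\<^bsub>gam e\<^esub>"
      by (rule \<theta>_inj[OF phi_mem(1)[OF phi_phiB] \<theta>.G.one_closed])
    then show False using phi_not_0 by (simp add: gam_one)
  qed
qed

text \<open>On the second axis \<open>w\<close> and \<open>x^4\<close> act alike. The image of
  \<open>w\<close> acts trivially on first coordinates because it fixes \<open>(s, 0)\<close>, so
  the image of \<open>x^4\<close> fixes \<open>s'\<close>. But it acts nontrivially on first
  coordinates, since \<open>x^4\<close> moves \<open>(\<phi>, 0)\<close>; hence
  \<open>s' = 0\<close>.\<close>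

lemma second_axis: "\<exists>t. \<theta> (0, phi, 0, 0, 0) = (0, t, 0, 0, 0) \<and> t \<in> phiB \<and> t \<noteq> 0"
proof -
  obtain s' t where st: "\<theta> (0, phi, 0, 0, 0) = (s', t, 0, 0, 0)" "s' \<in> BR" "t \<in> BR" "s' - e' * t \<in> phiB"
    using \<theta>_module[OF phi_mem(2)[OF phi_phiB]] by blast
  obtain u v i j r where w: "\<theta> (0, 0, 0, 0, 1) = (u, v, i, j, r)" by (cases "\<theta> (0, 0, 0, 0, 1)") auto
  obtain u' v' i' j' r' where x: "\<theta> (0, 0, 4, 0, 0) = (u', v', i', j', r')" by (cases "\<theta> (0, 0, 4, 0, 0)") auto
  have "\<theta> (phi, 0, 0, 0, 0) = (chi i j * s, 0, 0, 0, 0)"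
    using \<theta>_action[OF w phi_mem(1)[OF phi_phiB] first] by simp
  then have "chi i j * s = s" using first by auto
  then have ij: "i = 0" "j = 0" using chi_fix[of s i j] s_not_0 phiB_BR[OF s_phiB] by auto
  have "\<theta> (0, chi 4 0 * phi, 0, 0, 0) = (chi i j * s', chi (i + 4 * r) j * t, 0, 0, 0)"
    using \<theta>_action[OF w phi_mem(2)[OF phi_phiB] st(1)] by simp
  moreover have "\<theta> (0, chi 4 0 * phi, 0, 0, 0) = (chi i' j' * s', chi (i' + 4 * r') j' * t, 0, 0, 0)"
    using \<theta>_action[OF x phi_mem(2)[OF phi_phiB] st(1)] by simp
  ultimately have "chi i' j' * s' = s'" using ij by simp
  moreover have "\<not> (i' = 0 \<and> j' = 0)"
  proof
    assume "i' = 0 \<and> j' = 0"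
    then have "\<theta> (chi 4 0 * phi, 0, 0, 0, 0) = (s, 0, 0, 0, 0)"
      using \<theta>_action[OF x phi_mem(1)[OF phi_phiB] first] by simp
    then have "(chi 4 0 * phi, 0, 0, 0, 0) = (phi, 0 :: nat \<Rightarrow> complex, 0 :: int, 0 :: int, 0 :: int)"
      unfolding first[symmetric]
      by (rule \<theta>_inj[OF phi_mem(1)[OF phiB_mult[OF BR_chi phi_phiB]] phi_mem(1)[OF phi_phiB]])
    then have "chi 4 0 * phi = phi" by simp
    then show False using chi_fix[OF phi_BR phi_not_0] by fastforce
  qed
  ultimately have s': "s' = 0" using chi_fix[OF st(2)] by blast
  then have "e' * t \<in> phiB" using phiB_uminus[OF st(4)] by (simp only: diff_0 minus_minus)
  then have "t \<in> phiB" by (rule units_mod_phi[OF st(3) e' ec' c'])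
  moreover have "t \<noteq> 0"
  proof
    assume "t = 0"
    then have "\<theta> (0, phi, 0, 0, 0) = \<theta> \<one>\<^bsub>gam e\<^esub>" using st(1) s' \<theta>.hom_one by (simp only: gam_one)
    then have "(0, phi, 0, 0, 0) = \<one>\<^bsub>gam e\<^esub>"
      by (rule \<theta>_inj[OF phi_mem(2)[OF phi_phiB] \<theta>.G.one_closed])
    then show False using phi_not_0 by (simp add: gam_one)
  qed
  ultimately show ?thesis using st(1) s' by blast
qed

text \<open>As \<open>y\<close> acts as \<open>1 + x\<close> on either axis, the monomials by which
  the images of \<open>x\<close> and \<open>y\<close> act solve the unit equation in each
  coordinate. So \<open>i\<close> and \<open>i + 4 r\<close> are both 1 or -1, which forces
  \<open>r = 0\<close>.\<close>

lemma x_action: "\<exists>u v i. \<theta> (0, 0, 1, 0, 0) = (u, v, i, 0, 0) \<and> (i = 1 \<or> i = -1)"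
proof -
  obtain t where t: "\<theta> (0, phi, 0, 0, 0) = (0, t, 0, 0, 0)" "t \<in> phiB" "t \<noteq> 0" using second_axis by blast
  obtain u v i j r where x: "\<theta> (0, 0, 1, 0, 0) = (u, v, i, j, r)" by (cases "\<theta> (0, 0, 1, 0, 0)") auto
  obtain u' v' k l m where y: "\<theta> (0, 0, 0, 1, 0) = (u', v', k, l, m)" by (cases "\<theta> (0, 0, 0, 1, 0)") auto
  have Xf: "(chi 1 0 * phi, 0, 0, 0, 0) \<in> carrier (gam e)" "(0, chi 1 0 * phi, 0, 0, 0) \<in> carrier (gam e)"
    by (intro phi_mem phiB_mult BR_chi phi_phiB)+
  have Yf: "(chi 0 1 * phi, 0, 0, 0, 0) \<in> carrier (gam e)" "(0, chi 0 1 * phi, 0, 0, 0) \<in> carrier (gam e)"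
    by (intro phi_mem phiB_mult BR_chi phi_phiB)+
  have Y: "chi 0 1 * phi - chi 1 0 * phi = phi" by (simp only: chi_Y distrib_right mult_1_left add_diff_cancel_right')
  have cancel: "chi k' l' = 1 + chi i' j'" if "z \<in> phiB" "z \<noteq> 0" "chi k' l' * z - chi i' j' * z = z" for z k' l' i' j'
  proof -
    have "z * chi k' l' = z * (1 + chi i' j')" using that(3) by (simp add: algebra_simps)
    moreover have "1 + chi i' j' \<in> BR" by (intro BR_closed)
    ultimately show ?thesis using BR_cancel[OF phiB_BR[OF that(1)] BR_chi _ that(2)] by blast
  qed
  have "\<theta> (chi 0 1 * phi - chi 1 0 * phi, 0 - 0, 0, 0, 0) = (chi k l * s - chi i j * s, 0 - 0, 0, 0, 0)"
    by (rule \<theta>_diff[OF Yf(1) Xf(1)])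
      (use \<theta>_action[OF y phi_mem(1)[OF phi_phiB] first] \<theta>_action[OF x phi_mem(1)[OF phi_phiB] first] in simp_all)
  then have "chi k l * s - chi i j * s = s" using first unfolding Y by simp
  from chi_unit_equation[OF cancel[OF s_phiB s_not_0 this]] have 1: "j = 0" "i = 1 \<or> i = -1" by auto
  have "\<theta> (0 - 0, chi 0 1 * phi - chi 1 0 * phi, 0, 0, 0) =
      (0 - 0, chi (k + 4 * m) l * t - chi (i + 4 * r) j * t, 0, 0, 0)"
    by (rule \<theta>_diff[OF Yf(2) Xf(2)])
      (use \<theta>_action[OF y phi_mem(2)[OF phi_phiB] t(1)] \<theta>_action[OF x phi_mem(2)[OF phi_phiB] t(1)] in simp_all)
  then have "chi (k + 4 * m) l * t - chi (i + 4 * r) j * t = t" using t(1) unfolding Y by simp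
  from chi_unit_equation[OF cancel[OF t(2,3) this]] have 2: "i + 4 * r = 1 \<or> i + 4 * r = -1" by auto
  have "r = 0" using 1(2) 2 by presburger
  then show ?thesis using x 1 by blast
qed

text \<open>By additivity it is enough to treat monomials; each is replaced by the monomial through
  which its image acts on the first coordinate.\<close>

lemma \<theta>_multiples:
  assumes "b \<in> BR"
  shows "\<exists>b'\<in>BR. \<theta> (phi * b, 0, 0, 0, 0) = (s * b', 0, 0, 0, 0)"
  using assms
proof induction
  case (BR_chi i j)
  obtain u v i' j' r' where q: "\<theta> (0, 0, i, j, 0) = (u, v, i', j', r')" by (cases "\<theta> (0, 0, i, j, 0)") auto
  have "\<theta> (chi i j * phi, chi (i + 4 * 0) j * 0, 0, 0, 0) = (chi i' j' * s, chi (i' + 4 * r') j' * 0, 0, 0, 0)"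
    by (rule \<theta>_action[OF q phi_mem(1)[OF phi_phiB] first])
  then have "\<theta> (phi * chi i j, 0, 0, 0, 0) = (s * chi i' j', 0, 0, 0, 0)"
    by (simp only: mult_zero_right mult.commute[of phi] mult.commute[of s])
  then show ?case using BR.BR_chi by blast
next
  case (BR_diff f g)
  then obtain f' g' where fg: "f' \<in> BR" "g' \<in> BR" "\<theta> (phi * f, 0, 0, 0, 0) = (s * f', 0, 0, 0, 0)"
    "\<theta> (phi * g, 0, 0, 0, 0) = (s * g', 0, 0, 0, 0)" by blast
  have "\<theta> (phi * f - phi * g, 0 - 0, 0, 0, 0) = (s * f' - s * g', 0 - 0, 0, 0, 0)"
    by (rule \<theta>_diff[OF phi_mem(1) phi_mem(1) fg(3,4)]) (use BR_diff in \<open>auto intro: phiB_I\<close>)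
  then have "\<theta> (phi * (f - g), 0, 0, 0, 0) = (s * (f' - g'), 0, 0, 0, 0)" by (simp only: right_diff_distrib diff_self)
  then show ?case using fg BR.BR_diff by blast
qed

lemma \<theta>_multiples2:
  assumes t: "\<theta> (0, phi, 0, 0, 0) = (0, t, 0, 0, 0)" and "b \<in> BR"
  shows "\<exists>b'\<in>BR. \<theta> (0, phi * b, 0, 0, 0) = (0, t * b', 0, 0, 0)"
  using assms(2)
proof induction
  case (BR_chi i j)
  obtain u v i' j' r' where q: "\<theta> (0, 0, i, j, 0) = (u, v, i', j', r')" by (cases "\<theta> (0, 0, i, j, 0)") auto
  have "\<theta> (chi i j * 0, chi (i + 4 * 0) j * phi, 0, 0, 0) = (chi i' j' * 0, chi (i' + 4 * r') j' * t, 0, 0, 0)"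
    by (rule \<theta>_action[OF q phi_mem(2)[OF phi_phiB] t])
  then have "\<theta> (0, phi * chi i j, 0, 0, 0) = (0, t * chi (i' + 4 * r') j', 0, 0, 0)"
    by (simp only: mult_zero_right mult.commute[of phi] mult.commute[of t] add_0_right)
  then show ?case using BR.BR_chi by blast
next
  case (BR_diff f g)
  then obtain f' g' where fg: "f' \<in> BR" "g' \<in> BR" "\<theta> (0, phi * f, 0, 0, 0) = (0, t * f', 0, 0, 0)"
    "\<theta> (0, phi * g, 0, 0, 0) = (0, t * g', 0, 0, 0)" by blast
  have "\<theta> (0 - 0, phi * f - phi * g, 0, 0, 0) = (0 - 0, t * f' - t * g', 0, 0, 0)"
    by (rule \<theta>_diff[OF phi_mem(2) phi_mem(2) fg(3,4)]) (use BR_diff in \<open>auto intro: phiB_I\<close>)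
  then have "\<theta> (0, phi * (f - g), 0, 0, 0) = (0, t * (f' - g'), 0, 0, 0)" by (simp only: right_diff_distrib diff_self)
  then show ?case using fg BR.BR_diff by blast
qed

text \<open>\<open>\<theta>\<close> need not be linear over \<open>B\<close>, but \<phi> is
  \<open>x^4 - 1\<close>, and the image of \<open>x\<close> acts as \<open>x\<close> or as
  \<open>1/x\<close> on both coordinates. So multiplication by \<phi> turns into multiplication by
  \<open>\<phi> \<nu>\<close>, where \<open>\<nu>\<close> is 1 or \<open>- x^(-4)\<close>.\<close>

lemma phi_action:
  "\<exists>\<nu>\<in>BR. \<nu> \<noteq> 0 \<and> (\<forall>f g s' t'. (f, g, 0, 0, 0) \<in> carrier (gam e) \<longrightarrow> \<theta> (f, g, 0, 0, 0) = (s', t', 0, 0, 0) \<longrightarrow>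
    \<theta> (phi * f, phi * g, 0, 0, 0) = (phi * \<nu> * s', phi * \<nu> * t', 0, 0, 0))"
proof -
  obtain u v i where x: "\<theta> (0, 0, 1, 0, 0) = (u, v, i, 0, 0)" and i: "i = 1 \<or> i = -1" using x_action by blast
  have act4: "\<theta> (chi 4 0 * f, chi 4 0 * g, 0, 0, 0) = (chi (4 * i) 0 * s', chi (4 * i) 0 * t', 0, 0, 0)"
    if m: "(f, g, 0, 0, 0) \<in> carrier (gam e)" "\<theta> (f, g, 0, 0, 0) = (s', t', 0, 0, 0)" for f g s' t'
  proof -
    have q: "(0, 0, 1, 0, 0) [^]\<^bsub>gam e\<^esub> (4 :: int) = (0, 0, 4, 0, 0)"
      using gam_int_pow_Q[OF e, of 1 0 0 4] by simp
    have uv: "(u, v, i, 0, 0) \<in> carrier (gam e')" using \<theta>.hom_closed[OF Q_mem] x by metis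
    have step: "\<exists>u' v'. (u, v, i, 0, 0) [^]\<^bsub>gam e'\<^esub> n = (u', v', int n * i, 0, 0)" for n :: nat
      by (induction n) (auto simp: gam_one gam_mult algebra_simps)
    have "\<theta> (0, 0, 4, 0, 0) = (u, v, i, 0, 0) [^]\<^bsub>gam e'\<^esub> (4 :: nat)"
      using \<theta>.hom_int_pow[OF Q_mem, of 1 0 0 4] int_pow_int[of "gam e'" "(u, v, i, 0, 0)" 4] q x by simp
    then obtain u' v' where "\<theta> (0, 0, 4, 0, 0) = (u', v', 4 * i, 0, 0)" using step[of 4] by auto
    from \<theta>_action[OF this m] show ?thesis by simp
  qed
  define \<nu> where "\<nu> = (if i = 1 then 1 else - chi (-4) 0)"
  have \<nu>: "chi (4 * i) 0 - 1 = phi * \<nu>"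
  proof (cases "i = 1")
    case False
    then have "i = -1" using i by simp
    then show ?thesis by (simp add: \<nu>_def phi_def left_diff_distrib chi_mult)
  qed (simp add: \<nu>_def phi_def)
  have "\<theta> (phi * f, phi * g, 0, 0, 0) = (phi * \<nu> * s', phi * \<nu> * t', 0, 0, 0)"
    if m: "(f, g, 0, 0, 0) \<in> carrier (gam e)" "\<theta> (f, g, 0, 0, 0) = (s', t', 0, 0, 0)" for f g s' t'
  proof -
    have "(chi 4 0 * f, chi 4 0 * g, 0, 0, 0) \<in> carrier (gam e)"
      using m(1) gam_action_closed[OF e, of f g 4 0 0] unfolding gam_carrier by (simp add: BR_mult BR_chi)
    from \<theta>_diff[OF this m(1) act4[OF m] m(2)] show ?thesis
      unfolding \<nu>[symmetric] by (simp only: phi_def left_diff_distrib mult_1_left)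
  qed
  moreover have "\<nu> \<in> BR" unfolding \<nu>_def by (auto intro: BR_closed)
  moreover have "\<nu> \<noteq> 0"
  proof -
    have "\<nu> 2 \<noteq> 0" by (simp add: \<nu>_def)
    then show ?thesis by auto
  qed
  ultimately show ?thesis by blast
qed

lemma \<theta>_split:
  assumes t: "\<theta> (0, phi, 0, 0, 0) = (0, t, 0, 0, 0)" and "f \<in> BR" "g \<in> BR"
    and f': "\<theta> (phi * f, 0, 0, 0, 0) = (s', 0, 0, 0, 0)" and g': "\<theta> (0, phi * g, 0, 0, 0) = (0, t', 0, 0, 0)"
  shows "\<theta> (phi * f, phi * g, 0, 0, 0) = (s', t', 0, 0, 0)"
proof -
  have "(phi * f, phi * g, 0, 0, 0) = (phi * f, 0, 0, 0, 0) \<otimes>\<^bsub>gam e\<^esub> (0, phi * g, 0, 0, 0)" by (simp add: gam_mult)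
  then have "\<theta> (phi * f, phi * g, 0, 0, 0) = \<theta> (phi * f, 0, 0, 0, 0) \<otimes>\<^bsub>gam e'\<^esub> \<theta> (0, phi * g, 0, 0, 0)"
    using phi_mem phiB_I assms(2,3) by simp
  then show ?thesis using f' g' by (simp add: gam_mult)
qed

lemma \<theta>_zero: "(f, g, 0, 0, 0) \<in> carrier (gam e) \<Longrightarrow> \<theta> (f, g, 0, 0, 0) = (0, 0, 0, 0, 0) \<Longrightarrow> f = 0 \<and> g = 0"
  using \<theta>_inj[of "(f, g, 0, 0, 0)" "\<one>\<^bsub>gam e\<^esub>"] \<theta>.hom_one \<theta>.G.one_closed by (simp add: gam_one)

text \<open>Here \<open>s = \<phi> \<epsilon>1\<close> and \<open>t = \<phi> \<epsilon>2\<close>;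
  that \<open>(\<phi>, 0)\<close> and \<open>(0, \<phi>)\<close> are attained makes
  \<open>\<epsilon>1\<close> and \<open>\<epsilon>2\<close> units. Multiplication by \<phi> moves
  \<open>(e, 1)\<close> into the sum of the axes, where \<open>\<theta>\<close> is known, and the
  congruence satisfied by the image of \<open>(e, 1)\<close> becomes the relation.\<close>

theorem unit_relation:
  assumes k: "e = of_nat k"
  shows "\<exists>\<epsilon>1\<in>BR. \<exists>\<delta>1\<in>BR. \<exists>\<epsilon>2\<in>BR. \<exists>\<delta>2\<in>BR.
    \<epsilon>1 * \<delta>1 = 1 \<and> \<epsilon>2 * \<delta>2 = 1 \<and> e * \<epsilon>1 - e' * \<epsilon>2 \<in> phiB"
proof -
  obtain t where t: "\<theta> (0, phi, 0, 0, 0) = (0, t, 0, 0, 0)" "t \<in> phiB" "t \<noteq> 0" using second_axis by blast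
  obtain \<nu> where \<nu>: "\<nu> \<in> BR" "\<nu> \<noteq> 0" and act: "\<And>f g s' t'. (f, g, 0, 0, 0) \<in> carrier (gam e) \<Longrightarrow>
      \<theta> (f, g, 0, 0, 0) = (s', t', 0, 0, 0) \<Longrightarrow>
      \<theta> (phi * f, phi * g, 0, 0, 0) = (phi * \<nu> * s', phi * \<nu> * t', 0, 0, 0)"
    using phi_action by blast
  obtain \<epsilon>1 where \<epsilon>1: "\<epsilon>1 \<in> BR" "s = phi * \<epsilon>1" using s_phiB by (rule phiB_E)
  obtain \<epsilon>2 where \<epsilon>2: "\<epsilon>2 \<in> BR" "t = phi * \<epsilon>2" using t(2) by (rule phiB_E)
  note cancel = BR_cancel[OF phi_BR _ _ phi_not_0]
  have split: "\<exists>f'\<in>BR. \<exists>g'\<in>BR. \<theta> (phi * f, 0, 0, 0, 0) = (s * f', 0, 0, 0, 0) \<and>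
      \<theta> (0, phi * g, 0, 0, 0) = (0, t * g', 0, 0, 0) \<and> \<theta> (phi * f, phi * g, 0, 0, 0) = (s * f', t * g', 0, 0, 0)"
    if "f \<in> BR" "g \<in> BR" for f g
    using \<theta>_multiples[OF that(1)] \<theta>_multiples2[OF t(1) that(2)] \<theta>_split[OF t(1) that] by blast
  have "\<exists>\<delta>\<in>BR. \<epsilon>1 * \<delta> = 1"
  proof -
    have "(phi, 0, 0, 0, 0) \<in> carrier (gam e')"
      unfolding gam_carrier using phi_phiB phi_BR by (simp only: mult_zero_right diff_0_right BR_closed simp_thms)
    then obtain f g where fg: "\<theta> (f, g, 0, 0, 0) = (phi, 0, 0, 0, 0)" "f \<in> BR" "g \<in> BR" "f - e * g \<in> phiB"
      by (rule \<theta>_module_preimage)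
    have m: "(f, g, 0, 0, 0) \<in> carrier (gam e)" using fg by (simp add: gam_carrier)
    obtain f' g' where f'g': "g' \<in> BR" "\<theta> (0, phi * g, 0, 0, 0) = (0, t * g', 0, 0, 0)"
        "\<theta> (phi * f, phi * g, 0, 0, 0) = (s * f', t * g', 0, 0, 0)"
      using split[OF fg(2,3)] by blast
    \<comment> \<open>The image of \<open>\<phi> (f, g)\<close> has second coordinate 0, so the
      preimage of \<open>(\<phi>, 0)\<close> lies on the first axis.\<close>
    have "t * g' = 0" using act[OF m fg(1)] f'g'(3) by simp
    then have "\<theta> (0, phi * g, 0, 0, 0) = (0, 0, 0, 0, 0)" using f'g'(2) by (simp only:)
    then have "phi * g = 0" using \<theta>_zero[OF phi_mem(2)[OF phiB_I[OF fg(3)]]] by blast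
    then have g0: "g = 0" using BR_mult_eq_0[OF phi_BR fg(3)] phi_not_0 by blast
    then have "f \<in> phiB" using fg(4) by (simp only: mult_zero_right diff_0_right)
    then obtain f0 where f0: "f0 \<in> BR" "f = phi * f0" by (rule phiB_E)
    obtain \<delta> where \<delta>: "\<delta> \<in> BR" "\<theta> (phi * f0, 0, 0, 0, 0) = (s * \<delta>, 0, 0, 0, 0)" using \<theta>_multiples[OF f0(1)] by blast
    have "phi * 1 = phi * (\<epsilon>1 * \<delta>)" using \<delta>(2) fg(1) unfolding g0 f0(2) \<epsilon>1(2) by (simp add: mult.assoc)
    then have "1 = \<epsilon>1 * \<delta>" by (rule cancel[rotated 2]) (intro BR_closed \<epsilon>1 \<delta>)+
    then show ?thesis using \<delta>(1) by metis
  qed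
  moreover have "\<exists>\<delta>\<in>BR. \<epsilon>2 * \<delta> = 1"
  proof -
    have "0 - e' * phi \<in> phiB" using e' phi_phiB by (intro phiB_closed)
    then have "(0, phi, 0, 0, 0) \<in> carrier (gam e')"
      unfolding gam_carrier using phi_BR by (simp only: BR_closed simp_thms)
    then obtain f g where fg: "\<theta> (f, g, 0, 0, 0) = (0, phi, 0, 0, 0)" "f \<in> BR" "g \<in> BR" "f - e * g \<in> phiB"
      by (rule \<theta>_module_preimage)
    have m: "(f, g, 0, 0, 0) \<in> carrier (gam e)" using fg by (simp add: gam_carrier)
    obtain f' g' where f'g': "f' \<in> BR" "\<theta> (phi * f, 0, 0, 0, 0) = (s * f', 0, 0, 0, 0)"
        "\<theta> (phi * f, phi * g, 0, 0, 0) = (s * f', t * g', 0, 0, 0)"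
      using split[OF fg(2,3)] by blast
    have "s * f' = 0" using act[OF m fg(1)] f'g'(3) by simp
    then have "\<theta> (phi * f, 0, 0, 0, 0) = (0, 0, 0, 0, 0)" using f'g'(2) by (simp only:)
    then have "phi * f = 0" using \<theta>_zero[OF phi_mem(1)[OF phiB_I[OF fg(2)]]] by blast
    then have f0: "f = 0" using BR_mult_eq_0[OF phi_BR fg(2)] phi_not_0 by blast
    then have "e * g \<in> phiB" using phiB_uminus[OF fg(4)] by (simp only: diff_0 minus_minus)
    then have "g \<in> phiB" by (rule units_mod_phi[OF fg(3) e ec c])
    then obtain g0 where g0: "g0 \<in> BR" "g = phi * g0" by (rule phiB_E)
    obtain \<delta> where \<delta>: "\<delta> \<in> BR" "\<theta> (0, phi * g0, 0, 0, 0) = (0, t * \<delta>, 0, 0, 0)"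
      using \<theta>_multiples2[OF t(1) g0(1)] by blast
    have "phi * 1 = phi * (\<epsilon>2 * \<delta>)" using \<delta>(2) fg(1) unfolding f0 g0(2) \<epsilon>2(2) by (simp add: mult.assoc)
    then have "1 = \<epsilon>2 * \<delta>" by (rule cancel[rotated 2]) (intro BR_closed \<epsilon>2 \<delta>)+
    then show ?thesis using \<delta>(1) by metis
  qed
  moreover have "e * \<epsilon>1 - e' * \<epsilon>2 \<in> phiB"
  proof -
    have b: "(e, 1, 0, 0, 0) \<in> carrier (gam e)"
      unfolding gam_carrier using e by (simp only: mult_1_right diff_self BR_closed phiB_closed)
    obtain s' t' where st: "\<theta> (e, 1, 0, 0, 0) = (s', t', 0, 0, 0)" "s' \<in> BR" "t' \<in> BR" "s' - e' * t' \<in> phiB"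
      using \<theta>_module[OF b] by blast
    \<comment> \<open>Integer multiples are respected by additivity. This is where \<open>e\<close>
      has to be a natural number: multiplication by a general element of \<open>B\<close> may be
      changed by \<open>\<theta>\<close>.\<close>
    have mult: "\<theta> (phi * of_nat n, 0, 0, 0, 0) = (s * of_nat n, 0, 0, 0, 0)" for n
    proof (induction n)
      case 0
      show ?case using \<theta>.hom_one by (simp only: gam_one of_nat_0 mult_zero_right)
    next
      case (Suc n)
      have "(phi * of_nat (Suc n), 0, 0, 0, 0) = (phi, 0, 0, 0, 0) \<otimes>\<^bsub>gam e\<^esub> (phi * of_nat n, 0, 0, 0, 0)"
        by (simp only: gam_mult of_nat_Suc distrib_left mult_1_right chi_0 mult_1_left mult_zero_right add_0_right)
      then have "\<theta> (phi * of_nat (Suc n), 0, 0, 0, 0) = (s, 0, 0, 0, 0) \<otimes>\<^bsub>gam e'\<^esub> (s * of_nat n, 0, 0, 0, 0)"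
        using phi_mem(1)[OF phi_phiB] phi_mem(1)[OF phiB_I[OF BR_of_nat]] by (simp only: \<theta>.hom_mult first Suc)
      then show ?case
        by (simp only: gam_mult of_nat_Suc distrib_left mult_1_right chi_0 mult_1_left mult_zero_right add_0_right)
    qed
    have "\<theta> (phi * e, phi * 1, 0, 0, 0) = (s * e, t, 0, 0, 0)"
      by (rule \<theta>_split[OF t(1) e BR_1]) (use mult t(1) in \<open>simp_all only: k mult_1_right\<close>)
    then have "phi * \<nu> * s' = s * e" "phi * \<nu> * t' = t" using act[OF b st(1)] by simp_all
    then have "phi * (\<nu> * s') = phi * (e * \<epsilon>1)" "phi * (\<nu> * t') = phi * \<epsilon>2"
      unfolding \<epsilon>1(2) \<epsilon>2(2) by (simp_all only: mult_ac)
    then have "\<nu> * s' = e * \<epsilon>1" "\<nu> * t' = \<epsilon>2"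
      by - (rule cancel[rotated 2], assumption, intro BR_closed \<nu> st e \<epsilon>1 \<epsilon>2, intro BR_closed \<nu> st e \<epsilon>1 \<epsilon>2)+
    then have "e * \<epsilon>1 - e' * \<epsilon>2 = \<nu> * (s' - e' * t')"
      by (simp only: right_diff_distrib mult.left_commute[of e' \<nu> t'] flip: \<open>\<nu> * s' = e * \<epsilon>1\<close> \<open>\<nu> * t' = \<epsilon>2\<close>)
    then show ?thesis using phiB_mult[OF \<nu>(1) st(4)] by (simp only:)
  qed
  ultimately show ?thesis using \<epsilon>1(1) \<epsilon>2(1) by blast
qed

end

end

text \<open>Exchanging the coordinates exchanges the exponents \<open>i\<close> and
  \<open>i + 4 r\<close> of \<open>x\<close> by which an element acts on them, so \<open>r\<close>
  changes sign. Read from the other side, the congruence of \<open>f\<close> and \<open>e g\<close>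
  is one of \<open>g\<close> and \<open>c f\<close>.\<close>

lemma swap_iso:
  assumes e: "e \<in> BR" and c: "c \<in> BR" and ec: "e * c - 1 \<in> phiB"
  shows "(\<lambda>(f, g, i, j, r). (g, f, i + 4 * r, j, - r)) \<in> iso (gam e) (gam c)"
proof -
  let ?s = "\<lambda>(f, g, i, j, r). (g, f, i + 4 * r, j, - r) :: gelt"
  have mem: "?s a \<in> carrier (gam c)"
    if e: "e \<in> BR" and c: "c \<in> BR" and ec: "e * c - 1 \<in> phiB" and a: "a \<in> carrier (gam e)" for e c a
  proof -
    obtain f g i j r where fg: "a = (f, g, i, j, r)" "f \<in> BR" "g \<in> BR" "f - e * g \<in> phiB"
      using a by (rule gam_mem_E)
    have "g - c * f = - (c * (f - e * g)) - g * (e * c - 1)" by (simp add: algebra_simps)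
    then have "g - c * f \<in> phiB" using fg c ec by (simp only: phiB_closed)
    then show ?thesis using fg by (simp add: gam_carrier)
  qed
  have ce: "c * e - 1 \<in> phiB" using ec by (simp only: mult.commute)
  have "?s \<in> hom (gam e) (gam c)"
  proof (rule homI)
    show "?s a \<in> carrier (gam c)" if "a \<in> carrier (gam e)" for a by (rule mem[OF e c ec that])
    show "?s (a \<otimes>\<^bsub>gam e\<^esub> b) = ?s a \<otimes>\<^bsub>gam c\<^esub> ?s b" for a b
      by (cases a; cases b) (simp add: gam_mult)
  qed
  moreover have "bij_betw ?s (carrier (gam e)) (carrier (gam c))"
    by (rule bij_betw_byWitness[where f' = ?s]) (use mem[OF e c ec] mem[OF c e ce] in auto)
  ultimately show ?thesis by (simp add: iso_def)
qed

section \<open>Absolute values of units and the role of powers of two\<close>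

lemma power_int_inj:
  fixes b :: real
  assumes "b > 1" "b powi m = b powi n"
  shows "m = n"
  using assms power_int_strict_increasing[of m n b] power_int_strict_increasing[of n m b]
  by (cases m n rule: linorder_cases) auto

lemma phiB_vanishes:
  assumes "f \<in> phiB"
  shows "f 0 = 0" "f 1 = 0"
proof -
  have "phi 0 = 0" "phi 1 = 0" by (simp_all add: phi_def chi_def pt_def)
  then show "f 0 = 0" "f 1 = 0" using assms by (auto elim!: phiB_E)
qed

text \<open>
  A unit \<open>\<plusminus>x^i (1+x)^j\<close> has absolute value \<open>2^j\<close> at \<open>1\<close> and \<open>2^(j/2)\<close> at \<open>\<i>\<close>, whereas a
  power of \<open>2\<close> has the same absolute value at both points.
\<close>

lemma unit_relation_exponents:
  assumes "\<epsilon>1 \<in> BR" "\<delta>1 \<in> BR" "\<epsilon>2 \<in> BR" "\<delta>2 \<in> BR" "\<epsilon>1 * \<delta>1 = 1" "\<epsilon>2 * \<delta>2 = 1"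
    and rel: "of_nat (2 ^ k) * \<epsilon>1 - e * \<epsilon>2 \<in> phiB"
    and e: "e 0 = 2 powi m" "e 1 = 2 powi m"
  shows "int k = m"
proof -
  obtain i1 j1 s1 where 1: "s1 = 1 \<or> s1 = -1" "\<And>n. \<epsilon>1 n = s1 * chi i1 j1 n"
    using BR_unit[OF assms(1,2,5)] by blast
  obtain i2 j2 s2 where 2: "s2 = 1 \<or> s2 = -1" "\<And>n. \<epsilon>2 n = s2 * chi i2 j2 n"
    using BR_unit[OF assms(3,4,6)] by blast
  have ns: "norm s1 = 1" "norm s2 = 1" using 1 2 by auto
  have n1: "norm (chi i j 1) = 2 powi j" for i j by (simp add: chi_def pt_def norm_mult norm_power_int)
  have "norm (1 + \<i>) = sqrt 2" by (simp add: cmod_def)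
  then have n0: "norm (chi i j 0) = sqrt 2 powi j" for i j
    by (simp add: chi_def pt_def norm_mult norm_power_int)
  have "2 ^ k * \<epsilon>1 n = e n * \<epsilon>2 n" if "n = 0 \<or> n = 1" for n
    using phiB_vanishes[OF rel] that by (auto simp: of_nat_fun)
  then have eq: "2 ^ k * (s1 * chi i1 j1 n) = 2 powi m * (s2 * chi i2 j2 n)" if "n = 0 \<or> n = 1" for n
    using that e 1(2) 2(2) by auto
  have norm: "2 ^ k * norm (chi i1 j1 n) = 2 powi m * norm (chi i2 j2 n)" if "n = 0 \<or> n = 1" for n
    using arg_cong[OF eq[OF that], of norm] unfolding norm_mult ns norm_power norm_power_int by simp
  \<comment> \<open>The points 1 and \<i> give two independent linear equations in
    \<open>k - m\<close> and \<open>j1 - j2\<close>, so both differences vanish.\<close>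
  have "(2 :: real) powi (int k + j1) = 2 powi (m + j2)"
    using norm[of 1] unfolding n1 by (simp add: power_int_add)
  then have a: "int k + j1 = m + j2" by (rule power_int_inj[rotated]) simp
  have "sqrt 2 powi (2 * int k + j1) = sqrt 2 powi (2 * m + j2)"
    using norm[of 0] unfolding n0 by (simp add: power_int_add power_int_mult)
  then have "2 * int k + j1 = 2 * m + j2" by (rule power_int_inj[rotated]) simp
  then show ?thesis using a by simp
qed

text \<open>
  From \<open>(1 + x)^4 - \<phi> = 2 (2x^3 + 3x^2 + 2x + 1)\<close>.
\<close>

definition half :: "nat \<Rightarrow> complex"
  where "half = (2 * chi 3 0 + 3 * chi 2 0 + 2 * chi 1 0 + 1) * chi 0 (-4)"

lemma half_BR: "half \<in> BR"
  unfolding half_def by (intro BR_closed)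

lemma two_half: "2 * half = 1 - phi * chi 0 (-4)"
proof -
  have poly: "2 * (2 * z ^ 3 + 3 * z\<^sup>2 + 2 * z + 1) = (1 + z) ^ 4 - (z ^ 4 - 1)" for z :: complex
    by (simp add: power4_eq_xxxx power3_eq_cube power2_eq_square algebra_simps)
  have "(2 * half) n = (1 - phi * chi 0 (-4)) n" for n
  proof -
    let ?z = "pt n" and ?c = "chi 0 (-4) n"
    have c: "(1 + ?z) ^ 4 * ?c = 1" by (simp add: chi_def power_int_minus)
    have "(2 * half) n = 2 * (2 * ?z ^ 3 + 3 * ?z\<^sup>2 + 2 * ?z + 1) * ?c"
      by (simp add: half_def) (simp add: chi_def)
    also have "\<dots> = (1 + ?z) ^ 4 * ?c - (?z ^ 4 - 1) * ?c" unfolding poly by (rule left_diff_distrib)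
    also have "\<dots> = (1 - phi * chi 0 (-4)) n" unfolding c by (simp add: phi_def) (simp add: chi_def)
    finally show ?thesis .
  qed
  then show ?thesis by blast
qed

lemma power_two_half: "\<exists>h\<in>BR. of_nat (2 ^ l) * half ^ l = 1 - phi * h"
proof (induction l)
  case 0
  show ?case by (rule bexI[OF _ BR_0]) simp
next
  case (Suc l)
  then obtain h where h: "h \<in> BR" "of_nat (2 ^ l) * half ^ l = 1 - phi * h" by blast
  have "of_nat (2 ^ Suc l) * half ^ Suc l = (2 * half) * (of_nat (2 ^ l) * half ^ l)"
    by (simp only: power_Suc of_nat_mult of_nat_numeral mult_ac)
  also have "\<dots> = (1 - phi * chi 0 (-4)) * (1 - phi * h)" by (simp only: two_half h(2))
  also have "\<dots> = 1 - phi * (chi 0 (-4) + h - phi * chi 0 (-4) * h)"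
    by (simp only: algebra_simps) simp
  finally show ?case using h(1) phi_BR by (intro bexI[of _ "chi 0 (-4) + h - phi * chi 0 (-4) * h"] BR_closed)
qed

text \<open>Both points are zeros of \<phi>, where \<open>half\<close> is an exact inverse of
  2.\<close>

lemma half_values:
  assumes "n = 0 \<or> n = 1"
  shows "(half ^ l) n = 2 powi (- int l)"
proof -
  have "phi n = 0" using phiB_vanishes[OF phiB_I[OF BR_1]] assms by auto
  then have "2 * half n = 1" using fun_cong[OF two_half, of n] by simp
  then have "half n = 1 / 2" by (simp add: field_simps)
  then show ?thesis unfolding fun_power_apply by (simp only:) (simp add: power_int_minus power_divide inverse_eq_divide)
qed

theorem gam_not_iso:
  assumes "gam (of_nat (2 ^ k)) \<cong> gam (of_nat (2 ^ l))"
  shows "k = l"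
proof -
  have BR: "of_nat (2 ^ m) \<in> BR" "half ^ m \<in> BR" for m by (rule BR_of_nat, rule BR_power[OF half_BR])
  have inv: "of_nat (2 ^ m) * half ^ m - 1 \<in> phiB" for m
  proof -
    obtain h where h: "h \<in> BR" "of_nat (2 ^ m) * half ^ m = 1 - phi * h" using power_two_half by blast
    have "of_nat (2 ^ m) * half ^ m - 1 = - (phi * h)" unfolding h(2) by simp
    then show ?thesis using h(1) by (simp only: phiB_uminus phiB_I)
  qed
  have inv': "half ^ m * of_nat (2 ^ m) - 1 \<in> phiB" for m using inv[of m] by (simp only: mult.commute)
  obtain \<theta> where \<theta>: "\<theta> \<in> iso (gam (of_nat (2 ^ k))) (gam (of_nat (2 ^ l)))"
    using assms by (auto simp: is_iso_def)
  interpret gam_iso "of_nat (2 ^ k)" "half ^ k" "of_nat (2 ^ l)" "half ^ l" \<theta>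
    by unfold_locales (intro BR inv \<theta>)+
  obtain s t where st: "\<theta> (phi, 0, 0, 0, 0) = (s, t, 0, 0, 0)"
    using \<theta>_module[OF phi_mem(1)[OF phi_phiB]] by blast
  show ?thesis
  proof (cases "t = 0")
    case True
    then obtain \<epsilon>1 \<delta>1 \<epsilon>2 \<delta>2 where u: "\<epsilon>1 \<in> BR" "\<delta>1 \<in> BR" "\<epsilon>2 \<in> BR" "\<delta>2 \<in> BR" "\<epsilon>1 * \<delta>1 = 1" "\<epsilon>2 * \<delta>2 = 1"
        "of_nat (2 ^ k) * \<epsilon>1 - of_nat (2 ^ l) * \<epsilon>2 \<in> phiB"
      using unit_relation[of s "2 ^ k"] st by blast
    have "int k = int l" by (rule unit_relation_exponents[OF u]) (simp_all add: of_nat_fun)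
    then show ?thesis by simp
  next
    case False
    then have s: "s = 0" using axis[OF st] by blast
    let ?sw = "\<lambda>(f, g, i, j, r). (g, f, i + 4 * r, j, - r) :: gelt"
    have "?sw \<circ> \<theta> \<in> iso (gam (of_nat (2 ^ k))) (gam (half ^ l))"
      by (rule iso_set_trans[OF \<theta> swap_iso[OF BR inv]])
    then interpret sw: gam_iso "of_nat (2 ^ k)" "half ^ k" "half ^ l" "of_nat (2 ^ l)" "?sw \<circ> \<theta>"
      by unfold_locales (intro BR inv inv')+
    have "(?sw \<circ> \<theta>) (phi, 0, 0, 0, 0) = (t, 0, 0, 0, 0)" using st s by simp
    then obtain \<epsilon>1 \<delta>1 \<epsilon>2 \<delta>2 where u: "\<epsilon>1 \<in> BR" "\<delta>1 \<in> BR" "\<epsilon>2 \<in> BR" "\<delta>2 \<in> BR" "\<epsilon>1 * \<delta>1 = 1" "\<epsilon>2 * \<delta>2 = 1"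
        "of_nat (2 ^ k) * \<epsilon>1 - half ^ l * \<epsilon>2 \<in> phiB"
      using sw.unit_relation[of t "2 ^ k"] by blast
    \<comment> \<open>After the swap the second parameter is the inverse of \<open>2^l\<close>
      modulo \<phi>, with values \<open>2^(-l)\<close>, hence the sign; as \<open>k\<close> and
      \<open>l\<close> are natural numbers, both are 0.\<close>
    have "int k = - int l" by (rule unit_relation_exponents[OF u]) (intro half_values, simp)+
    then show ?thesis by simp
  qed
qed

theorem corollary1p2:
  shows "\<exists>\<Gamma> :: nat monoid.
    finitely_presented \<Gamma> \<and> residually_finite \<Gamma> \<and>
    countable (profinite_genus \<Gamma>) \<and> infinite (profinite_genus \<Gamma>)"
proof -
  let ?e = "\<lambda>k :: nat. of_nat (2 ^ k) :: nat \<Rightarrow> complex"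
  have e: "?e k \<in> BR" for k by (rule BR_of_nat)
  \<comment> \<open>The genus is made of groups on the natural numbers, so isomorphic copies of the
    groups are taken there.\<close>
  have "\<forall>k. \<exists>H :: nat monoid. group H \<and> gam (?e k) \<cong> H"
    using finitely_generated_nat_copy[OF finitely_generated_gam[OF e]] by blast
  then obtain H :: "nat \<Rightarrow> nat monoid" where H: "\<And>k. group (H k)" "\<And>k. gam (?e k) \<cong> H k" by metis
  have HG: "H k \<cong> gam (?e k)" for k by (rule group.iso_sym[OF group_gam[OF e] H(2)])
  have fg: "finitely_generated (H k)" for k
  proof -
    obtain h where h: "h \<in> iso (gam (?e k)) (H k)" using H(2) by (auto simp: is_iso_def)
    then have "group_hom (gam (?e k)) (H k) h" "h ` carrier (gam (?e k)) = carrier (H k)"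
      using group_gam[OF e] H(1) by (auto simp: group_hom_def group_hom_axioms_def iso_def bij_betw_def)
    then show ?thesis using finitely_generated_image finitely_generated_gam[OF e] by blast
  qed
  have rf: "residually_finite (H k)" for k
    by (rule residually_finite_iso[OF residually_finite_gam[OF e] H(1) HG])
  let ?\<Gamma> = "H 0"
  have e0: "?e 0 = 1" by simp
  have prof: "isomorphic_profinite_completions (H k) ?\<Gamma>" for k
  proof -
    obtain h where h: "h \<in> BR" "?e k * half ^ k = 1 - phi * h" using power_two_half by blast
    have 1: "isomorphic_profinite_completions (gam 1) (gam (?e k))"
      by (rule isomorphic_profinite_completions_gam[OF e BR_power[OF half_BR] h])
    note trans = isomorphic_profinite_completions_trans and of_iso = isomorphic_profinite_completions_of_iso
    \<comment> \<open>The chain is \<open>H k\<close>, \<open>gam (2^k)\<close>,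
      \<open>gam 1\<close>, \<open>H 0\<close>; its outer links come from isomorphisms of groups,
      the middle one from the limits of scalings.\<close>
    show ?thesis
      by (rule trans[OF of_iso[OF H(1) group_gam[OF e] HG]],
          rule trans[OF isomorphic_profinite_completions_sym[OF 1 group_gam[OF BR_1]]])
        (use of_iso[OF group_gam[OF e] H(1) H(2)[of 0]] e0 in simp)
  qed
  have mem: "H k \<in> genus_groups ?\<Gamma>" for k using fg rf prof by (simp add: genus_groups_def)
  let ?R = "{(G, K). G \<in> genus_groups ?\<Gamma> \<and> K \<in> genus_groups ?\<Gamma> \<and> G \<cong> K}"
  have "inj (\<lambda>k. ?R `` {H k})"
  proof (rule injI)
    fix k l assume eq: "?R `` {H k} = ?R `` {H l}"
    have "H l \<in> ?R `` {H l}" using mem by (auto intro: iso_refl)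
    then have "H k \<cong> H l" using eq by blast
    then have "gam (?e k) \<cong> gam (?e l)" using iso_trans[OF iso_trans[OF H(2)] HG] by blast
    then show "k = l" by (rule gam_not_iso)
  qed
  moreover have "range (\<lambda>k. ?R `` {H k}) \<subseteq> profinite_genus ?\<Gamma>"
    unfolding profinite_genus_def using quotientI[OF mem] by blast
  ultimately have "infinite (profinite_genus ?\<Gamma>)"
    using finite_subset[of "range (\<lambda>k. ?R `` {H k})"] finite_imageD[of _ "UNIV :: nat set"] by blast
  moreover have "finitely_presented ?\<Gamma>"
  proof -
    obtain X :: "nat set" and R where X: "finite X" "finite R" "R \<subseteq> carrier (free_group X)"
      "gam 1 \<cong> free_group X Mod normal_closure (free_group X) R"
      using finitely_presented_gam unfolding finitely_presented_def by blast
    then have "?\<Gamma> \<cong> free_group X Mod normal_closure (free_group X) R"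
      using iso_trans[OF HG[of 0]] e0 by metis
    then show ?thesis using X(1-3) H(1) unfolding finitely_presented_def by blast
  qed
  moreover have "metabelian ?\<Gamma>"
  proof -
    obtain h where h: "h \<in> iso ?\<Gamma> (gam (?e 0))" using HG[of 0] unfolding is_iso_def by blast
    show ?thesis
      by (rule metabelian_embedding[OF _ _ metabelian_gam[OF e[of 0]]])
        (use h H(1) group_gam[OF e[of 0]] in \<open>auto simp: group_hom_def group_hom_axioms_def iso_def bij_betw_def\<close>)
  qed
  ultimately show ?thesis using countable_profinite_genus[OF H(1)] rf by blast
qed

end
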